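(* Let $d\ge1$, $0<q<2$, $K(z)=-|z|^q$ on $\mathbb R^d$. Assume one of the following: (i) $d+q-2>0$ and $p_c<p\le\infty$, where $p_c:=d/(d+q-2)$; (ii) $d=q=1$ and $p=\infty$; (iii) $d=1$, $0<q<1$, and $1/q<p\le\infty$. Let $\mu\in\mathcal P_{\max\{1,q\}}(\mathbb R^d)\cap L^p(\mathbb R^d)$ be a probability density. For $N\ge2$ set $$\mathcal D_N:=\{(x_i)_{i\in[N]}\in(\mathbb R^d)^N:\ x_i\ne x_j\text{ for all distinct }i,j\in[N]\}.$$ Let $X_N^0\in\mathcal D_N$ and consider the particle system $$\dot x_i^t=-\frac1N\sum_{j\in[N]\setminus\{i\}}\nabla K(x_i^t-x_j^t)+\nabla(K*\mu)(x_i^t),\qquad i\in[N],\tag{P}$$ with initial configuration $X_N^0$. In cases (i) and (ii), (P) has a unique solution $X_N\in C^1([0,\infty);\mathcal D_N)$. In case (iii), (P) has at least one solution in $C^1([0,\infty);\mathcal D_N)$, and every maximal-lifespan $C^1$ solution with values in $\mathcal D_N$ is global. Moreover, every such global solution satisfies $$\sup_{t\ge0}\max_{i\in[N]}|x_i^t|<\infty,\qquad \inf_{t\ge0}\min_{i\ne j}|x_i^t-x_j^t|>0.$$ Its $\omega$-limit set $\omega(X_N):=\bigcap_{T\ge0}\overline{\{X_N^t:t\ge T\}}$ is nonempty, compact, and connected, and, with $\operatorname{Crit}_{\mathcal D_N}\mathcal E_N:=\{X_N\in\mathcal D_N:\nabla\mathcal E_N(X_N)=0\}$, $$\omega(X_N)\subset\operatorname{Crit}_{\mathcal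 D_N}\mathcal E_N\cap\{\mathcal E_N=\mathcal E_N^\infty\},\qquad \mathcal E_N^\infty:=\lim_{t\to\infty}\mathcal E_N(X_N^t).$$ Consequently, $\operatorname{dist}\bigl(X_N^t,\operatorname{Crit}_{\mathcal D_N}\mathcal E_N\bigr)\to0$ as $t\to\infty$.
   Context: $[N]=\{1,\dots,N\}$. $\mathcal P_s(\mathbb R^d)$ is the set of Borel probability measures with finite $s$-th moment; absolutely continuous measures are identified with their densities. $\nabla K(z)=-q|z|^{q-2}z$ for $z\ne0$. For a configuration $X_N=(x_i)_{i\in[N]}$ with empirical measure $\rho^N:=\frac1N\sum_{i=1}^N\delta_{x_i}$, the particle energy with target $\mu$ is $$\mathcal E_N(X_N):=\frac12\iint_{(\mathbb R^d)^2}K(x-y)\,\mathrm d(\rho^N-\mu)(x)\,\mathrm d(\rho^N-\mu)(y),$$ and $\nabla\mathcal E_N$ is its gradient on $\mathcal D_N\subset(\mathbb R^d)^N$. The closure and the distance are Euclidean in $(\mathbb R^d)^N$. Since $K$ has growth $q$ and $\mu\in\mathcal P_q(\mathbb R^d)$, $\mathcal E_N$ is finite. The field $\nabla(K*\mu)=\nabla K*\mu$ is $x\mapsto\int\nabla K(x-y)\,\mathrm d\mu(y)$. *)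

theory Defs
  imports "HOL-Probability.Probability"
begin

text \<open>
  Points live in an arbitrary Euclidean space \<open>'a\<close> of dimension \<open>d = DIM('a)\<close>; a configuration of
  \<open>N = CARD('n)\<close> particles is an element of \<open>'a ^ 'n\<close>, whose norm is the Euclidean one.
\<close>

definition prob_moment :: "real \<Rightarrow> 'a::euclidean_space measure set" where
  "prob_moment s =
     {\<mu>. prob_space \<mu> \<and> sets \<mu> = sets borel \<and> integrable \<mu> (\<lambda>x. norm x powr s)}"

text \<open>The following is meant for exponents \<open>0 < p\<close>, with \<open>p = \<infinity>\<close> allowed.\<close>

definition in_Lp :: "ereal \<Rightarrow> ('a::euclidean_space \<Rightarrow> real) \<Rightarrow> bool" where
  "in_Lp p f \<longleftrightarrow> f \<in> borel_measurable lborel \<and>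
     (if p = \<infinity> then \<exists>C. AE x in lborel. \<bar>f x\<bar> \<le> C
      else integrable lborel (\<lambda>x. \<bar>f x\<bar> powr real_of_ereal p))"

definition Lp_measures :: "ereal \<Rightarrow> 'a::euclidean_space measure set" where
  "Lp_measures p = {\<mu>. \<exists>f. (\<forall>x. 0 \<le> f x) \<and> in_Lp p f \<and> \<mu> = density lborel (\<lambda>x. ennreal (f x))}"

definition case_i :: "nat \<Rightarrow> real \<Rightarrow> ereal \<Rightarrow> bool" where
  "case_i d q p \<longleftrightarrow> real d + q - 2 > 0 \<and> ereal (real d / (real d + q - 2)) < p \<and> p \<le> \<infinity>"

definition case_ii :: "nat \<Rightarrow> real \<Rightarrow> ereal \<Rightarrow> bool" where
  "case_ii d q p \<longleftrightarrow> d = 1 \<and> q = 1 \<and> p = \<infinity>"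

definition case_iii :: "nat \<Rightarrow> real \<Rightarrow> ereal \<Rightarrow> bool" where
  "case_iii d q p \<longleftrightarrow> d = 1 \<and> 0 < q \<and> q < 1 \<and> ereal (1 / q) < p \<and> p \<le> \<infinity>"

definition kernel :: "real \<Rightarrow> 'a::euclidean_space \<Rightarrow> real" where
  "kernel q z = - (norm z powr q)"

text \<open>At \<open>z = 0\<close> this formula takes the conventional value \<open>0\<close>.\<close>

definition grad_kernel :: "real \<Rightarrow> 'a::euclidean_space \<Rightarrow> 'a" where
  "grad_kernel q z = - (q * norm z powr (q - 2)) *\<^sub>R z"

lemma GDERIV_kernel:
  fixes z :: "'a::euclidean_space"
  assumes "z \<noteq> 0"
  shows "GDERIV (kernel q) z :> grad_kernel q z"
proof -
  have "GDERIV norm z :> sgn z"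
    using assms by (rule GDERIV_norm)
  moreover have "DERIV (\<lambda>r. - (r powr q)) (norm z) :> - (q * norm z powr (q - 1))"
    using assms by (auto intro!: derivative_eq_intros)
  ultimately have "GDERIV (\<lambda>z. - (norm z powr q)) z :> - (q * norm z powr (q - 1)) *\<^sub>R sgn z"
    by (rule GDERIV_DERIV_compose)
  moreover have "norm z powr (q - 1) / norm z = norm z powr (q - 2)"
    using assms powr_diff[of "norm z" "q - 1" 1] by simp
  ultimately show ?thesis
    by (simp add: kernel_def[abs_def] grad_kernel_def sgn_div_norm divide_inverse mult.assoc)
qed

definition distinct_configs :: "('a::euclidean_space ^ 'n::finite) set" where
  "distinct_configs = {X. \<forall>i j. i \<noteq> j \<longrightarrow> X $ i \<noteq> X $ j}"

definition empirical :: "'a::euclidean_space ^ 'n::finite \<Rightarrow> 'a measure" where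
  "empirical X = distr (uniform_count_measure UNIV) borel (\<lambda>i. X $ i)"

lemma emeasure_empirical:
  fixes X :: "'a::euclidean_space ^ 'n::finite"
  assumes "A \<in> sets borel"
  shows "emeasure (empirical X) A =
           ennreal ((1 / real CARD('n)) * (\<Sum>i\<in>UNIV. measure (return borel (X $ i)) A))"
proof -
  have "(\<Sum>i\<in>UNIV. measure (return borel (X $ i)) A) = (\<Sum>i\<in>UNIV. indicator A (X $ i))"
    using assms by (simp add: measure_return)
  also have "\<dots> = real (card {i. X $ i \<in> A})"
    by (simp add: indicator_def sum.If_cases)
  finally show ?thesis
    using assms unfolding empirical_def
    by (subst emeasure_distr)
       (auto simp: measurable_def space_uniform_count_measure sets_uniform_count_measure
          emeasure_uniform_count_measure vimage_def)
qed

text \<open>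
  The integral against the signed measure \<open>\<rho> - \<mu>\<close>, for \<open>f\<close> integrable with respect to both.
\<close>

definition integral_diff :: "'a measure \<Rightarrow> 'a measure \<Rightarrow> ('a \<Rightarrow> real) \<Rightarrow> real" where
  "integral_diff \<rho> \<mu> f = integral\<^sup>L \<rho> f - integral\<^sup>L \<mu> f"

definition particle_energy ::
    "real \<Rightarrow> 'a::euclidean_space measure \<Rightarrow> 'a ^ 'n::finite \<Rightarrow> real" where
  "particle_energy q \<mu> X =
     1 / 2 * integral_diff (empirical X) \<mu>
               (\<lambda>y. integral_diff (empirical X) \<mu> (\<lambda>x. kernel q (x - y)))"

definition critical_configs ::
    "real \<Rightarrow> 'a::euclidean_space measure \<Rightarrow> ('a ^ 'n::finite) set" where
  "critical_configs q \<mu> = {X \<in> distinct_configs. GDERIV (particle_energy q \<mu>) X :> 0}"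

definition velocity ::
    "real \<Rightarrow> 'a::euclidean_space measure \<Rightarrow> 'a ^ 'n::finite \<Rightarrow> 'a ^ 'n" where
  "velocity q \<mu> X =
     (\<chi> i. - ((1 / real CARD('n)) *\<^sub>R (\<Sum>j\<in>UNIV - {i}. grad_kernel q (X $ i - X $ j)))
          + (LINT y|\<mu>. grad_kernel q (X $ i - y)))"

text \<open>Derivatives are taken within \<open>I\<close>, hence one-sided at an endpoint belonging to \<open>I\<close>.\<close>

definition C1_on :: "real set \<Rightarrow> (real \<Rightarrow> 'b::real_normed_vector) \<Rightarrow> bool" where
  "C1_on I X \<longleftrightarrow>
     (\<exists>V. (\<forall>t\<in>I. (X has_vector_derivative V t) (at t within I)) \<and> continuous_on I V)"

definition particle_solution ::
    "real \<Rightarrow> 'a::euclidean_space measure \<Rightarrow> 'a ^ 'n::finite \<Rightarrow> real set \<Rightarrow> (real \<Rightarrow> 'a ^ 'n) \<Rightarrow> bool"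
  where
  "particle_solution q \<mu> X0 I X \<longleftrightarrow>
     C1_on I X \<and> (\<forall>t\<in>I. X t \<in> distinct_configs) \<and> X 0 = X0 \<and>
     (\<forall>t\<in>I. (X has_vector_derivative velocity q \<mu> (X t)) (at t within I))"

definition lifespan :: "ereal \<Rightarrow> real set" where
  "lifespan T = {t. 0 \<le> t \<and> ereal t < T}"

lemma lifespan_infinity: "lifespan \<infinity> = {0..}"
  by (auto simp: lifespan_def)

definition maximal_particle_solution ::
    "real \<Rightarrow> 'a::euclidean_space measure \<Rightarrow> 'a ^ 'n::finite \<Rightarrow> ereal \<Rightarrow> (real \<Rightarrow> 'a ^ 'n) \<Rightarrow> bool"
  where
  "maximal_particle_solution q \<mu> X0 T X \<longleftrightarrow>
     0 < T \<and> particle_solution q \<mu> X0 (lifespan T) X \<and>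
     \<not> (\<exists>T' Y. T < T' \<and> particle_solution q \<mu> X0 (lifespan T') Y \<and>
               (\<forall>t\<in>lifespan T. Y t = X t))"

definition omega_limit :: "(real \<Rightarrow> 'b::topological_space) \<Rightarrow> 'b set" where
  "omega_limit X = (\<Inter>T\<in>{0..}. closure (X ` {T..}))"

end

theory Submission
  imports Defs "HOL-Complex_Analysis.Great_Picard"
begin

text \<open>
  The system is, up to the factor \<open>N\<close>, the gradient flow of the particle energy: on configurations without
  collisions the gradient of \<open>E_N\<close> is \<open>- 1 / N\<close> times the velocity
  (\<open>GDERIV_particle_energy\<close>). Hence the energy decreases along solutions, at rate \<open>|velocity|\<^sup>2 / N\<close>, and
  the theorem follows from three properties: the energy controls the size of a configuration, particles cannot
  approach each other, and the force exerted by the target is regular enough.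

  \<^bold>\<open>Regularity.\<close> In each of the three cases there are an exponent \<open>0 < \<beta> \<le> 1\<close> with \<open>\<beta> > q - 1\<close> and a bound,
  uniform in \<open>x\<close>, for \<open>\<integral> |x - y| powr (q - 1 - \<beta>) d\<mu>(y)\<close> (\<open>subcritical_holder_exponent\<close>). This single estimate is
  all that the integrability exponent \<open>p\<close> is used for. It makes the field \<open>\<nabla>K * \<mu>\<close> Hoelder continuous of exponent \<open>\<beta>\<close>
  and identifies it as the gradient of \<open>K * \<mu>\<close>. In case (i) one can take \<open>\<beta> = 1\<close>, so the field is Lipschitz; in
  case (ii) the kernel is concave, so the field is one-sided Lipschitz. Either suffices for uniqueness.

  \<^bold>\<open>Coercivity.\<close> For large configurations the energy is governed by the energy of \<open>\<rho>\<^sup>N - \<delta>\<^sub>0\<close>. That one is homogeneous of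
  degree \<open>q\<close> and strictly positive unless all particles sit at the origin (\<open>sum_pair_norm_powr_less\<close>), because
  \<open>|z| powr q\<close> is a mixture of the functions \<open>1 - exp (- s |z|\<^sup>2)\<close> and Gaussians are positive definite. By compactness of
  the sphere the energy grows at least like \<open>|X| powr q\<close> (\<open>particle_energy_coercive\<close>).

  \<^bold>\<open>Separation.\<close> For a cluster \<open>C\<close> of particles consider the sum of the squared mutual distances. The
  repulsion inside \<open>C\<close> increases it at a rate comparable to the \<open>q\<close>-th powers of the distances; if all
  other particles are at distance \<open>\<delta>\<close> or more, everything else contributes only \<open>r\<^sup>2\<close> and \<open>r powr (1 + \<beta>)\<close>, which are of
  higher order since \<open>2 > q\<close> and \<open>1 + \<beta> > q\<close>. So an isolated cluster expands once it is small
  (\<open>isolated_cluster_expands\<close>). Descending induction on the number of particles in \<open>C\<close> gives lower bounds for all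
  clusters, in particular for pairs, that depend only on the initial configuration and not on time
  (\<open>cluster_spread_lower_bound\<close>).

  Consequently all solutions starting at \<open>X0\<close> remain in one compact set of separated configurations
  (\<open>solutions_stay_separated\<close>). Global existence follows by extending the velocity from a slightly larger compact set
  to a bounded continuous field, applying Peano's theorem, and observing that the resulting curve cannot leave the
  set. A solution on a bounded half-open interval has a limit in the compact set and can be continued from there.
  The statements on the \<open>\<omega>\<close>-limit set follow by LaSalle's argument: near a point of nonzero velocity the trajectory
  would lose a fixed amount of energy at each of infinitely many visits.
\<close>

section \<open>Ordinary differential equations with continuous right-hand side\<close>

text \<open>
  For a negative bound the interval is empty and the integral is \<open>0\<close>. The estimate therefore covers
  the delayed integrals below without a case distinction at time \<open>h\<close>.
\<close>
lemma integral_upto_diff_le: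
  fixes G :: "real \<Rightarrow> 'b::euclidean_space"
  assumes "continuous_on UNIV G" "\<And>s. norm (G s) \<le> M" "a \<le> b"
  shows "norm (integral {0..b} G - integral {0..a} G) \<le> M * (b - a)"
proof -
  have M0: "0 \<le> M" using assms(2)[of 0] norm_ge_zero order_trans by blast
  have int: "G integrable_on {c..d}" for c d
    using assms(1) by (intro integrable_continuous_real) (auto intro: continuous_on_subset)
  have bd: "norm (integral {c..d} G) \<le> M * (d - c)" if "c \<le> d" for c d
    using integral_bound[of c d G M] that assms
    by (auto intro: continuous_on_subset)
  consider "0 \<le> a" | "a < 0" "0 \<le> b" | "b < 0" by linarith
  then show ?thesis
  proof cases
    case 1
    have "integral {0..b} G - integral {0..a} G = integral {a..b} G"
      using Henstock_Kurzweil_Integration.integral_combine[of 0 a b G] 1 assms(3) int by (simp add: algebra_simps)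
    then show ?thesis using bd[of a b] assms(3) by simp
  next
    case 2
    then have "norm (integral {0..b} G - integral {0..a} G) \<le> M * b" using bd[of 0 b] by simp
    also have "\<dots> \<le> M * (b - a)" using 2 M0 by (intro mult_left_mono) auto
    finally show ?thesis .
  next
    case 3
    then show ?thesis using assms(3) M0 by simp
  qed
qed

text \<open>
  Tonelli's approximation \<open>x t = x0 + \<integral>\<^bsub>0\<^esub>\<^bsup>t - h\<^esup> F (x s) ds\<close> of the flow of \<open>F\<close>, reached by iteration: the delay \<open>h\<close>
  makes the \<open>k\<close>-th iterate stationary up to time \<open>(k + 1) h\<close>.
\<close>
primrec delayed_flow :: "('b::euclidean_space \<Rightarrow> 'b) \<Rightarrow> 'b \<Rightarrow> real \<Rightarrow> nat \<Rightarrow> real \<Rightarrow> 'b" where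
  "delayed_flow F x0 h 0 = (\<lambda>t. x0)"
| "delayed_flow F x0 h (Suc k) = (\<lambda>t. x0 + integral {0..t - h} (\<lambda>s. F (delayed_flow F x0 h k s)))"

lemma delayed_flow_lipschitz:
  assumes F: "continuous_on UNIV F" "\<And>x. norm (F x) \<le> M"
  shows "norm (delayed_flow F x0 h k t - delayed_flow F x0 h k s) \<le> M * \<bar>t - s\<bar>"
proof (induction k arbitrary: s t)
  case 0
  have "0 \<le> M" using F(2)[of 0] norm_ge_zero order_trans by blast
  then show ?case by simp
next
  case (Suc k)
  have "M-lipschitz_on UNIV (delayed_flow F x0 h k)"
    using Suc F(2)[of 0] by (auto simp: lipschitz_on_def dist_norm intro: order_trans[OF norm_ge_zero])
  then have "continuous_on UNIV (delayed_flow F x0 h k)"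
    by (rule lipschitz_on_continuous_on)
  then have c: "continuous_on UNIV (\<lambda>s. F (delayed_flow F x0 h k s))"
    by (rule continuous_on_compose2[OF F(1)]) auto
  have *: "norm (delayed_flow F x0 h (Suc k) t - delayed_flow F x0 h (Suc k) s) \<le> M * (t - s)" if "s \<le> t" for s t
    using integral_upto_diff_le[OF c F(2), of "s - h" "t - h"] that by simp
  show ?case
    using *[of s t] *[of t s] by (cases "s \<le> t") (auto simp: norm_minus_commute)
qed

lemma delayed_flow_continuous:
  assumes F: "continuous_on UNIV F" "\<And>x. norm (F x) \<le> M"
  shows "continuous_on A (delayed_flow F x0 h k)"
proof -
  have "M-lipschitz_on UNIV (delayed_flow F x0 h k)"
    using delayed_flow_lipschitz[OF F] F(2)[of 0]
    by (auto simp: lipschitz_on_def dist_norm intro: order_trans[OF norm_ge_zero])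
  then show ?thesis
    using lipschitz_on_continuous_on continuous_on_subset by blast
qed

lemma delayed_flow_stationary:
  assumes "0 < h" "t \<le> real (Suc k) * h"
  shows "delayed_flow F x0 h (Suc k) t = delayed_flow F x0 h k t"
  using assms(2)
proof (induction k arbitrary: t)
  case 0
  show ?case
  proof (cases "t = h")
    case False
    then show ?thesis using 0 by simp
  qed simp
next
  case (Suc k)
  have "integral {0..t - h} (\<lambda>s. F (delayed_flow F x0 h (Suc k) s)) =
        integral {0..t - h} (\<lambda>s. F (delayed_flow F x0 h k s))"
  proof (rule Henstock_Kurzweil_Integration.integral_cong)
    fix s assume "s \<in> {0..t - h}"
    then have "s \<le> real (Suc k) * h" using Suc.prems by (simp add: algebra_simps)
    then show "F (delayed_flow F x0 h (Suc k) s) = F (delayed_flow F x0 h k s)"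
      using Suc.IH[of s] by presburger
  qed
  then show ?case by simp
qed

text \<open>
  The delayed solutions with \<open>h = 1 / n\<close> share the Lipschitz constant \<open>M\<close>, so by the Arzela--Ascoli theorem a
  subsequence converges uniformly. The delay alters the integral by at most \<open>M h\<close> and disappears in the limit.
\<close>
lemma peano_unit_interval:
  fixes F :: "'b::euclidean_space \<Rightarrow> 'b"
  assumes F: "continuous_on UNIV F" "\<And>x. norm (F x) \<le> M"
  shows "\<exists>X. X 0 = x0 \<and> (\<forall>t\<in>{0..1}. (X has_vector_derivative F (X t)) (at t within {0..1}))"
proof -
  have M0: "0 \<le> M" using F(2)[of 0] norm_ge_zero order_trans by blast
  define h :: "nat \<Rightarrow> real" where "h n = 1 / real (Suc n)" for n
  define \<phi> where "\<phi> n = delayed_flow F x0 (h n) (Suc n)" for n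
  have hpos: "0 < h n" for n by (simp add: h_def)
  have lip: "norm (\<phi> n t - \<phi> n s) \<le> M * \<bar>t - s\<bar>" for n s t
    unfolding \<phi>_def by (rule delayed_flow_lipschitz[OF F])
  have cont: "continuous_on A (\<phi> n)" for A n
    unfolding \<phi>_def by (rule delayed_flow_continuous[OF F])
  have cF: "continuous_on A (\<lambda>s. F (\<phi> n s))" for A n
    by (rule continuous_on_compose2[OF F(1) cont]) auto
  have eq: "\<phi> n t = x0 + integral {0..t - h n} (\<lambda>s. F (\<phi> n s))" if "t \<le> 1" for n t
  proof -
    have "1 \<le> real (Suc (Suc n)) * h n" by (simp add: h_def)
    with that have "t \<le> real (Suc (Suc n)) * h n" by linarith
    from delayed_flow_stationary[OF hpos this, of F x0] show ?thesis
      unfolding \<phi>_def by (metis delayed_flow.simps(2))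
  qed
  have phi0: "\<phi> n 0 = x0" for n
    using eq[of 0 n] hpos[of n] by simp
  have bd: "norm (\<phi> n t) \<le> norm x0 + M" if "t \<in> {0..1}" for n t
  proof -
    have "norm (\<phi> n t - x0) \<le> M * \<bar>t\<bar>" using lip[of n t 0] phi0 by simp
    also have "\<dots> \<le> M" using that M0 by (simp add: mult_left_le)
    finally show ?thesis using norm_triangle_ineq2[of "\<phi> n t" x0] by linarith
  qed
  have equi: "\<exists>d. 0 < d \<and> (\<forall>n y. y \<in> {0..1} \<and> norm (x - y) < d \<longrightarrow> norm (\<phi> n x - \<phi> n y) < e)"
    if "0 < e" for x e
  proof (intro exI conjI allI impI)
    show "0 < e / (M + 1)" using that M0 by simp
    fix n y assume "y \<in> {0..1::real} \<and> norm (x - y) < e / (M + 1)"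
    then have "(M + 1) * \<bar>x - y\<bar> < e" using M0 by (simp add: field_simps)
    moreover have "norm (\<phi> n x - \<phi> n y) \<le> M * \<bar>x - y\<bar>" by (rule lip)
    ultimately show "norm (\<phi> n x - \<phi> n y) < e" 
      using abs_ge_zero[of "x - y"] by (simp add: algebra_simps)
  qed
  obtain X r where X: "continuous_on {0..1} X" "strict_mono (r :: nat \<Rightarrow> nat)"
    and conv: "\<And>e. 0 < e \<Longrightarrow> \<exists>N. \<forall>n x. n \<ge> N \<and> x \<in> {0..1} \<longrightarrow> norm (\<phi> (r n) x - X x) < e"
    using Arzela_Ascoli[of "{0..1}" \<phi> "norm x0 + M"] bd equi by blast
  have lim: "(\<lambda>n. \<phi> (r n) t) \<longlonglongrightarrow> X t" if "t \<in> {0..1}" for t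
    unfolding LIMSEQ_iff using conv that by blast
  have "isCont F x" for x using F(1) by (simp add: continuous_on_eq_continuous_at)
  then have limF: "(\<lambda>n. F (\<phi> (r n) t)) \<longlonglongrightarrow> F (X t)" if "t \<in> {0..1}" for t
    using lim[OF that] isCont_tendsto_compose by blast
  have hr: "(\<lambda>n. h (r n)) \<longlonglongrightarrow> 0"
  proof -
    have "h \<longlonglongrightarrow> 0" unfolding h_def by (rule LIMSEQ_Suc[OF lim_1_over_n])
    then show ?thesis using X(2) LIMSEQ_subseq_LIMSEQ[of h 0 r] by (simp add: o_def)
  qed
  have Xint: "X t = x0 + integral {0..t} (\<lambda>s. F (X s))" if t: "t \<in> {0..1}" for t
  proof -
    have i1: "(\<lambda>n. integral {0..t} (\<lambda>s. F (\<phi> (r n) s))) \<longlonglongrightarrow> integral {0..t} (\<lambda>s. F (X s))"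
      using t by (intro dominated_convergence(2)[where h = "\<lambda>_. M"] limF integrable_continuous_real cF F(2)) auto
    have i2: "(\<lambda>n. \<phi> (r n) t - (x0 + integral {0..t} (\<lambda>s. F (\<phi> (r n) s)))) \<longlonglongrightarrow> 0"
    proof (rule Lim_null_comparison)
      show "\<forall>\<^sub>F n in sequentially. norm (\<phi> (r n) t - (x0 + integral {0..t} (\<lambda>s. F (\<phi> (r n) s)))) \<le> M * h (r n)"
      proof (rule always_eventually, rule allI)
        fix n
        show "norm (\<phi> (r n) t - (x0 + integral {0..t} (\<lambda>s. F (\<phi> (r n) s)))) \<le> M * h (r n)"
          using integral_upto_diff_le[OF cF F(2), of "t - h (r n)" t "r n"] hpos[of "r n"] t eq[of t "r n"]
          by (simp add: norm_minus_commute)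
      qed
      show "(\<lambda>n. M * h (r n)) \<longlonglongrightarrow> 0" using tendsto_mult_right_zero[OF hr] by simp
    qed
    have "(\<lambda>n. \<phi> (r n) t - (x0 + integral {0..t} (\<lambda>s. F (\<phi> (r n) s)))) \<longlonglongrightarrow> X t - (x0 + integral {0..t} (\<lambda>s. F (X s)))"
      by (intro tendsto_intros lim[OF t] i1)
    with i2 have "X t - (x0 + integral {0..t} (\<lambda>s. F (X s))) = 0" by (rule LIMSEQ_unique[rotated])
    then show ?thesis by simp
  qed
  have cFX: "continuous_on {0..1} (\<lambda>s. F (X s))"
    by (rule continuous_on_compose2[OF F(1) X(1)]) auto
  have "(X has_vector_derivative F (X t)) (at t within {0..1})" if t: "t \<in> {0..1}" for t
  proof -
    have "((\<lambda>u. x0 + integral {0..u} (\<lambda>s. F (X s))) has_vector_derivative F (X t)) (at t within {0..1})"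
      using has_vector_derivative_add[OF has_vector_derivative_const integral_has_vector_derivative[OF cFX t], of x0]
      by simp
    then show ?thesis
      by (rule has_vector_derivative_transform[OF t, rotated]) (use Xint in auto)
  qed
  moreover have "X 0 = x0" using Xint[of 0] by simp
  ultimately show ?thesis by blast
qed

text \<open>
  The interval \<open>I\<close> on which the second solution continues may be bounded, as in the proof of Peano's theorem, or
  unbounded, as in the continuation of a maximal solution.
\<close>
lemma has_vector_derivative_concat:
  fixes X Y :: "real \<Rightarrow> 'b::euclidean_space"
  assumes T: "0 \<le> T" and I: "I = {T..S} \<or> I = {T..}"
    and X: "\<And>t. t \<in> {0..T} \<Longrightarrow> (X has_vector_derivative V (X t)) (at t within {0..T})"
    and Y: "\<And>t. t + T \<in> I \<Longrightarrow> (Y has_vector_derivative V (Y t)) (at t within (\<lambda>t. t - T) ` I)"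
    and XY: "Y 0 = X T"
    and Z: "\<And>t. Z t = (if t \<le> T then X t else Y (t - T))"
    and t: "t \<in> {0..T} \<union> I"
  shows "(Z has_vector_derivative V (Z t)) (at t within {0..T} \<union> I)"
proof -
  have cl: "{0..T} \<union> closure {0..T} \<inter> closure I = {0..T}" "I \<union> closure {0..T} \<inter> closure I = I"
    using I by auto
  have X': "(X has_vector_derivative V (X t)) (at t within {0..T} \<union> closure {0..T} \<inter> closure I)"
    if "t \<in> {0..T} \<union> closure {0..T} \<inter> closure I"
    using X that unfolding cl by blast
  have Y': "((\<lambda>t. Y (t - T)) has_vector_derivative V (Y (t - T))) (at t within I \<union> closure {0..T} \<inter> closure I)"
    if "t \<in> I \<union> closure {0..T} \<inter> closure I"
  proof -
    have "t \<in> I" using that unfolding cl .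
    then have "(Y has_vector_derivative V (Y (t - T))) (at (t - T) within (\<lambda>t. t - T) ` I)"
      using Y[of "t - T"] by simp
    moreover have "((\<lambda>t. t - T) has_vector_derivative 1) (at t within I)"
      by (auto intro!: derivative_eq_intros)
    ultimately show ?thesis
      using vector_diff_chain_within[of "\<lambda>t. t - T" 1 t I Y "V (Y (t - T))"] unfolding cl by (simp add: o_def)
  qed
  have "((\<lambda>t. if t \<in> {0..T} then X t else Y (t - T)) has_vector_derivative
         (if t \<in> {0..T} then V (X t) else V (Y (t - T)))) (at t within {0..T} \<union> I)"
    by (rule has_vector_derivative_If_within_closures[where f = X and f' = "\<lambda>t. V (X t)" and
        g = "\<lambda>t. Y (t - T)" and g' = "\<lambda>t. V (Y (t - T))", OF t refl X' Y']) (use I T XY in auto)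
  then have "((\<lambda>t. if t \<in> {0..T} then X t else Y (t - T)) has_vector_derivative V (Z t)) (at t within {0..T} \<union> I)"
    using t Z I T by (auto split: if_splits)
  then show ?thesis
    by (rule has_vector_derivative_transform[OF t, rotated]) (use Z I T in auto)
qed

text \<open>
  Solutions on unit intervals are chained by dependent choice; no uniqueness is available to glue them otherwise.
\<close>
lemma peano_global:
  fixes F :: "'b::euclidean_space \<Rightarrow> 'b"
  assumes F: "continuous_on UNIV F" "\<And>x. norm (F x) \<le> M"
  shows "\<exists>X. X 0 = x0 \<and> (\<forall>t\<in>{0..}. (X has_vector_derivative F (X t)) (at t within {0..}))"
proof -
  define P where "P n X \<longleftrightarrow> X 0 = x0 \<and> (\<forall>t\<in>{0..real n}. (X has_vector_derivative F (X t)) (at t within {0..real n}))"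
    for n X
  have "\<exists>Z. \<forall>n. P n (Z n) \<and> (\<forall>t\<in>{0..real n}. Z (Suc n) t = Z n t)"
  proof (rule dependent_nat_choice)
    show "\<exists>X. P 0 X"
      by (rule exI[of _ "\<lambda>_. x0"]) (auto simp: P_def has_vector_derivative_def has_derivative_within_singleton_iff bounded_linear_scaleR_left)
  next
    fix X n assume P: "P n X"
    obtain Y where Y: "Y 0 = X (real n)" "\<And>t. t\<in>{0..1} \<Longrightarrow> (Y has_vector_derivative F (Y t)) (at t within {0..1})"
      using peano_unit_interval[OF F] by blast
    let ?Z = "\<lambda>t. if t \<le> real n then X t else Y (t - real n)"
    have "(?Z has_vector_derivative F (?Z t)) (at t within {0..real n} \<union> {real n..real n + 1})"
      if "t \<in> {0..real n} \<union> {real n..real n + 1}" for t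
      by (rule has_vector_derivative_concat[where S = "real n + 1" and X = X and Y = Y])
         (use P Y that in \<open>auto simp: P_def\<close>)
    moreover have "{0..real n} \<union> {real n..real n + 1} = {0..real (Suc n)}" by auto
    ultimately have "P (Suc n) ?Z" using P by (auto simp: P_def)
    then show "\<exists>Z. P (Suc n) Z \<and> (\<forall>t\<in>{0..real n}. Z t = X t)" by (intro exI[of _ ?Z]) auto
  qed
  then obtain Z where Z: "\<And>n. P n (Z n)" "\<And>n t. t \<in> {0..real n} \<Longrightarrow> Z (Suc n) t = Z n t" by blast
  have stab: "Z m t = Z n t" if "n \<le> m" "t \<in> {0..real n}" for m n t
    using that by (induction m rule: dec_induct) (use Z(2) in auto)
  define X where "X t = Z (nat \<lceil>t\<rceil>) t" for t
  have XZ: "X t = Z n t" if "t \<in> {0..real n}" for n t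
    unfolding X_def by (rule stab[symmetric]) (use that of_nat_ceiling[of t] in \<open>auto simp: nat_le_iff ceiling_le_iff\<close>)
  have "(X has_vector_derivative F (X t)) (at t within {0..})" if "t \<in> {0..}" for t
  proof -
    obtain n :: nat where n: "t < real n" using reals_Archimedean2 by blast
    have tn: "t \<in> {0..real n}" using that n by simp
    then have "(Z n has_vector_derivative F (Z n t)) (at t within {0..real n})"
      using Z(1)[of n] by (simp only: P_def)
    then have "(X has_vector_derivative F (X t)) (at t within {0..real n})"
      unfolding XZ[OF tn, symmetric]
      by (rule has_vector_derivative_transform[OF tn, rotated]) (rule XZ)
    moreover have "at t within {0..real n} = at t within {0..}"
      by (rule at_within_nhd[of t "{..<real n}"]) (use that n in auto)
    ultimately show ?thesis by simp
  qed
  moreover have "X 0 = x0" using XZ[of 0 0] Z(1)[of 0] by (simp add: P_def)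
  ultimately show ?thesis by blast
qed

text \<open>
  At a minimum of \<open>u\<close> below the barrier the derivative would be positive, so \<open>u\<close> would be smaller just before.
\<close>
lemma lower_barrier:
  fixes u :: "real \<Rightarrow> real"
  assumes u: "\<And>t. t \<in> {0..T} \<Longrightarrow> (u has_real_derivative u' t) (at t within {0..T})"
    and pos: "\<And>t. t \<in> {0..T} \<Longrightarrow> u t < c \<Longrightarrow> 0 < u' t"
    and c: "c \<le> u 0" and t: "t \<in> {0..T}"
  shows "c \<le> u t"
proof (rule ccontr)
  assume "\<not> c \<le> u t"
  have "continuous_on {0..T} u"
    by (rule DERIV_continuous_on) (rule u)
  moreover have "{0..T} \<noteq> {}" using t by force
  ultimately obtain s where s: "s \<in> {0..T}" "\<And>r. r \<in> {0..T} \<Longrightarrow> u s \<le> u r"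
    using continuous_attains_inf[of "{0..T}" u] by auto
  have "u s < c" using s(2)[OF t] \<open>\<not> c \<le> u t\<close> by simp
  then have "0 < s" using c s(1) by (cases "s = 0") auto
  obtain d where d: "0 < d" "\<And>h. 0 < h \<Longrightarrow> s - h \<in> {0..T} \<Longrightarrow> h < d \<Longrightarrow> u (s - h) < u s"
    using has_real_derivative_pos_inc_left[OF u[OF s(1)] pos[OF s(1) \<open>u s < c\<close>]] by blast
  define h where "h = min (d / 2) s"
  have "u (s - h) < u s" by (rule d(2)) (use \<open>0 < s\<close> \<open>0 < d\<close> s(1) in \<open>auto simp: h_def\<close>)
  moreover have "u s \<le> u (s - h)" by (rule s(2)) (use \<open>0 < s\<close> \<open>0 < d\<close> s(1) in \<open>auto simp: h_def\<close>)
  ultimately show False by simp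
qed

lemma gronwall_zero:
  fixes u :: "real \<Rightarrow> real"
  assumes u: "\<And>t. t \<in> {0..T} \<Longrightarrow> (u has_real_derivative u' t) (at t within {0..T})"
    and le: "\<And>t. t \<in> {0..T} \<Longrightarrow> u' t \<le> L * u t"
    and u0: "u 0 = 0" and nonneg: "0 \<le> u T" and T: "0 \<le> T"
  shows "u T = 0"
proof (cases "T = 0")
  case False
  then have T: "0 < T" using T by simp
  let ?w = "\<lambda>t. exp (- (L * t)) * u t"
  have "?w T \<le> ?w 0"
  proof (rule DERIV_nonpos_imp_decreasing_open[OF T[THEN less_imp_le]])
    fix t assume t: "0 < t" "t < T"
    have "at t within {0..T} = at t" by (rule at_within_Icc_at) (use t in auto)
    then have "(u has_real_derivative u' t) (at t)" using u[of t] t by simp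
    then have "(?w has_real_derivative exp (- (L * t)) * (u' t - L * u t)) (at t)"
      by (auto intro!: derivative_eq_intros simp: algebra_simps)
    moreover have "exp (- (L * t)) * (u' t - L * u t) \<le> 0"
      using le[of t] t by (intro mult_nonneg_nonpos) auto
    ultimately show "\<exists>y. DERIV ?w t :> y \<and> y \<le> 0" by blast
  next
    have "continuous_on {0..T} u"
      by (rule DERIV_continuous_on) (rule u)
    then show "continuous_on {0..T} ?w" by (intro continuous_intros)
  qed
  then have "exp (- (L * T)) * u T \<le> 0" using u0 by simp
  then show ?thesis using nonneg by (simp add: mult_le_0_iff)
qed (use u0 in simp)

section \<open>The power kernel\<close>

lemma grad_kernel_0 [simp]: "grad_kernel q 0 = 0"
  by (simp add: grad_kernel_def)

lemma grad_kernel_minus: "grad_kernel q (- z) = - grad_kernel q z"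
  by (simp add: grad_kernel_def)

lemma grad_kernel_swap: "grad_kernel q (x - y) = - grad_kernel q (y - x)"
  by (metis grad_kernel_minus minus_diff_eq)

lemma norm_grad_kernel:
  assumes "0 < q"
  shows "norm (grad_kernel q z) = q * norm z powr (q - 1)"
proof (cases "z = 0")
  case False
  have "norm z powr (q - 2) * norm z = norm z powr (q - 1)"
    using powr_add[of "norm z" "q - 2" 1] False by (simp add: algebra_simps)
  then show ?thesis using assms by (simp add: grad_kernel_def abs_mult)
qed simp

lemma inner_grad_kernel: "inner z (grad_kernel q z) = - q * norm z powr q"
proof (cases "z = 0")
  case False
  have "norm z powr (q - 2) * (norm z * norm z) = norm z powr q"
    using powr_add[of "norm z" "q - 2" 2] False by (simp add: power2_eq_square)
  then show ?thesis by (simp add: grad_kernel_def dot_square_norm power2_eq_square algebra_simps)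
qed simp

text \<open>
  Since \<open>s \<le> 2\<close>, the difference of powers is at most the one obtained from \<open>1 - (a / b)\<^sup>2\<close>, which factorises.
\<close>
lemma powr_diff_mult_le:
  fixes a b s :: real
  assumes "0 < a" "a \<le> b" "0 \<le> s" "s \<le> 2"
  shows "(a powr (- s) - b powr (- s)) * a \<le> 2 * a powr (- s) * (b - a)"
proof -
  have "(a / b)\<^sup>2 \<le> (a / b) powr s"
    using powr_mono'[of s 2 "a / b"] assms by simp
  also have "(a / b) powr s = a powr s * b powr (- s)"
    using assms by (simp add: powr_divide powr_minus_divide)
  finally have "a powr (- s) * (a / b)\<^sup>2 \<le> a powr (- s) * (a powr s * b powr (- s))"
    by (rule mult_left_mono) simp
  also have "\<dots> = b powr (- s)"
    using assms by (simp add: powr_minus field_simps)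
  finally have "a powr (- s) - b powr (- s) \<le> a powr (- s) * (1 - (a / b)\<^sup>2)"
    by (simp add: algebra_simps)
  also have "1 - (a / b)\<^sup>2 = (1 - a / b) * (1 + a / b)"
    by (simp add: power2_eq_square algebra_simps)
  also have "a powr (- s) * \<dots> \<le> a powr (- s) * ((1 - a / b) * 2)"
    using assms by (intro mult_left_mono) auto
  finally have "(a powr (- s) - b powr (- s)) * a \<le> a powr (- s) * ((1 - a / b) * 2) * a"
    using assms by (intro mult_right_mono) auto
  also have "\<dots> = 2 * a powr (- s) * (b - a) * (a / b)"
    using assms by (simp add: field_simps)
  also have "\<dots> \<le> 2 * a powr (- s) * (b - a) * 1"
    using assms by (intro mult_left_mono) auto
  finally show ?thesis by simp
qed

text \<open>
  The difference splits into a change of the argument, weighted by the smaller factor \<open>|b| powr (q - 2)\<close>, and a change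
  of the factor, applied to the shorter vector \<open>a\<close>.
\<close>
lemma grad_kernel_lipschitz:
  fixes a b :: "'a::euclidean_space"
  assumes q: "0 < q" "q < 2" and a: "a \<noteq> 0" and le: "norm a \<le> norm b"
  shows "norm (grad_kernel q a - grad_kernel q b) \<le> 3 * q * norm a powr (q - 2) * norm (a - b)"
proof -
  let ?A = "norm a powr (q - 2)" and ?B = "norm b powr (q - 2)"
  have BA: "?B \<le> ?A" using le a q by (intro powr_mono2') auto
  have eq: "grad_kernel q a - grad_kernel q b = q *\<^sub>R (?B *\<^sub>R (b - a) - (?A - ?B) *\<^sub>R a)"
    by (simp add: grad_kernel_def algebra_simps)
  have "norm (grad_kernel q a - grad_kernel q b) \<le> q * (norm (?B *\<^sub>R (b - a)) + norm ((?A - ?B) *\<^sub>R a))"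
  proof -
    have "norm (grad_kernel q a - grad_kernel q b) = q * norm (?B *\<^sub>R (b - a) - (?A - ?B) *\<^sub>R a)"
      unfolding eq norm_scaleR[of q] using q by simp
    also have "\<dots> \<le> q * (norm (?B *\<^sub>R (b - a)) + norm ((?A - ?B) *\<^sub>R a))"
      using q by (intro mult_left_mono norm_triangle_ineq4) simp
    finally show ?thesis .
  qed
  also have "\<dots> = q * (?B * norm (a - b) + (?A - ?B) * norm a)"
    using BA by (simp add: norm_minus_commute)
  also have "\<dots> \<le> q * (?A * norm (a - b) + 2 * ?A * (norm b - norm a))"
    using powr_diff_mult_le[of "norm a" "norm b" "2 - q"] a le q BA
    by (intro mult_left_mono add_mono mult_right_mono) (auto)
  also have "\<dots> \<le> q * (?A * norm (a - b) + 2 * ?A * norm (a - b))"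
    using norm_triangle_ineq2[of b a] q by (intro mult_left_mono add_mono) (auto simp: norm_minus_commute)
  finally show ?thesis by (simp add: algebra_simps)
qed

text \<open>
  If \<open>a\<close> and \<open>b\<close> are close compared with their norms, this interpolates the Lipschitz bound with exponent \<open>\<beta>\<close>;
  otherwise both values are already bounded by the right-hand side. At \<open>a = 0\<close> the power in the bound is \<open>0\<close>, and the
  estimate holds there too.
\<close>
lemma grad_kernel_holder:
  fixes a b :: "'a::euclidean_space"
  assumes q: "0 < q" "q < 2" and \<beta>: "0 < \<beta>" "\<beta> \<le> 1" "q - 1 < \<beta>"
  shows "norm (grad_kernel q a - grad_kernel q b)
           \<le> 3 * q * norm (a - b) powr \<beta> * (norm a powr (q - 1 - \<beta>) + norm b powr (q - 1 - \<beta>))"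
proof -
  have main: "norm (grad_kernel q a - grad_kernel q b)
           \<le> 3 * q * norm (a - b) powr \<beta> * (norm a powr (q - 1 - \<beta>) + norm b powr (q - 1 - \<beta>))"
    if le: "norm a \<le> norm b" for a b :: 'a
  proof (cases "a \<noteq> 0 \<and> norm (a - b) \<le> norm a")
    case True
    have "norm (grad_kernel q a - grad_kernel q b) \<le> 3 * q * (norm a powr (q - 2) * norm (a - b))"
      using grad_kernel_lipschitz[OF q _ le] True by (simp add: algebra_simps)
    also have "norm (a - b) = norm (a - b) powr \<beta> * norm (a - b) powr (1 - \<beta>)"
      by (cases "a = b") (simp_all flip: powr_add)
    also have "norm a powr (q - 2) * (norm (a - b) powr \<beta> * norm (a - b) powr (1 - \<beta>))
        \<le> norm a powr (q - 2) * (norm (a - b) powr \<beta> * norm a powr (1 - \<beta>))"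
      using True \<beta> by (intro mult_left_mono powr_mono2) auto
    also have "\<dots> = norm (a - b) powr \<beta> * norm a powr (q - 1 - \<beta>)"
      using True powr_add[of "norm a" "q - 2" "1 - \<beta>"] by (simp add: algebra_simps)
    also have "3 * q * \<dots> \<le> 3 * q * (norm (a - b) powr \<beta> * (norm a powr (q - 1 - \<beta>) + norm b powr (q - 1 - \<beta>)))"
      using q by (intro mult_left_mono) auto
    finally show ?thesis using q by (simp add: algebra_simps)
  next
    case False
    have split: "norm z powr (q - 1) = norm z powr \<beta> * norm z powr (q - 1 - \<beta>)" for z :: 'a
      by (simp flip: powr_add)
    have a: "norm a \<le> norm (a - b)" using False by force
    have b: "norm b \<le> 2 * norm (a - b)"
      using a norm_triangle_ineq2[of b a] by (simp add: norm_minus_commute)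
    have b': "norm b powr \<beta> \<le> 2 * norm (a - b) powr \<beta>"
    proof -
      have "norm b powr \<beta> \<le> (2 * norm (a - b)) powr \<beta>" using b \<beta> by (intro powr_mono2) auto
      also have "\<dots> = 2 powr \<beta> * norm (a - b) powr \<beta>" by (simp add: powr_mult)
      also have "2 powr \<beta> \<le> (2::real) powr 1" using \<beta> by (intro powr_mono) auto
      finally show ?thesis by (simp add: mult_right_mono)
    qed
    have "norm (grad_kernel q a - grad_kernel q b) \<le> q * norm a powr (q - 1) + q * norm b powr (q - 1)"
      using norm_triangle_ineq4[of "grad_kernel q a" "grad_kernel q b"] by (simp add: norm_grad_kernel q)
    also have "\<dots> \<le> q * (norm (a - b) powr \<beta> * norm a powr (q - 1 - \<beta>)) +
        q * (2 * norm (a - b) powr \<beta> * norm b powr (q - 1 - \<beta>))"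
      unfolding split using a b' q \<beta>
      by (intro add_mono mult_left_mono mult_right_mono powr_mono2) auto
    also have "\<dots> \<le> 3 * (q * (norm (a - b) powr \<beta> * norm a powr (q - 1 - \<beta>))) +
        3 * (q * (norm (a - b) powr \<beta> * norm b powr (q - 1 - \<beta>)))"
    proof -
      have "0 \<le> q * (norm (a - b) powr \<beta> * norm a powr (q - 1 - \<beta>))"
        "0 \<le> q * (norm (a - b) powr \<beta> * norm b powr (q - 1 - \<beta>))"
        using q by auto
      then show ?thesis by linarith
    qed
    finally show ?thesis by (simp add: algebra_simps)
  qed
  show ?thesis
  proof (cases "norm a \<le> norm b")
    case False
    then show ?thesis using main[of b a] by (simp add: norm_minus_commute add.commute)
  qed (rule main)
qed

text \<open>
  For \<open>h\<close> small compared with \<open>z\<close> this is the mean value theorem with the Hoelder bound on a segment that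
  stays away from \<open>0\<close>. For larger \<open>h\<close> all three terms on the left are individually small enough, which is how the
  singularity at \<open>0\<close> is crossed without a separate argument.
\<close>
lemma kernel_taylor:
  fixes z h :: "'a::euclidean_space"
  assumes q: "0 < q" "q < 2" and \<beta>: "0 < \<beta>" "\<beta> \<le> 1" "q - 1 < \<beta>" and z: "z \<noteq> 0"
  shows "\<bar>kernel q (z + h) - kernel q z - inner h (grad_kernel q z)\<bar>
           \<le> 60 * norm h powr (1 + \<beta>) * norm z powr (q - 1 - \<beta>)"
proof -
  define e where "e = q - 1 - \<beta>"
  have e: "e < 0" "-2 < e" using q \<beta> by (auto simp: e_def)
  have half: "(r / 2) powr e \<le> 4 * r powr e" if "0 \<le> r" for r :: real
  proof -
    have eq: "(r / 2) powr e = r powr e * 2 powr (- e)"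
      using that by (simp add: powr_divide powr_minus_divide)
    have "2 powr (- e) \<le> (2::real) powr 2" using e by (intro powr_mono) auto
    then have "r powr e * 2 powr (- e) \<le> r powr e * 4" by (intro mult_left_mono) auto
    with eq show ?thesis by simp
  qed
  show ?thesis unfolding e_def[symmetric]
  proof (cases "2 * norm h \<le> norm z")
    case True
    have low: "norm z / 2 \<le> norm (z + t *\<^sub>R h)" if "t \<in> {0..1}" for t
    proof -
      have "norm (t *\<^sub>R h) \<le> norm h" using that by (simp add: mult_left_le_one_le)
      then show ?thesis using norm_diff_ineq[of z "t *\<^sub>R h"] True by linarith
    qed
    have nz: "z + t *\<^sub>R h \<noteq> 0" if "t \<in> {0..1}" for t
      using low[OF that] z by auto
    have "\<exists>t\<in>{0<..<1}. kernel q (z + 1 *\<^sub>R h) - kernel q (z + 0 *\<^sub>R h) =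
        (1 - 0) * inner h (grad_kernel q (z + t *\<^sub>R h))"
    proof (rule mvt_simple)
      fix t :: real assume t: "0 \<le> t" "t \<le> 1"
      have "(kernel q has_derivative (\<lambda>v. inner v (grad_kernel q (z + t *\<^sub>R h)))) (at (z + t *\<^sub>R h))"
        using GDERIV_kernel[OF nz] t by (auto simp: gderiv_def)
      then have "((\<lambda>t. kernel q (z + t *\<^sub>R h)) has_derivative (\<lambda>s. inner (s *\<^sub>R h) (grad_kernel q (z + t *\<^sub>R h)))) (at t within {0..1})"
        by (rule has_derivative_compose[rotated]) (auto intro!: derivative_eq_intros)
      then show "((\<lambda>t. kernel q (z + t *\<^sub>R h)) has_derivative (\<lambda>s. s * inner h (grad_kernel q (z + t *\<^sub>R h)))) (at t within {0..1})"
        by simp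
    qed simp
    then obtain t where t: "0 < t" "t < 1" and
      eq: "kernel q (z + h) - kernel q z = inner h (grad_kernel q (z + t *\<^sub>R h))" by auto
    have "\<bar>kernel q (z + h) - kernel q z - inner h (grad_kernel q z)\<bar> =
        \<bar>inner h (grad_kernel q (z + t *\<^sub>R h) - grad_kernel q z)\<bar>"
      unfolding eq by (simp add: inner_diff_right)
    also have "\<dots> \<le> norm h * norm (grad_kernel q (z + t *\<^sub>R h) - grad_kernel q z)"
      by (rule Cauchy_Schwarz_ineq2)
    also have "\<dots> \<le> norm h * (3 * q * norm (t *\<^sub>R h) powr \<beta> * (norm (z + t *\<^sub>R h) powr e + norm z powr e))"
      using grad_kernel_holder[OF q \<beta>, of "z + t *\<^sub>R h" z] by (intro mult_left_mono) (auto simp: e_def)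
    also have "\<dots> \<le> norm h * (3 * 2 * norm h powr \<beta> * (4 * norm z powr e + norm z powr e))"
    proof -
      have "norm (z + t *\<^sub>R h) powr e \<le> (norm z / 2) powr e"
        using low[of t] t z e by (intro powr_mono2') auto
      also have "\<dots> \<le> 4 * norm z powr e" by (rule half) simp
      finally have "norm (z + t *\<^sub>R h) powr e \<le> 4 * norm z powr e" .
      moreover have "norm (t *\<^sub>R h) powr \<beta> \<le> norm h powr \<beta>"
        using t \<beta> by (intro powr_mono2) (auto simp: mult_left_le_one_le)
      ultimately show ?thesis
        using q by (intro mult_left_mono mult_mono add_mono) auto
    qed
    also have "\<dots> = 30 * norm h powr (1 + \<beta>) * norm z powr e"
      by (cases "h = 0") (simp_all add: powr_add)
    also have "\<dots> \<le> 60 * norm h powr (1 + \<beta>) * norm z powr e"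
      by (intro mult_right_mono) auto
    finally show "\<bar>kernel q (z + h) - kernel q z - inner h (grad_kernel q z)\<bar> \<le> 60 * norm h powr (1 + \<beta>) * norm z powr e" .
  next
    case False
    then have h: "h \<noteq> 0" "norm z / 2 \<le> norm h" by auto
    have pw: "(c * norm h) powr q \<le> c^2 * norm h powr q" if "1 \<le> c" for c :: real
    proof -
      have "(c * norm h) powr q = c powr q * norm h powr q" using that by (simp add: powr_mult)
      also have "c powr q \<le> c powr 2" using that q by (intro powr_mono) auto
      finally show ?thesis using that by (simp add: mult_right_mono)
    qed
    have "norm h powr q = norm h powr (1 + \<beta>) * norm h powr e"
      by (simp add: e_def flip: powr_add)
    also have "\<dots> \<le> norm h powr (1 + \<beta>) * (norm z / 2) powr e"
      using h z e by (intro mult_left_mono powr_mono2') auto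
    also have "\<dots> \<le> norm h powr (1 + \<beta>) * (4 * norm z powr e)"
      by (intro mult_left_mono half) auto
    finally have hq: "norm h powr q \<le> 4 * (norm h powr (1 + \<beta>) * norm z powr e)" by simp
    have "norm (z + h) powr q \<le> (3 * norm h) powr q"
      using norm_triangle_ineq[of z h] h q by (intro powr_mono2) auto
    then have 1: "norm (z + h) powr q \<le> 9 * norm h powr q" using pw[of 3] by simp
    have "norm z powr q \<le> (2 * norm h) powr q" using h q by (intro powr_mono2) auto
    then have 2: "norm z powr q \<le> 4 * norm h powr q" using pw[of 2] by simp
    have "\<bar>inner h (grad_kernel q z)\<bar> \<le> norm h * (q * norm z powr (q - 1))"
      using Cauchy_Schwarz_ineq2[of h "grad_kernel q z"] by (simp add: norm_grad_kernel q)
    also have "norm z powr (q - 1) = norm z powr \<beta> * norm z powr e"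
      by (simp add: e_def flip: powr_add)
    also have "norm h * (q * (norm z powr \<beta> * norm z powr e)) \<le> norm h * (2 * ((2 * norm h powr \<beta>) * norm z powr e))"
    proof -
      have "norm z powr \<beta> \<le> (2 * norm h) powr \<beta>" using h \<beta> by (intro powr_mono2) auto
      also have "\<dots> = 2 powr \<beta> * norm h powr \<beta>" by (simp add: powr_mult)
      also have "2 powr \<beta> \<le> (2::real) powr 1" using \<beta> by (intro powr_mono) auto
      finally have "norm z powr \<beta> \<le> 2 * norm h powr \<beta>" by (simp add: mult_right_mono)
      then show ?thesis using q by (intro mult_left_mono mult_mono) auto
    qed
    also have "\<dots> = 4 * (norm h powr (1 + \<beta>) * norm z powr e)"
      using h by (simp add: powr_add)
    finally have 3: "\<bar>inner h (grad_kernel q z)\<bar> \<le> 4 * (norm h powr (1 + \<beta>) * norm z powr e)" .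
    have "0 \<le> norm h powr (1 + \<beta>) * norm z powr e" "0 \<le> norm (z + h) powr q" "0 \<le> norm z powr q" by auto
    with 1 2 3 hq show "\<bar>kernel q (z + h) - kernel q z - inner h (grad_kernel q z)\<bar> \<le> 60 * norm h powr (1 + \<beta>) * norm z powr e"
      unfolding kernel_def mult.assoc abs_le_iff by linarith
  qed
qed

text \<open>
  For \<open>q \<ge> 1\<close> the kernel is concave, so its gradient is a monotone decreasing field.
\<close>
lemma grad_kernel_antimono:
  fixes a b :: "'a::euclidean_space"
  assumes q: "1 \<le> q"
  shows "inner (grad_kernel q a - grad_kernel q b) (a - b) \<le> 0"
proof -
  let ?a = "norm a" and ?b = "norm b"
  have n: "norm z powr q = norm z * norm z powr (q - 1)" for z :: 'a
    by (cases "z = 0") (simp_all add: powr_diff)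
  have cs: "inner (grad_kernel q x) y \<ge> - (q * norm x powr (q - 1) * norm y)" for x y :: 'a
    using Cauchy_Schwarz_ineq2[of "grad_kernel q x" y] q by (simp add: norm_grad_kernel abs_le_iff)
  have "inner (grad_kernel q a - grad_kernel q b) (a - b) =
      - q * ?a powr q - q * ?b powr q - inner (grad_kernel q a) b - inner (grad_kernel q b) a"
    using inner_grad_kernel[of a q] inner_grad_kernel[of b q]
    by (simp add: inner_diff_left inner_diff_right inner_commute algebra_simps)
  also have "\<dots> \<le> - q * ?a powr q - q * ?b powr q + q * ?a powr (q - 1) * ?b + q * ?b powr (q - 1) * ?a"
    using cs[of a b] cs[of b a] by linarith
  also have "\<dots> = - (q * ((?a powr (q - 1) - ?b powr (q - 1)) * (?a - ?b)))"
    unfolding n by (simp add: algebra_simps)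
  also have "\<dots> \<le> 0"
  proof -
    have "0 \<le> (?a powr (q - 1) - ?b powr (q - 1)) * (?a - ?b)"
    proof (cases "?a \<le> ?b")
      case True
      then have "?a powr (q - 1) \<le> ?b powr (q - 1)" using q by (intro powr_mono2) auto
      then show ?thesis using True by (intro mult_nonpos_nonpos) auto
    next
      case False
      then have "?b powr (q - 1) \<le> ?a powr (q - 1)" using q by (intro powr_mono2) auto
      then show ?thesis using False by (intro mult_nonneg_nonneg) auto
    qed
    then show ?thesis using q by simp
  qed
  finally show ?thesis .
qed

section \<open>Singular potentials of integrable densities\<close>

text \<open>
  On the shell between the radii \<open>2\<^bsup>-k-1\<^esup>\<close> and \<open>2\<^bsup>-k\<^esup>\<close> the integrand is at most \<open>2 powr ((k + 1) \<sigma>)\<close>; bounding the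
  integrand by a sum over balls gives a geometric series of ratio \<open>2 powr (\<sigma> - d)\<close>.
\<close>
lemma nn_integral_power_singularity_finite:
  assumes \<sigma>: "0 \<le> \<sigma>" "\<sigma> < real DIM('a::euclidean_space)"
  shows "(\<integral>\<^sup>+ (z::'a). ennreal (indicator (cball 0 1) z * norm z powr (- \<sigma>)) \<partial>lborel) < \<infinity>"
proof -
  let ?d = "DIM('a)"
  let ?c = "\<lambda>k::nat. 2 powr (real (Suc k) * \<sigma>)" and ?r = "\<lambda>k::nat. (1/2::real) ^ k"
  have le: "ennreal (indicator (cball 0 1) z * norm z powr (- \<sigma>))
      \<le> (\<Sum>k. ennreal (?c k) * indicator (cball 0 (?r k)) z)" for z :: 'a
  proof (cases "z \<noteq> 0 \<and> norm z \<le> 1")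
    case True
    define l where "l = log 2 (1 / norm z)"
    \<comment> \<open>The index of the dyadic shell containing \<open>z\<close>.\<close>
    define k where "k = nat \<lfloor>l\<rfloor>"
    have l: "0 \<le> l" "2 powr l = 1 / norm z" using True by (auto simp: l_def)
    have k: "real k \<le> l" "l \<le> real (Suc k)" using l(1) unfolding k_def by linarith+
    have "2 powr real k \<le> 1 / norm z" using k(1) unfolding l(2)[symmetric] by simp
    then have "norm z \<le> ?r k" using True by (simp add: powr_realpow field_simps)
    then have mem: "z \<in> cball 0 (?r k)" by simp
    have "norm z powr (- \<sigma>) = (1 / norm z) powr \<sigma>"
      using True by (simp add: powr_minus powr_divide inverse_eq_divide)
    also have "\<dots> = 2 powr (l * \<sigma>)" by (simp add: l(2)[symmetric] powr_powr)
    also have "\<dots> \<le> ?c k" using k \<sigma> by (simp add: mult_right_mono)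
    finally have "ennreal (indicator (cball 0 1) z * norm z powr (- \<sigma>)) \<le> ennreal (?c k) * indicator (cball 0 (?r k)) z"
      using True mem by (simp add: ennreal_leI)
    also have "\<dots> \<le> (\<Sum>k. ennreal (?c k) * indicator (cball 0 (?r k)) z)"
    proof -
      have "(\<Sum>j\<in>{k}. ennreal (?c j) * indicator (cball 0 (?r j)) z) \<le> (\<Sum>k. ennreal (?c k) * indicator (cball 0 (?r k)) z)"
        by (rule sum_le_suminf) auto
      then show ?thesis by (simp only: sum.insert finite.emptyI sum.empty empty_iff not_False_eq_True add_0_right)
    qed
    finally show ?thesis .
  qed auto
  define \<rho> :: real where "\<rho> = 2 powr (\<sigma> - real ?d)"
  have \<rho>: "0 \<le> \<rho>" "\<rho> < 1" using \<sigma> by (auto simp: \<rho>_def powr_less_one)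
  define C where "C = unit_ball_vol (real ?d) * 2 powr \<sigma>"
  have C0: "0 \<le> C" by (simp add: C_def)
  have "(\<integral>\<^sup>+ (z::'a). ennreal (indicator (cball 0 1) z * norm z powr (- \<sigma>)) \<partial>lborel) \<le>
     (\<integral>\<^sup>+ (z::'a). (\<Sum>k. ennreal (?c k) * indicator (cball 0 (?r k)) z) \<partial>lborel)"
    by (intro nn_integral_mono le)
  also have "\<dots> = (\<Sum>k. \<integral>\<^sup>+ (z::'a). ennreal (?c k) * indicator (cball 0 (?r k)) z \<partial>lborel)"
    by (rule nn_integral_suminf) (intro borel_measurable_times_ennreal borel_measurable_const borel_measurable_indicator; simp)
  also have "\<dots> = (\<Sum>k. ennreal (?c k) * emeasure lborel (cball (0::'a) (?r k)))"
    by (intro arg_cong[where f = suminf] ext nn_integral_cmult_indicator) simp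
  also have "\<dots> = (\<Sum>k. ennreal (C * \<rho> ^ k))"
  proof (rule arg_cong[where f = suminf], rule ext)
    fix k
    have "?c k * (?r k) ^ ?d = 2 powr \<sigma> * \<rho> ^ k"
    proof -
      have "(?r k) ^ ?d = 2 powr (- real k * real ?d)"
        by (simp add: powr_minus powr_realpow power_mult power_one_over field_simps flip: of_nat_mult)
      moreover have "\<rho> ^ k = 2 powr (real k * (\<sigma> - real ?d))"
        unfolding \<rho>_def by (simp add: powr_realpow[symmetric] powr_powr mult.commute)
      ultimately show ?thesis by (simp add: algebra_simps flip: powr_add)
    qed
    then have "?c k * (unit_ball_vol (real ?d) * (?r k) ^ ?d) = C * \<rho> ^ k"
      unfolding C_def by (simp add: algebra_simps)
    then show "ennreal (?c k) * emeasure lborel (cball (0::'a) (?r k)) = ennreal (C * \<rho> ^ k)"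
      by (simp add: emeasure_cball flip: ennreal_mult)
  qed
  also have "\<dots> = ennreal (\<Sum>k. C * \<rho> ^ k)"
    using C0 \<rho> by (intro suminf_ennreal2 summable_mult summable_geometric) auto
  also have "\<dots> < \<infinity>" by simp
  finally show ?thesis .
qed

lemma nn_integral_translate:
  fixes x :: "'a::euclidean_space"
  assumes "h \<in> borel_measurable borel"
  shows "(\<integral>\<^sup>+ y. h (y - x) \<partial>lborel) = (\<integral>\<^sup>+ z. h z \<partial>lborel)"
proof -
  have "(\<integral>\<^sup>+ y. h (y - x) \<partial>lborel) = (\<integral>\<^sup>+ y. h (y - x) \<partial>distr lborel borel ((+) x))"
    by (simp add: lborel_distr_plus)
  also have "\<dots> = (\<integral>\<^sup>+ z. h z \<partial>lborel)"
    using assms by (subst nn_integral_distr) auto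
  finally show ?thesis .
qed

text \<open>
  A form of Young's inequality for conjugate exponents \<open>r\<close> and \<open>r / (r - 1)\<close>, without the sharp constants.
\<close>
lemma mult_le_powr_add:
  fixes a w r :: real
  assumes "0 \<le> a" "0 \<le> w" "1 < r"
  shows "a * w \<le> a powr r + w powr (r / (r - 1))"
proof (cases "w \<le> a powr (r - 1)")
  case True
  then have "a * w \<le> a * a powr (r - 1)" using assms by (intro mult_left_mono) auto
  also have "\<dots> = a powr r" using assms by (cases "a = 0") (simp_all add: powr_diff)
  finally show ?thesis by (simp add: add_increasing2)
next
  case False
  then have "a powr (r - 1) < w" by simp
  then have "(a powr (r - 1)) powr (1 / (r - 1)) \<le> w powr (1 / (r - 1))"
    using assms by (intro powr_mono2) auto
  then have "a \<le> w powr (1 / (r - 1))" using assms by (simp add: powr_powr)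
  then have "a * w \<le> w powr (1 / (r - 1)) * w" using assms by (intro mult_right_mono) auto
  also have "\<dots> = w powr (r / (r - 1))"
  proof (cases "w = 0")
    case False
    have "w powr (1 / (r - 1)) * w = w powr (1 / (r - 1) + 1)" using False assms by (simp add: powr_add)
    also have "1 / (r - 1) + 1 = r / (r - 1)" using assms by (simp add: field_simps)
    finally show ?thesis .
  qed (use assms in simp)
  finally show ?thesis by (simp add: add_increasing)
qed

text \<open>
  Near the singularity Young's inequality separates the density from the power, and the translation invariance of
  Lebesgue measure makes the bound uniform in \<open>x\<close>; away from it the power is at most \<open>1\<close>. For finite \<open>p\<close> the
  condition is the integrability of the power raised to the conjugate exponent.
\<close>
lemma singular_potential_bounded:
  fixes \<mu> :: "'a::euclidean_space measure"
  assumes \<mu>: "\<mu> \<in> Lp_measures p" "prob_space \<mu>"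
    and s: "0 < s" "(p = \<infinity> \<and> s < real DIM('a)) \<or>
       (\<exists>r>1. p = ereal r \<and> s * (r / (r - 1)) < real DIM('a))"
  shows "\<exists>M. \<forall>x. integrable \<mu> (\<lambda>y. norm (x - y) powr (- s)) \<and>
                 (LINT y|\<mu>. norm (x - y) powr (- s)) \<le> M"
proof -
  obtain f where f: "\<And>x. 0 \<le> f x" "in_Lp p f" and mu: "\<mu> = density lborel (\<lambda>x. ennreal (f x))"
    using \<mu> by (auto simp: Lp_measures_def)
  have fm[measurable]: "f \<in> borel_measurable borel" using f(2) by (simp add: in_Lp_def)
  let ?w = "\<lambda>z::'a. indicator (cball 0 1) z * norm z powr (- s)"
  have wm: "(\<lambda>z::'a. indicator (cball 0 1) z * norm z powr (- c)) \<in> borel_measurable borel" for c :: real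
    by (intro borel_measurable_times borel_measurable_indicator powr_real_measurable) auto
  have wm2: "(\<lambda>y::'a. ennreal (indicator (cball 0 1) (y - x) * norm (y - x) powr (- c))) \<in> borel_measurable lborel" for c x
    by (rule measurable_compose[of "\<lambda>y. y - x" lborel borel, OF _ measurable_compose[OF wm measurable_ennreal]]) simp
  have f1: "(\<integral>\<^sup>+ y. ennreal (f y) \<partial>lborel) = 1"
    using prob_space.emeasure_space_1[OF \<mu>(2)] unfolding mu by (simp add: emeasure_density)
  have "\<exists>B<\<infinity>. \<forall>x. (\<integral>\<^sup>+ y. ennreal (f y) * ennreal (?w (y - x)) \<partial>lborel) \<le> B"
    using s(2)
  proof (elim disjE conjE exE)
    assume p: "p = \<infinity>" and sd: "s < real DIM('a)"
    obtain C where C: "AE x in lborel. \<bar>f x\<bar> \<le> C" using f(2) p by (auto simp: in_Lp_def)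
    let ?B = "ennreal C * (\<integral>\<^sup>+ z. ennreal (?w z) \<partial>lborel)"
    have "(\<integral>\<^sup>+ y. ennreal (f y) * ennreal (?w (y - x)) \<partial>lborel) \<le> ?B" for x
    proof -
      have "(\<integral>\<^sup>+ y. ennreal (f y) * ennreal (?w (y - x)) \<partial>lborel) \<le>
            (\<integral>\<^sup>+ y. ennreal C * ennreal (?w (y - x)) \<partial>lborel)"
        by (intro nn_integral_mono_AE) (use C in \<open>auto elim!: eventually_mono intro!: mult_right_mono ennreal_leI\<close>)
      also have "\<dots> = (\<integral>\<^sup>+ z. ennreal C * ennreal (?w z) \<partial>lborel)"
        by (rule nn_integral_translate[where h = "\<lambda>z. ennreal C * ennreal (?w z)"])
          (intro borel_measurable_times_ennreal borel_measurable_const measurable_compose[OF wm measurable_ennreal])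
      also have "\<dots> = ?B"
        by (rule nn_integral_cmult) (simp add: measurable_compose[OF wm measurable_ennreal])
      finally show ?thesis .
    qed
    moreover have "?B < \<infinity>"
      using nn_integral_power_singularity_finite[of s, where 'a = 'a] s(1) sd by (simp add: ennreal_mult_less_top)
    ultimately show ?thesis by blast
  next
    fix r assume r: "1 < r" and p: "p = ereal r" and sd: "s * (r / (r - 1)) < real DIM('a)"
    let ?w' = "\<lambda>z::'a. indicator (cball 0 1) z * norm z powr (- (s * (r / (r - 1))))"
    have fr: "integrable lborel (\<lambda>x. \<bar>f x\<bar> powr r)" using f(2) p by (auto simp: in_Lp_def)
    let ?B = "(\<integral>\<^sup>+ y. ennreal (f y powr r) \<partial>lborel) + (\<integral>\<^sup>+ z. ennreal (?w' z) \<partial>lborel)"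
    have "(\<integral>\<^sup>+ y. ennreal (f y) * ennreal (?w (y - x)) \<partial>lborel) \<le> ?B" for x
    proof -
      have "ennreal (f y) * ennreal (?w (y - x)) \<le> ennreal (f y powr r) + ennreal (?w' (y - x))" for y
      proof -
        have "f y * ?w (y - x) \<le> f y powr r + ?w' (y - x)"
        proof (cases "y - x \<in> cball 0 1")
          case True
          have "f y * norm (y - x) powr (- s) \<le> f y powr r + (norm (y - x) powr (- s)) powr (r / (r - 1))"
            using f(1) r by (intro mult_le_powr_add) auto
          then show ?thesis using True by (simp add: powr_powr)
        qed simp
        then show ?thesis using f(1)[of y] by (simp flip: ennreal_mult ennreal_plus add: ennreal_leI)
      qed
      then have "(\<integral>\<^sup>+ y. ennreal (f y) * ennreal (?w (y - x)) \<partial>lborel) \<le>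
          (\<integral>\<^sup>+ y. ennreal (f y powr r) + ennreal (?w' (y - x)) \<partial>lborel)"
        by (intro nn_integral_mono)
      also have "\<dots> = (\<integral>\<^sup>+ y. ennreal (f y powr r) \<partial>lborel) + (\<integral>\<^sup>+ y. ennreal (?w' (y - x)) \<partial>lborel)"
        by (rule nn_integral_add) (use wm2 in simp_all)
      also have "(\<integral>\<^sup>+ y. ennreal (?w' (y - x)) \<partial>lborel) = (\<integral>\<^sup>+ z. ennreal (?w' z) \<partial>lborel)"
        by (rule nn_integral_translate[where h = "\<lambda>z. ennreal (?w' z)"]) (rule measurable_compose[OF wm measurable_ennreal])
      finally show ?thesis .
    qed
    moreover have "(\<integral>\<^sup>+ y. ennreal (f y powr r) \<partial>lborel) < \<infinity>"
      using fr f(1) by (simp add: integrable_iff_bounded)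
    moreover have "(\<integral>\<^sup>+ z. ennreal (?w' z) \<partial>lborel) < \<infinity>"
      using s(1) r sd by (intro nn_integral_power_singularity_finite) auto
    ultimately show ?thesis by (intro exI[of _ ?B]) simp
  qed
  then obtain B where B: "B < \<infinity>" "\<And>x. (\<integral>\<^sup>+ y. ennreal (f y) * ennreal (?w (y - x)) \<partial>lborel) \<le> B"
    by blast
  have bd: "(\<integral>\<^sup>+ y. ennreal (norm (x - y) powr (- s)) \<partial>\<mu>) \<le> B + 1" for x
  proof -
    have "(\<integral>\<^sup>+ y. ennreal (norm (x - y) powr (- s)) \<partial>\<mu>) =
        (\<integral>\<^sup>+ y. ennreal (f y) * ennreal (norm (x - y) powr (- s)) \<partial>lborel)"
      unfolding mu by (subst nn_integral_density) auto
    also have "\<dots> \<le> (\<integral>\<^sup>+ y. ennreal (f y) * ennreal (?w (y - x)) + ennreal (f y) \<partial>lborel)"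
    proof (intro nn_integral_mono)
      fix y
      have "norm (x - y) powr (- s) \<le> ?w (y - x) + 1"
      proof (cases "y - x \<in> cball 0 1")
        case False
        then have "norm (x - y) powr (- s) \<le> 1"
          using s(1) powr_mono2'[of "-s" 1 "norm (x - y)"] by (simp add: norm_minus_commute)
        then show ?thesis using False by simp
      qed (simp add: norm_minus_commute)
      then have "f y * norm (x - y) powr (- s) \<le> f y * (?w (y - x) + 1)"
        using f(1) by (intro mult_left_mono)
      then have "f y * norm (x - y) powr (- s) \<le> f y * ?w (y - x) + f y"
        by (simp add: algebra_simps)
      then show "ennreal (f y) * ennreal (norm (x - y) powr (- s)) \<le> ennreal (f y) * ennreal (?w (y - x)) + ennreal (f y)"
        using f(1)[of y] by (simp flip: ennreal_mult ennreal_plus add: ennreal_leI)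
    qed
    also have "\<dots> = (\<integral>\<^sup>+ y. ennreal (f y) * ennreal (?w (y - x)) \<partial>lborel) + 1"
      by (subst nn_integral_add) (use wm2 in \<open>auto simp: f1\<close>)
    also have "\<dots> \<le> B + 1" using B(2) by (intro add_right_mono)
    finally show ?thesis .
  qed
  have B1: "B + 1 < \<infinity>" using B(1) by simp
  have meas: "(\<lambda>y. norm (x - y) powr (- s)) \<in> borel_measurable \<mu>" for x
    unfolding mu by simp
  show ?thesis
  proof (intro exI allI conjI)
    fix x
    show int: "integrable \<mu> (\<lambda>y. norm (x - y) powr (- s))"
      using bd[of x] B1 by (intro integrableI_bounded meas) (auto intro: le_less_trans)
    show "(LINT y|\<mu>. norm (x - y) powr (- s)) \<le> enn2real (B + 1)"
      using bd[of x] B1 by (subst integral_eq_nn_integral) (auto simp: meas intro!: enn2real_mono)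
  qed
qed

lemma Lp_measures_no_atoms:
  fixes \<mu> :: "'a::euclidean_space measure"
  assumes "\<mu> \<in> Lp_measures p"
  shows "AE y in \<mu>. y \<noteq> x"
proof -
  obtain f where f: "in_Lp p f" and mu: "\<mu> = density lborel (\<lambda>x. ennreal (f x))"
    using assms by (auto simp: Lp_measures_def)
  have [measurable]: "f \<in> borel_measurable borel" using f by (simp add: in_Lp_def)
  show ?thesis unfolding mu
    by (subst AE_density) (use AE_lborel_singleton[of x] in \<open>auto elim: eventually_mono\<close>)
qed

text \<open>
  Each of the three cases provides room for a positive \<open>\<beta>\<close>: the condition on \<open>p\<close> in case (i) says exactly that \<open>\<beta> = 1\<close> is
  admissible, and in case (iii) any \<open>\<beta> < q - 1 / p\<close> is. In case (ii) every \<open>\<beta> < 1\<close> would do.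
\<close>
lemma subcritical_holder_exponent:
  fixes \<mu> :: "'a::euclidean_space measure"
  assumes q: "0 < q" "q < 2"
    and cases: "case_i DIM('a) q p \<or> case_ii DIM('a) q p \<or> case_iii DIM('a) q p"
    and \<mu>: "\<mu> \<in> Lp_measures p" "prob_space \<mu>"
  obtains \<beta> M where "0 < \<beta>" "\<beta> \<le> 1" "q - 1 < \<beta>" "case_i DIM('a) q p \<Longrightarrow> \<beta> = 1"
    "\<And>x. integrable \<mu> (\<lambda>y. norm (x - y) powr (q - 1 - \<beta>))"
    "\<And>x. (LINT y|\<mu>. norm (x - y) powr (q - 1 - \<beta>)) \<le> M"
proof -
  let ?d = "real DIM('a)"
  have d: "1 \<le> ?d" by simp
  have "\<exists>\<beta>. 0 < \<beta> \<and> \<beta> \<le> 1 \<and> q - 1 < \<beta> \<and> (case_i DIM('a) q p \<longrightarrow> \<beta> = 1) \<and>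
     ((p = \<infinity> \<and> 1 + \<beta> - q < ?d) \<or> (\<exists>r>1. p = ereal r \<and> (1 + \<beta> - q) * (r / (r - 1)) < ?d))"
    using cases
  proof (elim disjE)
    assume c: "case_i DIM('a) q p"
    show ?thesis
    proof (intro exI[of _ 1] conjI)
      show "(p = \<infinity> \<and> 1 + 1 - q < ?d) \<or> (\<exists>r>1. p = ereal r \<and> (1 + 1 - q) * (r / (r - 1)) < ?d)"
      proof (cases p)
        case (real r)
        have D: "0 < ?d + q - 2" "?d / (?d + q - 2) < r" using c real by (auto simp: case_i_def)
        then have *: "?d < r * (?d + q - 2)" by (simp add: field_simps)
        have "1 < ?d / (?d + q - 2)" using D(1) q by (simp add: field_simps)
        then have "1 < r" using D by linarith
        then show ?thesis using * real by (auto simp: field_simps)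
      qed (use c in \<open>auto simp: case_i_def\<close>)
    qed (use q in auto)
  next
    assume c: "case_ii DIM('a) q p"
    then show ?thesis by (intro exI[of _ "1/2"]) (auto simp: case_i_def case_ii_def)
  next
    assume c: "case_iii DIM('a) q p"
    then have nc: "\<not> case_i DIM('a) q p" by (auto simp: case_i_def case_iii_def)
    show ?thesis
    proof (cases p)
      case (real r)
      have r: "1 / q < r" "?d = 1" "q < 1" using c real by (auto simp: case_iii_def)
      have "1 < 1 / q" using q r by simp
      then have r1: "1 < r" using r by linarith
      \<comment> \<open>Any value strictly between \<open>0\<close> and \<open>q - 1 / r\<close> would do.\<close>
      define \<beta> where "\<beta> = (q - 1 / r) / 2"
      have "1 / r < q" using r(1) r1 q by (simp add: field_simps)
      then have \<beta>: "0 < \<beta>" "\<beta> < q - 1 / r" by (auto simp: \<beta>_def)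
      have "r * \<beta> < r * (q - 1 / r)" using \<beta>(2) r1 by simp
      also have "\<dots> = r * q - 1" using r1 by (simp add: field_simps)
      finally have "(1 + \<beta> - q) * r < r - 1" by (simp add: algebra_simps)
      then have "(1 + \<beta> - q) * (r / (r - 1)) < 1" using r1 by (simp add: field_simps)
      moreover have "\<beta> \<le> 1"
      proof -
        have "0 < 1 / r" using r1 by simp
        then show ?thesis using r unfolding \<beta>_def by argo
      qed
      ultimately show ?thesis using \<beta> r r1 real nc by (intro exI[of _ \<beta>]) auto
    qed (use c q nc in \<open>auto simp: case_iii_def intro!: exI[of _ "q / 2"]\<close>)
  qed
  then obtain \<beta> where \<beta>: "0 < \<beta>" "\<beta> \<le> 1" "q - 1 < \<beta>" "case_i DIM('a) q p \<Longrightarrow> \<beta> = 1"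
     "(p = \<infinity> \<and> 1 + \<beta> - q < ?d) \<or> (\<exists>r>1. p = ereal r \<and> (1 + \<beta> - q) * (r / (r - 1)) < ?d)" by blast
  have "- (1 + \<beta> - q) = q - 1 - \<beta>" by simp
  moreover have "0 < 1 + \<beta> - q" using \<beta>(3) by simp
  ultimately obtain M where "\<forall>x. integrable \<mu> (\<lambda>y. norm (x - y) powr (q - 1 - \<beta>)) \<and>
      (LINT y|\<mu>. norm (x - y) powr (q - 1 - \<beta>)) \<le> M"
    using singular_potential_bounded[OF \<mu>, of "1 + \<beta> - q"] \<beta>(5) by metis
  then show ?thesis using \<beta>(1-4) that[of \<beta> M] by blast
qed

section \<open>The field of the target and the gradient of the energy\<close>

lemma kernel_0 [simp]: "kernel q 0 = 0"
  by (simp add: kernel_def)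

lemma kernel_swap: "kernel q (x - y) = kernel q (y - x)"
  by (simp add: kernel_def norm_minus_commute)

lemma borel_measurable_kernel [measurable]: "kernel q \<in> borel_measurable borel"
  unfolding kernel_def[abs_def] by measurable

lemma borel_measurable_grad_kernel [measurable]: "grad_kernel q \<in> borel_measurable borel"
  unfolding grad_kernel_def[abs_def] by measurable

lemma continuous_on_grad_kernel: "continuous_on (- {0}) (grad_kernel q)"
  unfolding grad_kernel_def[abs_def] by (intro continuous_intros) auto

lemma powr_norm_diff_le:
  fixes x y :: "'a::real_normed_vector"
  assumes "0 \<le> m" "m \<le> 2"
  shows "norm (x - y) powr m \<le> 4 * norm x powr m + 4 * norm y powr m"
proof -
  define r where "r = max (norm x) (norm y)"
  have "norm (x - y) powr m \<le> (2 * r) powr m"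
    using norm_triangle_ineq4[of x y] assms by (intro powr_mono2) (auto simp: r_def)
  also have "\<dots> = 2 powr m * r powr m" by (simp add: powr_mult)
  also have "\<dots> \<le> 2 powr 2 * (norm x powr m + norm y powr m)"
    using assms by (intro mult_mono powr_mono) (auto simp: r_def max_def)
  finally show ?thesis by simp
qed

lemma integral_empirical:
  fixes X :: "'a::euclidean_space ^ 'n::finite" and f :: "'a \<Rightarrow> real"
  assumes "f \<in> borel_measurable borel"
  shows "integral\<^sup>L (empirical X) f = (1 / real CARD('n)) * (\<Sum>i\<in>UNIV. f (X $ i))"
proof -
  have "integral\<^sup>L (empirical X) f = (LINT i|uniform_count_measure UNIV. f (X $ i))"
    unfolding empirical_def by (rule integral_distr[OF _ assms]) (simp add: measurable_def space_uniform_count_measure sets_uniform_count_measure)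
  also have "\<dots> = (\<Sum>i\<in>UNIV. (1 / real CARD('n)) * f (X $ i))"
    unfolding uniform_count_measure_def by (subst lebesgue_integral_point_measure_finite) auto
  finally show ?thesis by (simp add: sum_distrib_left)
qed

text \<open>
  The hypotheses on the target that the rest of the proof uses, uniformly in the three cases. The absence of
  atoms is required separately: as \<open>0 powr a = 0\<close>, an atom at \<open>x\<close> would not be seen by the singular integral.
\<close>
locale target_measure =
  fixes q \<beta> M :: real and \<mu> :: "'a::euclidean_space measure"
  assumes q: "0 < q" "q < 2" and \<beta>: "0 < \<beta>" "\<beta> \<le> 1" "q - 1 < \<beta>"
    and prob: "prob_space \<mu>" and sets_\<mu> [measurable_cong]: "sets \<mu> = sets borel"
    and moment: "integrable \<mu> (\<lambda>x. norm x powr max 1 q)"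
    and no_atoms: "\<And>x. AE y in \<mu>. y \<noteq> x"
    and singular_integrable: "\<And>x. integrable \<mu> (\<lambda>y. norm (x - y) powr (q - 1 - \<beta>))"
    and singular_le: "\<And>x. (LINT y|\<mu>. norm (x - y) powr (q - 1 - \<beta>)) \<le> M"
begin

sublocale prob_space \<mu> by (rule prob)

definition drift :: "'a \<Rightarrow> 'a" where
  "drift x = (LINT y|\<mu>. grad_kernel q (x - y))"

definition potential :: "'a \<Rightarrow> real" where
  "potential x = (LINT y|\<mu>. kernel q (x - y))"

lemma integrable_shifted_moment: "integrable \<mu> (\<lambda>y. norm (x - y) powr max 1 q)"
proof (rule Bochner_Integration.integrable_bound)
  show "integrable \<mu> (\<lambda>y. 4 * norm x powr max 1 q + 4 * norm y powr max 1 q)"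
    using moment by simp
  show "AE y in \<mu>. norm (norm (x - y) powr max 1 q) \<le> norm (4 * norm x powr max 1 q + 4 * norm y powr max 1 q)"
    using powr_norm_diff_le[of "max 1 q" x] q by simp
qed measurable

lemma integrable_kernel: "integrable \<mu> (\<lambda>y. kernel q (x - y))"
proof (rule Bochner_Integration.integrable_bound)
  show "integrable \<mu> (\<lambda>y. 1 + norm (x - y) powr max 1 q)"
    using integrable_shifted_moment by simp
  have "r powr q \<le> 1 + r powr max 1 q" if "0 \<le> r" for r :: real
  proof (cases "r \<le> 1")
    case True
    then have "r powr q \<le> 1" using that q by (simp add: powr_le1)
    then show ?thesis by (simp add: add_increasing2)
  next
    case False
    then have "r powr q \<le> r powr max 1 q" by (intro powr_mono) auto
    then show ?thesis by simp
  qed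
  then show "AE y in \<mu>. norm (kernel q (x - y)) \<le> norm (1 + norm (x - y) powr max 1 q)"
    by (simp add: kernel_def)
qed measurable

lemma integrable_grad_kernel: "integrable \<mu> (\<lambda>y. grad_kernel q (x - y))"
proof (rule Bochner_Integration.integrable_bound)
  show "integrable \<mu> (\<lambda>y. q * (norm (x - y) powr (q - 1 - \<beta>) + norm (x - y) powr max 1 q))"
    using integrable_shifted_moment singular_integrable by simp
  have "r powr (q - 1) \<le> r powr (q - 1 - \<beta>) + r powr max 1 q" if "0 \<le> r" for r :: real
  proof (cases "r \<le> 1")
    case True
    then have "r powr (q - 1) \<le> r powr (q - 1 - \<beta>)" using that \<beta> by (intro powr_mono') auto
    then show ?thesis by (simp add: add_increasing2)
  next
    case False
    then have "r powr (q - 1) \<le> r powr max 1 q" by (intro powr_mono) auto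
    then show ?thesis by (simp add: add_increasing)
  qed
  then show "AE y in \<mu>. norm (grad_kernel q (x - y)) \<le> norm (q * (norm (x - y) powr (q - 1 - \<beta>) + norm (x - y) powr max 1 q))"
    using q by (simp add: norm_grad_kernel)
qed measurable

text \<open>
  The pointwise Hoelder bound of the kernel gradient has an integral that is bounded uniformly in both base points.
\<close>
lemma drift_holder: "norm (drift x - drift y) \<le> 6 * q * M * norm (x - y) powr \<beta>"
proof -
  let ?e = "q - 1 - \<beta>"
  have "norm (drift x - drift y) = norm (LINT z|\<mu>. grad_kernel q (x - z) - grad_kernel q (y - z))"
    unfolding drift_def using integrable_grad_kernel by simp
  also have "\<dots> \<le> (LINT z|\<mu>. norm (grad_kernel q (x - z) - grad_kernel q (y - z)))"
    by (rule integral_norm_bound)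
  also have "\<dots> \<le> (LINT z|\<mu>. 3 * q * norm (x - y) powr \<beta> * (norm (x - z) powr ?e + norm (y - z) powr ?e))"
  proof (rule integral_mono)
    fix z
    show "norm (grad_kernel q (x - z) - grad_kernel q (y - z)) \<le> 3 * q * norm (x - y) powr \<beta> * (norm (x - z) powr ?e + norm (y - z) powr ?e)"
      using grad_kernel_holder[OF q \<beta>, of "x - z" "y - z"] by simp
  qed (use integrable_grad_kernel singular_integrable in auto)
  also have "\<dots> = 3 * q * norm (x - y) powr \<beta> * ((LINT z|\<mu>. norm (x - z) powr ?e) + (LINT z|\<mu>. norm (y - z) powr ?e))"
    using singular_integrable by simp
  also have "\<dots> \<le> 3 * q * norm (x - y) powr \<beta> * (M + M)"
    using q by (intro mult_left_mono add_mono singular_le) auto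
  finally show ?thesis by (simp add: algebra_simps)
qed

lemma continuous_on_drift: "continuous_on A drift"
proof -
  have "isCont drift x" for x
  proof -
    have "((\<lambda>y. norm (y - x) powr \<beta>) \<longlongrightarrow> norm (x - x) powr \<beta>) (at x)"
      using \<beta> by (intro tendsto_powr2 tendsto_intros) auto
    then have "((\<lambda>y. 6 * q * M * norm (y - x) powr \<beta>) \<longlongrightarrow> 0) (at x)"
      using tendsto_mult_right_zero by simp
    then have "((\<lambda>y. drift y - drift x) \<longlongrightarrow> 0) (at x)"
      by (rule Lim_null_comparison[rotated]) (intro always_eventually allI drift_holder)
    then show ?thesis unfolding isCont_def by (rule LIM_zero_cancel)
  qed
  then show ?thesis by (simp add: continuous_at_imp_continuous_on)
qed

text \<open>
  The Taylor remainder is integrable in \<open>y\<close> with a bound of order \<open>|h| powr (1 + \<beta>)\<close>. Such a bound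
  replaces dominated convergence: the singularity of the difference quotients moves with \<open>h\<close>.
\<close>
lemma GDERIV_potential: "GDERIV potential x :> drift x"
proof -
  let ?e = "q - 1 - \<beta>"
  have bd: "norm (potential (x + h) - potential x - inner h (drift x)) \<le> 60 * M * norm h powr (1 + \<beta>)" for h
  proof -
    have int: "integrable \<mu> (\<lambda>y. inner h (grad_kernel q (x - y)))"
      using integrable_grad_kernel by simp
    have "potential (x + h) - potential x - inner h (drift x) =
        (LINT y|\<mu>. kernel q (x + h - y) - kernel q (x - y) - inner h (grad_kernel q (x - y)))"
      unfolding potential_def drift_def
      using integrable_kernel int integrable_grad_kernel by (simp add: Bochner_Integration.integral_diff)
    also have "norm \<dots> \<le> (LINT y|\<mu>. norm (kernel q (x + h - y) - kernel q (x - y) - inner h (grad_kernel q (x - y))))"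
      by (rule integral_norm_bound)
    also have "\<dots> \<le> (LINT y|\<mu>. 60 * norm h powr (1 + \<beta>) * norm (x - y) powr ?e)"
    proof (rule integral_mono_AE)
      show "AE y in \<mu>. norm (kernel q (x + h - y) - kernel q (x - y) - inner h (grad_kernel q (x - y)))
          \<le> 60 * norm h powr (1 + \<beta>) * norm (x - y) powr ?e"
        using no_atoms[of x]
      proof eventually_elim
        case (elim y)
        then have nz: "x - y \<noteq> 0" by simp
        have eq: "x - y + h = x + h - y" by simp
        show ?case
          using kernel_taylor[OF q \<beta> nz, of h] unfolding eq real_norm_def .
      qed
    qed (use integrable_kernel int singular_integrable in auto)
    also have "\<dots> = 60 * norm h powr (1 + \<beta>) * (LINT y|\<mu>. norm (x - y) powr ?e)"
      by simp
    also have "\<dots> \<le> 60 * norm h powr (1 + \<beta>) * M"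
      by (intro mult_left_mono singular_le) simp
    finally show ?thesis by (simp add: algebra_simps)
  qed
  have "(\<lambda>h. norm (potential (x + h) - potential x - inner h (drift x)) / norm h) \<midarrow>0\<rightarrow> 0"
  proof (rule Lim_null_comparison)
    show "\<forall>\<^sub>F h in at 0. norm (norm (potential (x + h) - potential x - inner h (drift x)) / norm h) \<le> 60 * M * norm h powr \<beta>"
      unfolding eventually_at_filter
    proof (rule always_eventually, intro allI impI)
      fix h :: 'a assume "h \<noteq> 0"
      then have eq: "60 * M * norm h powr (1 + \<beta>) = 60 * M * norm h powr \<beta> * norm h"
        by (simp add: powr_add)
      then show "norm (norm (potential (x + h) - potential x - inner h (drift x)) / norm h) \<le> 60 * M * norm h powr \<beta>"
        using bd[of h] \<open>h \<noteq> 0\<close> unfolding eq by (simp add: divide_le_eq)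
    qed
    have "((\<lambda>h::'a. norm h powr \<beta>) \<longlongrightarrow> norm (0::'a) powr \<beta>) (at 0)"
      using \<beta> by (intro tendsto_powr2 tendsto_intros) auto
    then show "((\<lambda>h::'a. 60 * M * norm h powr \<beta>) \<longlongrightarrow> 0) (at 0)"
      using tendsto_mult_right_zero by simp
  qed
  then show ?thesis
    unfolding gderiv_def has_derivative_at by (simp add: bounded_linear_inner_left)
qed

lemma continuous_on_potential: "continuous_on A potential"
  using GDERIV_potential by (auto simp: gderiv_def intro!: continuous_at_imp_continuous_on has_derivative_continuous)

lemma integrable_potential: "integrable \<mu> potential"
proof (rule Bochner_Integration.integrable_bound)
  let ?A = "LINT y|\<mu>. 1 + (4 * norm y powr max 1 q)"
  let ?b = "\<lambda>x. ?A + 4 * norm x powr max 1 q"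
  show "integrable \<mu> ?b" using moment by simp
  have m: "0 \<le> max 1 q" "max 1 q \<le> 2" using q by auto
  have "norm (potential x) \<le> ?b x" for x
  proof -
    have "norm (potential x) \<le> (LINT y|\<mu>. norm (kernel q (x - y)))"
      unfolding potential_def by (rule integral_norm_bound)
    also have "\<dots> \<le> (LINT y|\<mu>. (1 + 4 * norm y powr max 1 q) + 4 * norm x powr max 1 q)"
    proof (rule integral_mono)
      fix y
      have "norm (kernel q (x - y)) \<le> 1 + norm (x - y) powr max 1 q"
      proof (cases "norm (x - y) \<le> 1")
        case True
        then show ?thesis using q by (simp add: kernel_def powr_le1 add_increasing2)
      next
        case False
        then have "norm (x - y) powr q \<le> norm (x - y) powr max 1 q" by (intro powr_mono) auto
        then show ?thesis by (simp add: kernel_def)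
      qed
      then show "norm (kernel q (x - y)) \<le> (1 + 4 * norm y powr max 1 q) + 4 * norm x powr max 1 q"
        using powr_norm_diff_le[OF m, of x y] by linarith
    qed (use integrable_kernel moment in auto)
    also have "\<dots> = ?b x" using moment by (simp add: prob_space)
    finally show ?thesis .
  qed
  then show "AE x in \<mu>. norm (potential x) \<le> norm (?b x)" by (auto intro: order_trans)
  show "potential \<in> borel_measurable \<mu>"
    using borel_measurable_continuous_onI[OF continuous_on_potential] by simp
qed

text \<open>
  The kernel is even, so the two mixed terms coincide and the factor \<open>1 / 2\<close> cancels in front of the potential.
\<close>
lemma particle_energy_eq:
  fixes X :: "'a ^ 'n::finite"
  shows "particle_energy q \<mu> X =
     (1 / (2 * (real CARD('n))\<^sup>2)) * (\<Sum>i\<in>UNIV. \<Sum>j\<in>UNIV. kernel q (X $ i - X $ j))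
     - (1 / real CARD('n)) * (\<Sum>i\<in>UNIV. potential (X $ i)) + (1/2) * integral\<^sup>L \<mu> potential"
proof -
  let ?N = "real CARD('n)"
  have inner: "integral_diff (empirical X) \<mu> (\<lambda>x. kernel q (x - y)) =
      (1 / ?N) * (\<Sum>i\<in>UNIV. kernel q (X $ i - y)) - potential y" for y
    unfolding integral_diff_def potential_def
    by (subst integral_empirical) (measurable, simp add: kernel_swap[of q y])
  have meas: "(\<lambda>y. (1 / ?N) * (\<Sum>i\<in>UNIV. kernel q (X $ i - y)) - potential y) \<in> borel_measurable borel"
    using borel_measurable_continuous_onI[OF continuous_on_potential] by measurable
  have int: "(LINT y|\<mu>. (1 / ?N) * (\<Sum>i\<in>UNIV. kernel q (X $ i - y)) - potential y) =
     (1 / ?N) * (\<Sum>i\<in>UNIV. potential (X $ i)) - integral\<^sup>L \<mu> potential"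
  proof -
    have sum_int: "integrable \<mu> (\<lambda>y. (1 / ?N) * (\<Sum>i\<in>UNIV. kernel q (X $ i - y)))"
      by (intro integrable_mult_right Bochner_Integration.integrable_sum integrable_kernel)
    have "(LINT y|\<mu>. (\<Sum>i\<in>UNIV. kernel q (X $ i - y))) = (\<Sum>i\<in>UNIV. potential (X $ i))"
      unfolding potential_def by (rule Bochner_Integration.integral_sum) (rule integrable_kernel)
    then show ?thesis
      using Bochner_Integration.integral_diff[OF sum_int integrable_potential] by simp
  qed
  have eq: "(\<Sum>j\<in>UNIV. (1 / ?N) * (\<Sum>i\<in>UNIV. kernel q (X $ i - X $ j)) - potential (X $ j)) =
     (1 / ?N) * (\<Sum>i\<in>UNIV. \<Sum>j\<in>UNIV. kernel q (X $ i - X $ j)) - (\<Sum>j\<in>UNIV. potential (X $ j))"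
    unfolding sum_subtractf sum_distrib_left[symmetric] by (subst sum.swap) (rule refl)
  have alg: "1 / 2 * ((1 / ?N) * ((1 / ?N) * S - P) - ((1 / ?N) * P - I)) =
      (1 / (2 * ?N\<^sup>2)) * S - (1 / ?N) * P + (1 / 2) * I" for S P I :: real
    by (simp add: field_simps power2_eq_square)
  show ?thesis
    unfolding particle_energy_def inner
    unfolding integral_diff_def integral_empirical[OF meas] int eq
    by (rule alg)
qed

text \<open>
  Since \<open>grad_kernel q 0 = 0\<close>, the self-interaction can be included in the sum, which then becomes symmetric.
\<close>
lemma velocity_nth:
  fixes X :: "'a ^ 'n::finite"
  shows "velocity q \<mu> X $ i = - ((1 / real CARD('n)) *\<^sub>R (\<Sum>j\<in>UNIV. grad_kernel q (X $ i - X $ j))) + drift (X $ i)"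
proof -
  have "(\<Sum>j\<in>UNIV. grad_kernel q (X $ i - X $ j)) = (\<Sum>j\<in>UNIV - {i}. grad_kernel q (X $ i - X $ j))"
    by (subst sum.remove[of _ i]) auto
  then show ?thesis by (simp add: velocity_def drift_def)
qed

text \<open>
  The pair interaction is differentiated in both of its arguments, and the antisymmetry of the kernel gradient turns
  the two contributions into twice one of them.
\<close>
lemma GDERIV_particle_energy:
  fixes X :: "'a ^ 'n::finite"
  assumes X: "X \<in> distinct_configs"
  shows "GDERIV (particle_energy q \<mu>) X :> - ((1 / real CARD('n)) *\<^sub>R velocity q \<mu> X)"
proof -
  let ?N = "real CARD('n)" and ?k = "\<lambda>i j. grad_kernel q (X $ i - X $ j)"
  have pair: "((\<lambda>X. kernel q (X $ i - X $ j)) has_derivative (\<lambda>h. inner (h $ i - h $ j) (?k i j))) (at X)" for i j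
  proof (cases "i = j")
    case False
    then have "X $ i - X $ j \<noteq> 0" using X by (auto simp: distinct_configs_def)
    then have "(kernel q has_derivative (\<lambda>h. inner h (?k i j))) (at (X $ i - X $ j))"
      by (rule GDERIV_kernel[unfolded gderiv_def])
    moreover have "((\<lambda>X. X $ i - X $ j) has_derivative (\<lambda>h. h $ i - h $ j)) (at X)"
      by (intro bounded_linear_imp_has_derivative bounded_linear_sub bounded_linear_vec_nth)
    ultimately show ?thesis by (rule has_derivative_compose[rotated])
  qed simp
  have pot: "((\<lambda>X. potential (X $ i)) has_derivative (\<lambda>h. inner (h $ i) (drift (X $ i)))) (at X)" for i
  proof -
    have "((\<lambda>X. X $ i) has_derivative (\<lambda>h. h $ i)) (at X)"
      by (intro bounded_linear_imp_has_derivative bounded_linear_vec_nth)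
    then show ?thesis
      by (rule has_derivative_compose) (use GDERIV_potential in \<open>auto simp: gderiv_def\<close>)
  qed
  have "(particle_energy q \<mu> has_derivative
     (\<lambda>h. (1 / (2 * ?N\<^sup>2)) * (\<Sum>i\<in>UNIV. \<Sum>j\<in>UNIV. inner (h $ i - h $ j) (?k i j))
     - (1 / ?N) * (\<Sum>i\<in>UNIV. inner (h $ i) (drift (X $ i))) + 0)) (at X)"
    unfolding particle_energy_eq[abs_def]
    by (intro has_derivative_add has_derivative_diff has_derivative_const has_derivative_mult_right has_derivative_sum pair pot)
  moreover have "(\<Sum>i\<in>UNIV. \<Sum>j\<in>UNIV. inner (h $ i - h $ j) (?k i j)) = 2 * (\<Sum>i\<in>UNIV. inner (h $ i) (\<Sum>j\<in>UNIV. ?k i j))"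
    for h :: "'a ^ 'n"
  proof -
    have "(\<Sum>i\<in>UNIV. \<Sum>j\<in>UNIV. inner (h $ j) (?k i j)) = (\<Sum>j\<in>UNIV. \<Sum>i\<in>UNIV. inner (h $ j) (?k i j))"
      by (rule sum.swap)
    also have "\<dots> = - (\<Sum>j\<in>UNIV. \<Sum>i\<in>UNIV. inner (h $ j) (?k j i))"
      by (subst grad_kernel_swap) (simp add: sum_negf)
    finally show ?thesis
      by (simp add: inner_diff_left sum_subtractf inner_sum_right)
  qed
  moreover have "(1 / (2 * ?N\<^sup>2)) * (2 * (\<Sum>i\<in>UNIV. inner (h $ i) (\<Sum>j\<in>UNIV. ?k i j)))
     - (1 / ?N) * (\<Sum>i\<in>UNIV. inner (h $ i) (drift (X $ i))) + 0 =
     inner h (- ((1 / ?N) *\<^sub>R velocity q \<mu> X))" for h :: "'a ^ 'n"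
  proof -
    have "inner h (- ((1 / ?N) *\<^sub>R velocity q \<mu> X)) =
        (\<Sum>i\<in>UNIV. (1 / ?N\<^sup>2) * inner (h $ i) (\<Sum>j\<in>UNIV. ?k i j) - (1 / ?N) * inner (h $ i) (drift (X $ i)))"
      unfolding inner_vec_def
      by (rule sum.cong) (simp_all add: velocity_nth inner_diff_right inner_add_right power2_eq_square algebra_simps)
    then show ?thesis by (simp add: sum_subtractf sum_distrib_left)
  qed
  ultimately show ?thesis unfolding gderiv_def by simp
qed

lemma continuous_on_velocity: "continuous_on distinct_configs (velocity q \<mu> :: 'a ^ 'n::finite \<Rightarrow> 'a ^ 'n)"
proof -
  have "continuous_on distinct_configs (\<lambda>X :: 'a ^ 'n. grad_kernel q (X $ i - X $ j))" if "j \<in> UNIV - {i}" for i j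
    by (rule continuous_on_compose2[OF continuous_on_grad_kernel])
       (use that in \<open>auto intro!: continuous_intros simp: distinct_configs_def\<close>)
  moreover have "continuous_on distinct_configs (\<lambda>X :: 'a ^ 'n. LINT y|\<mu>. grad_kernel q (X $ i - y))" for i
    unfolding drift_def[symmetric]
    by (rule continuous_on_compose2[OF continuous_on_drift[of UNIV] linear_continuous_on[OF bounded_linear_vec_nth]]) simp
  ultimately show ?thesis
    unfolding velocity_def[abs_def] by (intro continuous_intros)
qed

lemma continuous_on_particle_energy: "continuous_on A (particle_energy q \<mu> :: 'a ^ 'n::finite \<Rightarrow> real)"
proof -
  have "continuous_on A (\<lambda>X :: 'a ^ 'n. norm (X $ i - X $ j) powr q)" for i j
    by (rule continuous_on_powr') (use q in \<open>auto intro!: continuous_intros\<close>)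
  then have "continuous_on A (\<lambda>X :: 'a ^ 'n. kernel q (X $ i - X $ j))" for i j
    unfolding kernel_def by (intro continuous_on_minus)
  moreover have "continuous_on A (\<lambda>X :: 'a ^ 'n. potential (X $ i))" for i
    by (rule continuous_on_compose2[OF continuous_on_potential[of UNIV] linear_continuous_on[OF bounded_linear_vec_nth]]) simp
  ultimately show ?thesis
    unfolding particle_energy_eq[abs_def] by (intro continuous_intros)
qed

end

section \<open>Strict positivity of the power energy\<close>

text \<open>
  Entrywise powers of a Gram matrix are positive semidefinite: expanding one factor \<open>inner (x i) (x j)\<close> in an orthonormal
  basis reduces the exponent, at the cost of new coefficients \<open>u i * inner (x i) b\<close>.
\<close>
lemma sum_inner_power_nonneg:
  fixes x :: "'i \<Rightarrow> 'a::euclidean_space" and u :: "'i \<Rightarrow> real"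
  shows "0 \<le> (\<Sum>i\<in>I. \<Sum>j\<in>I. u i * u j * inner (x i) (x j) ^ k)"
proof (induction k arbitrary: u)
  case 0
  have "(\<Sum>i\<in>I. \<Sum>j\<in>I. u i * u j * inner (x i) (x j) ^ 0) = (\<Sum>i\<in>I. u i)\<^sup>2"
    by (simp add: power2_eq_square sum_product)
  then show ?case by simp
next
  case (Suc k)
  have "(\<Sum>i\<in>I. \<Sum>j\<in>I. u i * u j * inner (x i) (x j) ^ Suc k) =
        (\<Sum>i\<in>I. \<Sum>j\<in>I. \<Sum>b\<in>Basis. (u i * inner (x i) b) * (u j * inner (x j) b) * inner (x i) (x j) ^ k)"
  proof (intro sum.cong refl)
    fix i j
    have e: "inner (x i) (x j) * P = (\<Sum>b\<in>Basis. inner (x i) b * inner (x j) b * P)" for P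
      by (subst euclidean_inner) (rule sum_distrib_right)
    show "u i * u j * inner (x i) (x j) ^ Suc k =
        (\<Sum>b\<in>Basis. (u i * inner (x i) b) * (u j * inner (x j) b) * inner (x i) (x j) ^ k)"
      using e[of "u i * u j * inner (x i) (x j) ^ k"] by (simp add: mult_ac)
  qed
  also have "\<dots> = (\<Sum>b\<in>Basis. \<Sum>i\<in>I. \<Sum>j\<in>I. (u i * inner (x i) b) * (u j * inner (x j) b) * inner (x i) (x j) ^ k)"
    by (simp only: sum.swap[of _ Basis])
  also have "0 \<le> \<dots>" by (intro sum_nonneg Suc)
  finally show ?case .
qed

text \<open>
  All terms of the exponential series are nonnegative, and the square of the sum is the term of order \<open>0\<close>.
\<close>
lemma square_sum_le_sum_exp_inner:
  fixes x :: "'i \<Rightarrow> 'a::euclidean_space" and u :: "'i \<Rightarrow> real"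
  assumes "0 \<le> c"
  shows "(\<Sum>i\<in>I. u i)\<^sup>2 \<le> (\<Sum>i\<in>I. \<Sum>j\<in>I. u i * u j * exp (c * inner (x i) (x j)))"
proof -
  let ?f = "\<lambda>k. (c ^ k / fact k) * (\<Sum>i\<in>I. \<Sum>j\<in>I. u i * u j * inner (x i) (x j) ^ k)"
  have "(\<lambda>k. (c * inner (x i) (x j)) ^ k /\<^sub>R fact k) sums exp (c * inner (x i) (x j))" for i j
    by (rule exp_converges)
  then have "(\<lambda>k. \<Sum>i\<in>I. \<Sum>j\<in>I. u i * u j * ((c * inner (x i) (x j)) ^ k /\<^sub>R fact k)) sums
      (\<Sum>i\<in>I. \<Sum>j\<in>I. u i * u j * exp (c * inner (x i) (x j)))"
    by (intro sums_sum sums_mult)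
  moreover have "(\<Sum>i\<in>I. \<Sum>j\<in>I. u i * u j * ((c * inner (x i) (x j)) ^ k /\<^sub>R fact k)) = ?f k" for k
    unfolding sum_distrib_left by (intro sum.cong refl) (simp add: power_mult_distrib divide_inverse mult_ac)
  ultimately have s: "?f sums (\<Sum>i\<in>I. \<Sum>j\<in>I. u i * u j * exp (c * inner (x i) (x j)))"
    by (simp only:)
  have "0 \<le> ?f k" for k
    using assms by (intro mult_nonneg_nonneg sum_inner_power_nonneg) auto
  then have "sum ?f {0} \<le> suminf ?f"
    using s by (intro sum_le_suminf) (auto simp: sums_iff)
  moreover have "sum ?f {0} = (\<Sum>i\<in>I. u i)\<^sup>2"
    by (simp add: power2_eq_square sum_product)
  ultimately show ?thesis using s by (simp add: sums_iff)
qed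

text \<open>
  The integrand of the representation of \<open>r powr q\<close> as a constant times
  \<open>\<integral> (1 - exp (- s r\<^sup>2)) s powr (- 1 - q / 2) ds\<close> over \<open>s > 0\<close>, which expresses that \<open>t powr (q / 2)\<close> is a Bernstein function.
\<close>
definition subordinator :: "real \<Rightarrow> real \<Rightarrow> real \<Rightarrow> real" where
  "subordinator q r s = indicator {0<..} s * ((1 - exp (- s * r\<^sup>2)) * s powr (- 1 - q / 2))"

lemma subordinator_nonneg: "0 \<le> subordinator q r s"
  by (auto simp: subordinator_def indicator_def intro!: mult_nonneg_nonneg)

lemma subordinator_integrable_1:
  assumes q: "0 < q" "q < 2"
  shows "integrable lborel (subordinator q 1)"
proof -
  have conv: "integrable lborel (\<lambda>s. indicator A s * s powr a)"
    if "(\<lambda>s::real. s powr a) integrable_on A" "A \<in> sets borel" for A a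
  proof -
    have "set_integrable lebesgue A (\<lambda>s. s powr a)"
      using that by (intro nonnegative_absolutely_integrable_1) auto
    then have "integrable lebesgue (\<lambda>s. indicator A s * s powr a)"
      by (simp add: set_integrable_def)
    then show ?thesis
      by (subst (asm) integrable_completion) (use that in auto)
  qed
  have i1: "integrable lborel (\<lambda>s. indicator {0..1} s * s powr (- (q / 2)))"
    using q by (intro conv integrable_on_powr_from_0) auto
  have i2: "integrable lborel (\<lambda>s. indicator {1..} s * s powr (- 1 - q / 2))"
    using q has_integral_powr_to_inf[of "- 1 - q / 2" 1] by (intro conv) (auto simp: integrable_on_def)
  show ?thesis
  proof (rule Bochner_Integration.integrable_bound[OF Bochner_Integration.integrable_add[OF i1 i2]])
    show "subordinator q 1 \<in> borel_measurable lborel"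
      unfolding subordinator_def by measurable
    have "subordinator q 1 s \<le> indicator {0..1} s * s powr (- (q / 2)) + indicator {1..} s * s powr (- 1 - q / 2)" for s
    proof -
      consider "s \<le> 0" | "0 < s" "s \<le> 1" | "1 < s" by linarith
      then show ?thesis
      proof cases
        case 2
        have "1 - exp (- s) \<le> s" using exp_ge_add_one_self[of "- s"] by linarith
        then have "(1 - exp (- s)) * s powr (- 1 - q / 2) \<le> s * s powr (- 1 - q / 2)"
          by (intro mult_right_mono) auto
        also have "\<dots> = s powr (- (q / 2))"
          using 2 powr_add[of s 1 "- 1 - q / 2"] by simp
        finally show ?thesis using 2 by (simp add: subordinator_def add_increasing2)
      next
        case 3
        then show ?thesis by (simp add: subordinator_def mult_left_le_one_le)
      qed (simp add: subordinator_def)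
    qed
    then show "AE s in lborel. norm (subordinator q 1 s) \<le>
        norm (indicator {0..1} s * s powr (- (q / 2)) + indicator {1..} s * s powr (- 1 - q / 2))"
      using subordinator_nonneg[of q 1] by (auto intro!: AE_I2 order_trans[OF _ abs_ge_self])
  qed
qed

lemma subordinator_scale:
  assumes "0 < r"
  shows "subordinator q r s = r powr q * (r\<^sup>2 * subordinator q 1 (0 + r\<^sup>2 * s))"
proof (cases "0 < s")
  case True
  define E W where "E = 1 - exp (- s * r\<^sup>2)" and "W = s powr (- 1 - q / 2)"
  have r2: "r\<^sup>2 = r powr 2" using assms by simp
  have "(r\<^sup>2 * s) powr (- 1 - q / 2) = (r powr 2) powr (- 1 - q / 2) * s powr (- 1 - q / 2)"
    unfolding r2 by (rule powr_mult)
  also have "(r powr 2) powr (- 1 - q / 2) = r powr (- 2 - q)"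
    unfolding powr_powr by (rule arg_cong[where f = "(powr) r"]) (simp add: field_simps)
  finally have W: "(r\<^sup>2 * s) powr (- 1 - q / 2) = r powr (- 2 - q) * W" unfolding W_def .
  have one: "r powr q * (r\<^sup>2 * r powr (- 2 - q)) = 1"
    unfolding r2 powr_add[symmetric] using assms by simp
  have "0 < r\<^sup>2 * s" using True assms by simp
  then have "subordinator q 1 (0 + r\<^sup>2 * s) = E * (r powr (- 2 - q) * W)"
    unfolding subordinator_def add_0 W E_def by (simp add: mult.commute)
  then have "r powr q * (r\<^sup>2 * subordinator q 1 (0 + r\<^sup>2 * s)) = (r powr q * (r\<^sup>2 * r powr (- 2 - q))) * (E * W)"
    by (simp only: mult_ac)
  also have "\<dots> = subordinator q r s"
    unfolding one using True by (simp add: subordinator_def E_def W_def)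
  finally show ?thesis by simp
next
  case False
  then have "\<not> 0 < r\<^sup>2 * s" by (simp add: mult_le_0_iff not_less)
  then show ?thesis using False by (simp add: subordinator_def)
qed

lemma subordinator_integral:
  assumes q: "0 < q" "q < 2" and r: "0 \<le> r"
  shows "integrable lborel (subordinator q r)"
    and "integral\<^sup>L lborel (subordinator q r) = r powr q * integral\<^sup>L lborel (subordinator q 1)"
proof -
  have "integrable lborel (subordinator q r) \<and>
      integral\<^sup>L lborel (subordinator q r) = r powr q * integral\<^sup>L lborel (subordinator q 1)"
  proof (cases "r = 0")
    case True
    then have "subordinator q r = (\<lambda>_. 0)" by (simp add: subordinator_def fun_eq_iff)
    then show ?thesis using True by simp
  next
    case False
    then have r: "0 < r" using r by simp
    have "integrable lborel (\<lambda>s. subordinator q 1 (0 + r\<^sup>2 * s))"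
      using r by (intro lborel_integrable_real_affine subordinator_integrable_1[OF q]) auto
    moreover have "integral\<^sup>L lborel (subordinator q 1) = \<bar>r\<^sup>2\<bar> *\<^sub>R (\<integral>s. subordinator q 1 (0 + r\<^sup>2 * s) \<partial>lborel)"
      using r by (intro lborel_integral_real_affine) auto
    ultimately show ?thesis
      unfolding subordinator_scale[OF r, abs_def] by simp
  qed
  then show "integrable lborel (subordinator q r)"
    and "integral\<^sup>L lborel (subordinator q r) = r powr q * integral\<^sup>L lborel (subordinator q 1)"
    by auto
qed

text \<open>
  This says that the energy of the signed measure \<open>\<rho>\<^sup>N - \<delta>\<^sub>0\<close> is positive. In the subordination integral the
  integrand is a nonnegative multiple of the Gaussian energy of the same measure, which is at least a multiple of the square
  of \<open>N - \<Sum> exp (- s |x\<^sub>i|\<^sup>2)\<close>. That square is positive for every \<open>s > 0\<close> as soon as one particle is not at the origin.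
\<close>
lemma sum_pair_norm_powr_less:
  fixes X :: "'a::euclidean_space ^ 'n::finite"
  assumes q: "0 < q" "q < 2" and X: "X \<noteq> 0"
  shows "(\<Sum>i\<in>UNIV. \<Sum>j\<in>UNIV. norm (X $ i - X $ j) powr q) < 2 * real CARD('n) * (\<Sum>i\<in>UNIV. norm (X $ i) powr q)"
proof -
  let ?N = "real CARD('n)" and ?F = "subordinator q"
  define c where "c = integral\<^sup>L lborel (?F 1)"
  define Y where "Y s = 2 * ?N * (\<Sum>i\<in>UNIV. ?F (norm (X $ i)) s) - (\<Sum>i\<in>UNIV. \<Sum>j\<in>UNIV. ?F (norm (X $ i - X $ j)) s)" for s
  have int: "integrable lborel (?F (norm z))" for z :: 'a
    by (rule subordinator_integral[OF q norm_ge_zero])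
  have I: "integral\<^sup>L lborel (?F (norm z)) = norm z powr q * c" for z :: 'a
    unfolding c_def by (rule subordinator_integral[OF q norm_ge_zero])
  have Yint: "integrable lborel Y"
    unfolding Y_def by (intro Bochner_Integration.integrable_diff integrable_mult_right Bochner_Integration.integrable_sum int)
  have "integral\<^sup>L lborel Y = 2 * ?N * (\<Sum>i\<in>UNIV. norm (X $ i) powr q * c) - (\<Sum>i\<in>UNIV. \<Sum>j\<in>UNIV. norm (X $ i - X $ j) powr q * c)"
    unfolding Y_def using int I
    by (simp add: Bochner_Integration.integral_diff Bochner_Integration.integral_sum Bochner_Integration.integrable_sum)
  then have IY: "integral\<^sup>L lborel Y = c * (2 * ?N * (\<Sum>i\<in>UNIV. norm (X $ i) powr q) - (\<Sum>i\<in>UNIV. \<Sum>j\<in>UNIV. norm (X $ i - X $ j) powr q))"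
    unfolding sum_distrib_right[symmetric] by (simp add: algebra_simps)
  have Ypos: "0 < Y s" if s: "0 < s" for s
  proof -
    let ?e = "\<lambda>i. exp (- s * (norm (X $ i))\<^sup>2)" and ?w = "s powr (- 1 - q / 2)"
    let ?g = "\<lambda>i j. exp (- s * (norm (X $ i - X $ j))\<^sup>2)"
    have g: "?g i j = ?e i * ?e j * exp (2 * s * inner (X $ i) (X $ j))" for i j
    proof -
      have "(norm (X $ i - X $ j))\<^sup>2 = (norm (X $ i))\<^sup>2 + (norm (X $ j))\<^sup>2 - 2 * inner (X $ i) (X $ j)"
        by (simp add: power2_norm_eq_inner inner_diff_left inner_diff_right inner_commute)
      then have "- s * (norm (X $ i - X $ j))\<^sup>2 =
          (- s * (norm (X $ i))\<^sup>2 + - s * (norm (X $ j))\<^sup>2) + 2 * s * inner (X $ i) (X $ j)"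
        by (simp only:) (simp add: algebra_simps)
      then show ?thesis by (simp only: exp_add)
    qed
    have pd: "(\<Sum>i\<in>UNIV. ?e i)\<^sup>2 \<le> (\<Sum>i\<in>UNIV. \<Sum>j\<in>UNIV. ?g i j)"
      unfolding g by (rule square_sum_le_sum_exp_inner) (use s in simp)
    obtain k where k: "X $ k \<noteq> 0" using X by (auto simp: vec_eq_iff)
    have "(\<Sum>i\<in>UNIV. ?e i) < (\<Sum>i\<in>(UNIV::'n set). 1)"
    proof (rule sum_strict_mono_ex1)
      show "\<exists>a\<in>UNIV. ?e a < 1" using k s by (intro bexI[of _ k]) auto
    qed (use s in auto)
    then have "(\<Sum>i\<in>UNIV. ?e i) < ?N" by simp
    then have "0 < (?N - (\<Sum>i\<in>UNIV. ?e i))\<^sup>2" by simp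
    also have "\<dots> \<le> ?N\<^sup>2 - 2 * ?N * (\<Sum>i\<in>UNIV. ?e i) + (\<Sum>i\<in>UNIV. \<Sum>j\<in>UNIV. ?g i j)"
      using pd by (simp add: power2_eq_square algebra_simps)
    also have "\<dots> = 2 * ?N * (\<Sum>i\<in>UNIV. 1 - ?e i) - (\<Sum>i\<in>UNIV. \<Sum>j\<in>UNIV. 1 - ?g i j)"
      by (simp add: sum_subtractf power2_eq_square algebra_simps)
    finally have "0 < (2 * ?N * (\<Sum>i\<in>UNIV. 1 - ?e i) - (\<Sum>i\<in>UNIV. \<Sum>j\<in>UNIV. 1 - ?g i j)) * ?w"
      using s by simp
    also have "\<dots> = Y s"
      using s by (simp add: Y_def subordinator_def sum_distrib_right sum_distrib_left left_diff_distrib mult.assoc)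
    finally show ?thesis .
  qed
  have Ynonneg: "0 \<le> Y s" for s
  proof (cases "0 < s")
    case False
    then show ?thesis by (simp add: Y_def subordinator_def)
  qed (use Ypos in \<open>simp add: less_imp_le\<close>)
  have "integral\<^sup>L lborel Y \<noteq> 0"
  proof
    assume "integral\<^sup>L lborel Y = 0"
    then have "AE s in lborel. Y s = 0"
      using integral_nonneg_eq_0_iff_AE[OF Yint] Ynonneg by simp
    then have "AE s in lborel. s \<notin> {0<..<1::real}"
      by eventually_elim (use Ypos in force)
    then have "emeasure lborel {0<..<1::real} = 0"
      by (subst (asm) AE_iff_measurable[of "{0<..<1}"]) auto
    then show False by simp
  qed
  moreover have "0 \<le> integral\<^sup>L lborel Y"
    using Ynonneg by (intro Bochner_Integration.integral_nonneg)
  ultimately have "0 < integral\<^sup>L lborel Y" by simp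
  then have "0 < c * (2 * ?N * (\<Sum>i\<in>UNIV. norm (X $ i) powr q) - (\<Sum>i\<in>UNIV. \<Sum>j\<in>UNIV. norm (X $ i - X $ j) powr q))"
    unfolding IY .
  moreover have "0 \<le> c" unfolding c_def by (intro Bochner_Integration.integral_nonneg subordinator_nonneg)
  ultimately show ?thesis by (simp add: zero_less_mult_iff)
qed

text \<open>
  Both sides are homogeneous of degree \<open>q\<close>, so \<open>m\<close> is the minimum of the right-hand side on the unit sphere.
\<close>
lemma sum_pair_norm_powr_gap:
  assumes q: "0 < q" "q < 2"
  obtains m where "0 < m"
    "\<And>X :: 'a::euclidean_space ^ 'n::finite. m * norm X powr q \<le>
       2 * real CARD('n) * (\<Sum>i\<in>UNIV. norm (X $ i) powr q) - (\<Sum>i\<in>UNIV. \<Sum>j\<in>UNIV. norm (X $ i - X $ j) powr q)"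
proof -
  define \<Phi> :: "'a ^ 'n \<Rightarrow> real" where "\<Phi> X = 2 * real CARD('n) * (\<Sum>i\<in>UNIV. norm (X $ i) powr q) - (\<Sum>i\<in>UNIV. \<Sum>j\<in>UNIV. norm (X $ i - X $ j) powr q)" for X
  have c1: "continuous_on A (\<lambda>X :: 'a ^ 'n. norm (X $ i) powr q)" for A i
    by (rule continuous_on_powr') (use q in \<open>auto intro!: continuous_intros\<close>)
  have c2: "continuous_on A (\<lambda>X :: 'a ^ 'n. norm (X $ i - X $ j) powr q)" for A i j
    by (rule continuous_on_powr') (use q in \<open>auto intro!: continuous_intros\<close>)
  have cont: "continuous_on (sphere 0 1) \<Phi>"
    unfolding \<Phi>_def by (intro continuous_on_diff continuous_on_mult continuous_on_const continuous_on_sum c1 c2)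
  obtain b :: "'a ^ 'n" where "b \<in> Basis" using nonempty_Basis by blast
  then have "sphere (0 :: 'a ^ 'n) 1 \<noteq> {}" by force
  then obtain X0 where X0: "X0 \<in> sphere 0 1" "\<And>X. X \<in> sphere 0 1 \<Longrightarrow> \<Phi> X0 \<le> \<Phi> X"
    using continuous_attains_inf[OF compact_sphere _ cont] by blast
  have "X0 \<noteq> 0" using X0(1) by auto
  then have pos: "0 < \<Phi> X0" using sum_pair_norm_powr_less[OF q] by (simp add: \<Phi>_def)
  have "\<Phi> X0 * norm X powr q \<le> \<Phi> X" for X
  proof (cases "X = 0")
    case False
    define Y where "Y = (1 / norm X) *\<^sub>R X"
    have XY: "X = norm X *\<^sub>R Y" using False by (simp add: Y_def)
    have "\<Phi> X = norm X powr q * \<Phi> Y"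
    proof -
      have "norm (X $ i) powr q = norm X powr q * norm (Y $ i) powr q" for i
        by (subst XY) (simp add: powr_mult)
      moreover have "norm (X $ i - X $ j) powr q = norm X powr q * norm (Y $ i - Y $ j) powr q" for i j
      proof -
        have "X $ i - X $ j = norm X *\<^sub>R (Y $ i - Y $ j)"
          by (subst (1 2) XY) (simp add: scaleR_diff_right)
        then show ?thesis by (simp add: powr_mult)
      qed
      ultimately show ?thesis
        by (simp add: \<Phi>_def sum_distrib_left[symmetric] algebra_simps)
    qed
    moreover have "\<Phi> X0 \<le> \<Phi> Y" by (rule X0(2)) (use False in \<open>simp add: Y_def\<close>)
    ultimately show ?thesis by (simp add: mult_right_mono mult.commute)
  qed (use q in \<open>simp add: \<Phi>_def\<close>)
  then show ?thesis using that[OF pos] by (simp add: \<Phi>_def)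
qed

text \<open>
  Replacing \<open>|x - y|\<close> by \<open>|x|\<close> costs an arbitrarily small fraction of the leading term and a constant multiple of
  \<open>|y| powr q\<close>, which has a finite integral.
\<close>
lemma powr_norm_diff_lower:
  fixes x y :: "'a::real_normed_vector"
  assumes q: "0 < q" "q < 2" and \<eta>: "0 < \<eta>" "\<eta> < 1"
  shows "(1 - 2 * \<eta>) * norm x powr q - \<eta> powr (- q) * norm y powr q \<le> norm (x - y) powr q"
proof (cases "norm y \<le> \<eta> * norm x")
  case True
  have "1 - 2 * \<eta> \<le> (1 - \<eta>)\<^sup>2" by (simp add: power2_eq_square algebra_simps)
  also have "\<dots> = (1 - \<eta>) powr 2" using \<eta> by simp
  also have "\<dots> \<le> (1 - \<eta>) powr q" using \<eta> q by (intro powr_mono') auto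
  finally have "(1 - 2 * \<eta>) * norm x powr q \<le> (1 - \<eta>) powr q * norm x powr q"
    by (intro mult_right_mono) auto
  also have "\<dots> = ((1 - \<eta>) * norm x) powr q" using \<eta> by (simp add: powr_mult)
  also have "\<dots> \<le> norm (x - y) powr q"
  proof (rule powr_mono2)
    show "(1 - \<eta>) * norm x \<le> norm (x - y)"
      using True norm_triangle_ineq2[of x y] by (simp add: algebra_simps)
  qed (use \<eta> q in auto)
  also have "\<dots> \<le> norm (x - y) powr q + \<eta> powr (- q) * norm y powr q" by simp
  finally show ?thesis by linarith
next
  case False
  have "(1 - 2 * \<eta>) * norm x powr q \<le> 1 * norm x powr q"
    using \<eta> by (intro mult_right_mono) auto
  also have "\<dots> \<le> (norm y / \<eta>) powr q"
    using False \<eta> q by (simp, intro powr_mono2) (auto simp: field_simps)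
  also have "\<dots> = \<eta> powr (- q) * norm y powr q" using \<eta> by (simp add: powr_divide powr_minus field_simps)
  also have "\<dots> \<le> norm (x - y) powr q + \<eta> powr (- q) * norm y powr q" by simp
  finally show ?thesis by linarith
qed

section \<open>Coercivity of the energy and separation of the particles\<close>

lemma grad_kernel_lipschitz_away:
  fixes a b :: "'a::euclidean_space"
  assumes q: "0 < q" "q < 2" and \<delta>: "0 < \<delta>" "\<delta> \<le> norm a" "\<delta> \<le> norm b"
  shows "norm (grad_kernel q a - grad_kernel q b) \<le> 3 * q * \<delta> powr (q - 2) * norm (a - b)"
proof -
  have *: "norm (grad_kernel q a - grad_kernel q b) \<le> 3 * q * \<delta> powr (q - 2) * norm (a - b)"
    if "\<delta> \<le> norm a" "norm a \<le> norm b" for a b :: 'a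
  proof -
    have "norm (grad_kernel q a - grad_kernel q b) \<le> 3 * q * norm a powr (q - 2) * norm (a - b)"
      by (rule grad_kernel_lipschitz[OF q]) (use that \<delta> in auto)
    also have "\<dots> \<le> 3 * q * \<delta> powr (q - 2) * norm (a - b)"
      using that \<delta> q by (intro mult_right_mono mult_left_mono powr_mono2') auto
    finally show ?thesis .
  qed
  show ?thesis
    using *[of a b] *[of b a] \<delta> by (cases "norm a \<le> norm b") (auto simp: norm_minus_commute)
qed

lemma distinct_configs_gap:
  fixes X :: "'a::euclidean_space ^ 'n::finite"
  assumes "X \<in> distinct_configs"
  obtains d where "0 < d" "\<And>i j. i \<noteq> j \<Longrightarrow> d \<le> norm (X $ i - X $ j)"
proof -
  define S where "S = insert 1 ((\<lambda>(i, j). norm (X $ i - X $ j)) ` {(i, j). i \<noteq> j})"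
  have fin: "finite S" unfolding S_def by simp
  have "0 < Min S"
    using fin assms by (subst Min_gr_iff) (auto simp: S_def distinct_configs_def)
  moreover have "Min S \<le> norm (X $ i - X $ j)" if "i \<noteq> j" for i j
    using fin by (rule Min_le) (use that in \<open>auto simp: S_def\<close>)
  ultimately show ?thesis using that by blast
qed

text \<open>
  For \<open>C\<close> of cardinality \<open>m\<close> this is \<open>2 m\<close> times the moment of inertia of the cluster about its centre of mass.
\<close>
definition spread :: "'n set \<Rightarrow> 'a::euclidean_space ^ 'n::finite \<Rightarrow> real" where
  "spread C X = (\<Sum>i\<in>C. \<Sum>j\<in>C. (norm (X $ i - X $ j))\<^sup>2)"

lemma pair_le_spread:
  assumes "i \<in> C" "j \<in> C"
  shows "(norm (X $ i - X $ j))\<^sup>2 \<le> spread C X"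
proof -
  have "(norm (X $ i - X $ j))\<^sup>2 \<le> (\<Sum>j\<in>C. (norm (X $ i - X $ j))\<^sup>2)"
    using assms by (intro member_le_sum) auto
  also have "\<dots> \<le> spread C X"
    unfolding spread_def using assms
    by (intro member_le_sum[where f = "\<lambda>i. \<Sum>j\<in>C. (norm (X $ i - X $ j))\<^sup>2"]) (auto intro: sum_nonneg)
  finally show ?thesis .
qed

lemma spread_insert:
  assumes "k \<notin> C"
  shows "spread (insert k C) X = spread C X + 2 * (\<Sum>i\<in>C. (norm (X $ i - X $ k))\<^sup>2)"
  using assms by (simp add: spread_def sum.distrib norm_minus_commute)

text \<open>
  Pairwise antisymmetric forces have resultant \<open>0\<close>, so the mean position drops out and only the virial remains.
\<close>
lemma sum_antisymmetric_interaction: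
  fixes x :: "'i \<Rightarrow> 'a::real_inner" and w :: "'i \<Rightarrow> 'i \<Rightarrow> 'a"
  assumes "\<And>i k. w k i = - w i k"
  shows "(\<Sum>i\<in>C. \<Sum>j\<in>C. inner (x i - x j) ((\<Sum>k\<in>C. w i k) - (\<Sum>k\<in>C. w j k))) =
         real (card C) * (\<Sum>i\<in>C. \<Sum>k\<in>C. inner (x i - x k) (w i k))"
proof -
  define A where "A i = (\<Sum>k\<in>C. w i k)" for i
  have "(\<Sum>i\<in>C. A i) = (\<Sum>k\<in>C. \<Sum>i\<in>C. w i k)" unfolding A_def by (rule sum.swap)
  also have "\<dots> = - (\<Sum>k\<in>C. A k)"
    unfolding A_def by (simp add: sum_negf[symmetric] assms[symmetric])
  finally have "(\<Sum>i\<in>C. A i) + (\<Sum>i\<in>C. A i) = 0" by (simp only: eq_neg_iff_add_eq_0)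
  then have "2 *\<^sub>R (\<Sum>i\<in>C. A i) = 0" by (simp only: scaleR_2)
  then have A0: "(\<Sum>i\<in>C. A i) = 0" by simp
  have xA: "(\<Sum>i\<in>C. \<Sum>j\<in>C. inner (x i) (A j)) = 0" 
    by (simp only: inner_sum_right[symmetric] A0 inner_zero_right sum.neutral_const)
  then have Ax: "(\<Sum>i\<in>C. \<Sum>j\<in>C. inner (x j) (A i)) = 0" by (subst sum.swap)
  have "(\<Sum>i\<in>C. \<Sum>j\<in>C. inner (x i - x j) (A i - A j)) = 2 * real (card C) * (\<Sum>i\<in>C. inner (x i) (A i))"
    by (simp add: inner_diff_left inner_diff_right sum_subtractf xA Ax sum_distrib_left[symmetric])
  moreover have "(\<Sum>i\<in>C. \<Sum>k\<in>C. inner (x k) (w i k)) = - (\<Sum>i\<in>C. inner (x i) (A i))"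
  proof -
    have "(\<Sum>i\<in>C. \<Sum>k\<in>C. inner (x k) (w i k)) = (\<Sum>k\<in>C. \<Sum>i\<in>C. inner (x k) (w i k))" by (rule sum.swap)
    also have "\<dots> = (\<Sum>k\<in>C. \<Sum>i\<in>C. - inner (x k) (w k i))"
      by (intro sum.cong refl) (metis assms inner_minus_right)
    finally show ?thesis by (simp add: A_def inner_sum_right sum_negf)
  qed
  moreover have "(\<Sum>i\<in>C. \<Sum>k\<in>C. inner (x i) (w i k)) = (\<Sum>i\<in>C. inner (x i) (A i))"
    by (simp add: A_def inner_sum_right)
  ultimately show ?thesis
    unfolding A_def[symmetric] by (simp add: inner_diff_left sum_subtractf)
qed

lemma eventually_mult_powr_less:
  fixes A s e :: real
  assumes "0 < s" "0 < e"
  shows "\<forall>\<^sub>F r in at_right 0. A * r powr s < e"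
proof -
  have "((\<lambda>r. r powr s) \<longlongrightarrow> 0 powr s) (at_right (0::real))"
    using assms by (intro tendsto_powr2 tendsto_intros) (auto simp: eventually_at_filter)
  then have "((\<lambda>r. A * r powr s) \<longlongrightarrow> 0) (at_right (0::real))"
    using assms tendsto_mult_right_zero by simp
  then show ?thesis using assms(2) by (rule order_tendstoD)
qed

context target_measure
begin

text \<open>
  A solution on the compact interval \<open>{0..T}\<close>, the form in which a priori estimates are stated: they concern all
  solutions with the given initial configuration, not a particular one.
\<close>
definition solves :: "real \<Rightarrow> 'a ^ 'n::finite \<Rightarrow> (real \<Rightarrow> 'a ^ 'n) \<Rightarrow> bool" where
  "solves T X0 X \<longleftrightarrow> X 0 = X0 \<and> (\<forall>t\<in>{0..T}. X t \<in> distinct_configs \<and>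
     (X has_vector_derivative velocity q \<mu> (X t)) (at t within {0..T}))"

text \<open>
  The energy exceeds a multiple of the energy of \<open>\<rho>\<^sup>N - \<delta>\<^sub>0\<close> up to an error that is a small
  fraction of \<open>|X| powr q\<close> plus a constant; \<open>\<eta>\<close> is chosen so that the fraction is at most half of the leading term.
\<close>
lemma particle_energy_coercive:
  "\<exists>R. \<forall>X :: 'a ^ 'n::finite. particle_energy q \<mu> X \<le> B \<longrightarrow> norm X \<le> R"
proof -
  let ?N = "real CARD('n)"
  have N: "0 < ?N" by simp
  obtain m where m: "0 < m" "\<And>X :: 'a ^ 'n. m * norm X powr q \<le>
       2 * ?N * (\<Sum>i\<in>UNIV. norm (X $ i) powr q) - (\<Sum>i\<in>UNIV. \<Sum>j\<in>UNIV. norm (X $ i - X $ j) powr q)"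
    using sum_pair_norm_powr_gap[OF q] by metis
  define \<kappa> where "\<kappa> = m / (2 * ?N\<^sup>2)"
  have \<kappa>: "0 < \<kappa>" using m by (simp add: \<kappa>_def)
  define \<eta> where "\<eta> = min (1 / 2) (\<kappa> / 4)"
  have \<eta>: "0 < \<eta>" "\<eta> < 1" "2 * \<eta> \<le> \<kappa> / 2" using \<kappa> by (auto simp: \<eta>_def)
  define A where "A = (LINT y|\<mu>. norm y powr q)"
  define c where "c = (1/2) * integral\<^sup>L \<mu> potential"
  have int: "integrable \<mu> (\<lambda>y. norm y powr q)"
    using integrable_kernel[of 0] by (simp add: kernel_def)
  have pot: "(1 - 2 * \<eta>) * norm x powr q - \<eta> powr (- q) * A \<le> - potential x" for x
  proof -
    have "(1 - 2 * \<eta>) * norm x powr q - \<eta> powr (- q) * A =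
        (LINT y|\<mu>. (1 - 2 * \<eta>) * norm x powr q - \<eta> powr (- q) * norm y powr q)"
      using int by (simp add: A_def Bochner_Integration.integral_diff prob_space)
    also have "\<dots> \<le> (LINT y|\<mu>. - kernel q (x - y))"
      using int integrable_kernel powr_norm_diff_lower[OF q \<eta>(1,2), of x]
      by (intro integral_mono) (auto simp: kernel_def)
    also have "\<dots> = - potential x" by (simp add: potential_def)
    finally show ?thesis .
  qed
  have lower: "(\<kappa> / 2) * norm X powr q - \<eta> powr (- q) * A + c \<le> particle_energy q \<mu> X" for X :: "'a ^ 'n"
  proof -
    let ?S = "\<Sum>i\<in>UNIV. norm (X $ i) powr q" and ?P = "\<Sum>i\<in>UNIV. \<Sum>j\<in>UNIV. norm (X $ i - X $ j) powr q"
    have "?S \<le> (\<Sum>i\<in>(UNIV::'n set). norm X powr q)"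
      using q by (intro sum_mono powr_mono2 Finite_Cartesian_Product.norm_nth_le) auto
    then have S: "?S \<le> ?N * norm X powr q" by simp
    have "(\<Sum>i\<in>UNIV. (1 - 2 * \<eta>) * norm (X $ i) powr q - \<eta> powr (- q) * A) \<le> (\<Sum>i\<in>UNIV. - potential (X $ i))"
      by (intro sum_mono pot)
    then have P: "(1 - 2 * \<eta>) * ?S - ?N * (\<eta> powr (- q) * A) \<le> - (\<Sum>i\<in>UNIV. potential (X $ i))"
      by (simp add: sum_subtractf sum_negf sum_distrib_left[symmetric])
    have E: "particle_energy q \<mu> X = - (1 / (2 * ?N\<^sup>2)) * ?P + (1 / ?N) * (- (\<Sum>i\<in>UNIV. potential (X $ i))) + c"
      by (simp add: particle_energy_eq c_def kernel_def sum_negf)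
    have 1: "(1 / ?N) * ((1 - 2 * \<eta>) * ?S - ?N * (\<eta> powr (- q) * A)) \<le> (1 / ?N) * (- (\<Sum>i\<in>UNIV. potential (X $ i)))"
      by (rule mult_left_mono[OF P]) simp
    have 2: "- (1 / (2 * ?N\<^sup>2)) * ?P + (1 / ?N) * ((1 - 2 * \<eta>) * ?S - ?N * (\<eta> powr (- q) * A)) =
        (1 / (2 * ?N\<^sup>2)) * (2 * ?N * ?S - ?P) - (1 / ?N) * (2 * \<eta> * ?S) - \<eta> powr (- q) * A"
      by (simp add: field_simps power2_eq_square)
    have 3: "(1 / (2 * ?N\<^sup>2)) * (m * norm X powr q) \<le> (1 / (2 * ?N\<^sup>2)) * (2 * ?N * ?S - ?P)"
      by (rule mult_left_mono[OF m(2)]) simp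
    have "2 * \<eta> * ?S \<le> (\<kappa> / 2) * (?N * norm X powr q)"
      using S \<eta> \<kappa> by (intro mult_mono sum_nonneg) auto
    then have 4: "(1 / ?N) * (2 * \<eta> * ?S) \<le> (1 / ?N) * ((\<kappa> / 2) * (?N * norm X powr q))"
      by (rule mult_left_mono) simp
    have 5: "(1 / (2 * ?N\<^sup>2)) * (m * norm X powr q) = \<kappa> * norm X powr q"
      "(1 / ?N) * ((\<kappa> / 2) * (?N * norm X powr q)) = (\<kappa> / 2) * norm X powr q"
      by (simp_all add: \<kappa>_def)
    show ?thesis using 1 2 3 4 5 unfolding E by linarith
  qed
  show ?thesis
  proof (intro exI allI impI)
    fix X :: "'a ^ 'n" assume "particle_energy q \<mu> X \<le> B"
    with lower[of X] have "(\<kappa> / 2) * norm X powr q \<le> B + \<eta> powr (- q) * A - c" by linarith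
    then have le: "norm X powr q \<le> (B + \<eta> powr (- q) * A - c) / (\<kappa> / 2)"
      using \<kappa> by (simp add: field_simps)
    have "norm X = (norm X powr q) powr (1 / q)" using q by (simp add: powr_powr)
    also have "\<dots> \<le> ((B + \<eta> powr (- q) * A - c) / (\<kappa> / 2)) powr (1 / q)"
      using le q by (intro powr_mono2) auto
    finally show "norm X \<le> ((B + \<eta> powr (- q) * A - c) / (\<kappa> / 2)) powr (1 / q)" .
  qed
qed

text \<open>
  The sum in the conclusion is half of the time derivative of the spread. It is bounded below pair by pair: a pair at
  distance \<open>r\<close> gains at least \<open>2 q / N\<close> times \<open>r powr q\<close> from the repulsion inside the cluster and loses at most
  \<open>L r\<^sup>2\<close> to the other particles and \<open>6 q M r powr (1 + \<beta>)\<close> to the target.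
\<close>
lemma isolated_cluster_expands:
  assumes \<delta>: "0 < \<delta>"
  obtains \<rho> where "0 < \<rho>"
    "\<And>(X :: 'a ^ 'n::finite) C. X \<in> distinct_configs \<Longrightarrow> 2 \<le> card C \<Longrightarrow>
        (\<And>i k. i \<in> C \<Longrightarrow> k \<notin> C \<Longrightarrow> \<delta> \<le> norm (X $ i - X $ k)) \<Longrightarrow> spread C X < \<rho>\<^sup>2 \<Longrightarrow>
        0 < (\<Sum>i\<in>C. \<Sum>j\<in>C. inner (X $ i - X $ j) (velocity q \<mu> X $ i - velocity q \<mu> X $ j))"
proof -
  let ?N = "real CARD('n)"
  define L where "L = 3 * q * \<delta> powr (q - 2)"
  have L0: "0 \<le> L" using q by (simp add: L_def)
  have "\<forall>\<^sub>F r in at_right 0. L * r powr (2 - q) < q / ?N \<and> 6 * q * M * r powr (1 + \<beta> - q) < q / ?N"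
    using q \<beta> by (intro eventually_conj eventually_mult_powr_less) auto
  then obtain \<rho> where \<rho>: "0 < \<rho>" "\<And>r. 0 < r \<Longrightarrow> r < \<rho> \<Longrightarrow> L * r powr (2 - q) < q / ?N \<and> 6 * q * M * r powr (1 + \<beta> - q) < q / ?N"
    by (auto simp: eventually_at_right_field)
  have dom: "L * r\<^sup>2 + 6 * q * M * (r * r powr \<beta>) < (2 * q / ?N) * r powr q" if "0 < r" "r < \<rho>" for r
  proof -
    have "r\<^sup>2 = r powr q * r powr (2 - q)" using that by (simp flip: powr_add)
    moreover have "r * r powr \<beta> = r powr q * r powr (1 + \<beta> - q)"
      using that powr_add[of r 1 \<beta>] by (simp flip: powr_add)
    moreover have "r powr q * (L * r powr (2 - q) + 6 * q * M * r powr (1 + \<beta> - q)) < r powr q * (q / ?N + q / ?N)"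
      using \<rho>(2)[OF that] that by (intro mult_strict_left_mono add_strict_mono) auto
    ultimately show ?thesis by (simp add: algebra_simps)
  qed
  have main: "0 < (\<Sum>i\<in>C. \<Sum>j\<in>C. inner (X $ i - X $ j) (velocity q \<mu> X $ i - velocity q \<mu> X $ j))"
    if X: "X \<in> distinct_configs" and C: "2 \<le> card C"
      and far: "\<And>i k. i \<in> C \<Longrightarrow> k \<notin> C \<Longrightarrow> \<delta> \<le> norm (X $ i - X $ k)" and small: "spread C X < \<rho>\<^sup>2"
    for X :: "'a ^ 'n" and C
  proof -
    define w where "w i k = - ((1 / ?N) *\<^sub>R grad_kernel q (X $ i - X $ k))" for i k
    define a where "a i = (\<Sum>k\<in>C. w i k)" for i
    define b where "b i = (\<Sum>k\<in>-C. w i k)" for i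
    have v: "velocity q \<mu> X $ i = a i + b i + drift (X $ i)" for i
    proof -
      have "(\<Sum>k\<in>UNIV. w i k) = (\<Sum>k\<in>C \<union> - C. w i k)" by simp
      also have "\<dots> = a i + b i" unfolding a_def b_def by (rule sum.union_disjoint) auto
      finally show ?thesis
        by (simp add: velocity_nth w_def sum_negf scaleR_sum_right)
    qed
    have anti: "w k i = - w i k" for i k
      unfolding w_def by (subst grad_kernel_swap) simp
    have wsq: "inner (X $ i - X $ k) (w i k) = (q / ?N) * norm (X $ i - X $ k) powr q" for i k
      by (simp add: w_def inner_grad_kernel)
    have "(\<Sum>i\<in>C. \<Sum>j\<in>C. inner (X $ i - X $ j) (a i - a j)) =
        real (card C) * (\<Sum>i\<in>C. \<Sum>j\<in>C. (q / ?N) * norm (X $ i - X $ j) powr q)"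
      unfolding a_def using sum_antisymmetric_interaction[of w "\<lambda>i. X $ i" C, OF anti] by (simp only: wsq)
    also have "\<dots> \<ge> 2 * (\<Sum>i\<in>C. \<Sum>j\<in>C. (q / ?N) * norm (X $ i - X $ j) powr q)"
      using C q by (intro mult_right_mono sum_nonneg) auto
    finally have inside: "(\<Sum>i\<in>C. \<Sum>j\<in>C. (2 * q / ?N) * norm (X $ i - X $ j) powr q)
        \<le> (\<Sum>i\<in>C. \<Sum>j\<in>C. inner (X $ i - X $ j) (a i - a j))"
      by (simp add: sum_distrib_left mult.assoc)
    have outside: "- (L * (norm (X $ i - X $ j))\<^sup>2 + 6 * q * M * (norm (X $ i - X $ j) * norm (X $ i - X $ j) powr \<beta>))
        \<le> inner (X $ i - X $ j) ((b i - b j) + (drift (X $ i) - drift (X $ j)))" if ij: "i \<in> C" "j \<in> C" for i j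
    proof -
      let ?r = "norm (X $ i - X $ j)"
      have "norm (b i - b j) \<le> (\<Sum>k\<in>-C. norm (w i k - w j k))"
        unfolding b_def sum_subtractf[symmetric] by (rule norm_sum)
      also have "\<dots> \<le> (\<Sum>k\<in>-C. (1 / ?N) * (L * ?r))"
      proof (rule sum_mono)
        fix k assume k: "k \<in> - C"
        have "w i k - w j k = (1 / ?N) *\<^sub>R (grad_kernel q (X $ j - X $ k) - grad_kernel q (X $ i - X $ k))"
          by (simp add: w_def scaleR_diff_right)
        then have "norm (w i k - w j k) = (1 / ?N) * norm (grad_kernel q (X $ j - X $ k) - grad_kernel q (X $ i - X $ k))"
          by simp
        also have "norm (grad_kernel q (X $ j - X $ k) - grad_kernel q (X $ i - X $ k)) \<le> L * norm ((X $ j - X $ k) - (X $ i - X $ k))"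
          unfolding L_def using k ij far by (intro grad_kernel_lipschitz_away q \<delta>) auto
        also have "(X $ j - X $ k) - (X $ i - X $ k) = - (X $ i - X $ j)" by simp
        finally show "norm (w i k - w j k) \<le> (1 / ?N) * (L * ?r)"
          unfolding norm_minus_cancel by (simp add: divide_right_mono)
      qed
      also have "\<dots> = (real (card (- C)) / ?N) * (L * ?r)" by simp
      also have "\<dots> \<le> 1 * (L * ?r)"
        using L0 by (intro mult_right_mono) (auto simp: divide_le_eq card_mono)
      finally have b: "norm (b i - b j) \<le> L * ?r" by simp
      have "norm ((b i - b j) + (drift (X $ i) - drift (X $ j))) \<le> L * ?r + 6 * q * M * ?r powr \<beta>"
        using norm_triangle_mono[OF b drift_holder] .
      then have "?r * norm ((b i - b j) + (drift (X $ i) - drift (X $ j))) \<le> ?r * (L * ?r + 6 * q * M * ?r powr \<beta>)"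
        by (rule mult_left_mono) simp
      also have "\<dots> = L * ?r\<^sup>2 + 6 * q * M * (?r * ?r powr \<beta>)"
        by (simp add: power2_eq_square algebra_simps)
      finally show ?thesis
        using Cauchy_Schwarz_ineq2[of "X $ i - X $ j" "(b i - b j) + (drift (X $ i) - drift (X $ j))"] by linarith
    qed
    define e where "e i j = (2 * q / ?N) * norm (X $ i - X $ j) powr q
        - (L * (norm (X $ i - X $ j))\<^sup>2 + 6 * q * M * (norm (X $ i - X $ j) * norm (X $ i - X $ j) powr \<beta>))" for i j
    have epos: "0 < e i j" if "i \<in> C" "j \<in> C" "i \<noteq> j" for i j
    proof -
      have "(norm (X $ i - X $ j))\<^sup>2 < \<rho>\<^sup>2" using pair_le_spread[OF that(1,2), of X] small by linarith
      then have "norm (X $ i - X $ j) < \<rho>" using \<rho>(1) by (simp add: power_less_imp_less_base)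
      moreover have "0 < norm (X $ i - X $ j)" using X that by (auto simp: distinct_configs_def)
      ultimately show ?thesis using dom[of "norm (X $ i - X $ j)"] by (simp add: e_def)
    qed
    have enn: "0 \<le> e i j" if "i \<in> C" "j \<in> C" for i j
      using epos[OF that] q \<beta> by (cases "i = j") (auto simp: e_def)
    obtain i0 j0 where ij0: "i0 \<in> C" "j0 \<in> C" "i0 \<noteq> j0"
      using C by (metis card_le_Suc0_iff_eq finite not_less_eq_eq numeral_2_eq_2)
    have "0 < (\<Sum>j\<in>C. e i0 j)"
      using ij0 enn epos by (intro sum_pos2[of _ j0]) auto
    then have "0 < (\<Sum>i\<in>C. \<Sum>j\<in>C. e i j)"
      using ij0 enn by (intro sum_pos2[of C i0 "\<lambda>i. \<Sum>j\<in>C. e i j"] sum_nonneg) auto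
    also have "\<dots> = (\<Sum>i\<in>C. \<Sum>j\<in>C. (2 * q / ?N) * norm (X $ i - X $ j) powr q) +
        (\<Sum>i\<in>C. \<Sum>j\<in>C. - (L * (norm (X $ i - X $ j))\<^sup>2 + 6 * q * M * (norm (X $ i - X $ j) * norm (X $ i - X $ j) powr \<beta>)))"
      unfolding e_def sum.distrib[symmetric] by (intro sum.cong refl diff_conv_add_uminus)
    also have "\<dots> \<le> (\<Sum>i\<in>C. \<Sum>j\<in>C. inner (X $ i - X $ j) (a i - a j)) +
        (\<Sum>i\<in>C. \<Sum>j\<in>C. inner (X $ i - X $ j) ((b i - b j) + (drift (X $ i) - drift (X $ j))))"
      by (intro add_mono inside sum_mono outside)
    also have "\<dots> = (\<Sum>i\<in>C. \<Sum>j\<in>C. inner (X $ i - X $ j) (velocity q \<mu> X $ i - velocity q \<mu> X $ j))"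
      unfolding sum.distrib[symmetric] inner_add_right[symmetric]
      by (intro sum.cong refl arg_cong2[where f = inner]) (simp add: v)
    finally show ?thesis .
  qed
  show ?thesis by (rule that[OF \<rho>(1) main])
qed

lemma spread_has_derivative:
  fixes X :: "real \<Rightarrow> 'a ^ 'n::finite"
  assumes "(X has_vector_derivative V) (at t within I)"
  shows "((\<lambda>t. spread C (X t)) has_real_derivative
    2 * (\<Sum>i\<in>C. \<Sum>j\<in>C. inner (X t $ i - X t $ j) (V $ i - V $ j))) (at t within I)"
proof -
  have "((\<lambda>t. X t $ i) has_vector_derivative V $ i) (at t within I)" for i
    by (rule bounded_linear.has_vector_derivative[OF bounded_linear_vec_nth assms])
  then have "((\<lambda>t. X t $ i - X t $ j) has_vector_derivative (V $ i - V $ j)) (at t within I)" for i j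
    by (intro has_vector_derivative_diff)
  then have d: "((\<lambda>t. X t $ i - X t $ j) has_derivative (\<lambda>h. h *\<^sub>R (V $ i - V $ j))) (at t within I)" for i j
    by (simp add: has_vector_derivative_def)
  have "((\<lambda>t. (norm (X t $ i - X t $ j))\<^sup>2) has_derivative
     (\<lambda>h. h * (2 * inner (X t $ i - X t $ j) (V $ i - V $ j)))) (at t within I)" for i j
    unfolding power2_norm_eq_inner
    by (rule has_derivative_eq_rhs[OF has_derivative_inner[OF d d]]) (simp add: fun_eq_iff inner_commute)
  then have "((\<lambda>t. spread C (X t)) has_derivative
     (\<lambda>h. \<Sum>i\<in>C. \<Sum>j\<in>C. h * (2 * inner (X t $ i - X t $ j) (V $ i - V $ j)))) (at t within I)"
    unfolding spread_def by (intro has_derivative_sum)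
  then show ?thesis
    unfolding has_field_derivative_def
    by (rule has_derivative_eq_rhs) (simp add: fun_eq_iff sum_distrib_left sum_distrib_right mult_ac)
qed

text \<open>
  Descending induction on \<open>m\<close>. If a cluster of \<open>m\<close> particles is very small while all clusters of \<open>m + 1\<close> particles have
  spread at least \<open>\<epsilon>\<close>, then no other particle can be near it, so it expands. Its spread hence cannot fall below a
  threshold. For \<open>m = N\<close> there is no other particle.
\<close>
lemma cluster_spread_lower_bound:
  fixes X0 :: "'a ^ 'n::finite"
  assumes X0: "X0 \<in> distinct_configs" and m: "2 \<le> m" "m \<le> CARD('n)"
  shows "\<exists>\<epsilon>>0. \<forall>T X C. solves T X0 X \<longrightarrow> card C = m \<longrightarrow> (\<forall>t\<in>{0..T}. \<epsilon> \<le> spread C (X t))"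
proof -
  obtain d0 where d0: "0 < d0" "\<And>i j. i \<noteq> j \<Longrightarrow> d0 \<le> norm (X0 $ i - X0 $ j)"
    using distinct_configs_gap[OF X0] by blast
  have propagate: "\<exists>\<epsilon>>0. \<forall>T X C. solves T X0 X \<longrightarrow> card C = m \<longrightarrow> (\<forall>t\<in>{0..T}. \<epsilon> \<le> spread C (X t))"
    if m: "2 \<le> m" and \<delta>: "0 < \<delta>"
      and far: "\<And>T X C t i k. solves T X0 X \<Longrightarrow> card C = m \<Longrightarrow> t \<in> {0..T} \<Longrightarrow> spread C (X t) < \<delta>\<^sup>2 \<Longrightarrow>
        i \<in> C \<Longrightarrow> k \<notin> C \<Longrightarrow> \<delta> \<le> norm (X t $ i - X t $ k)"
    for m \<delta>
  proof -
    obtain \<rho> where \<rho>: "0 < \<rho>"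
      "\<And>(X :: 'a ^ 'n) C. X \<in> distinct_configs \<Longrightarrow> 2 \<le> card C \<Longrightarrow>
        (\<And>i k. i \<in> C \<Longrightarrow> k \<notin> C \<Longrightarrow> \<delta> \<le> norm (X $ i - X $ k)) \<Longrightarrow> spread C X < \<rho>\<^sup>2 \<Longrightarrow>
        0 < (\<Sum>i\<in>C. \<Sum>j\<in>C. inner (X $ i - X $ j) (velocity q \<mu> X $ i - velocity q \<mu> X $ j))"
      using isolated_cluster_expands[OF \<delta>, where 'n = 'n] by blast
    define c where "c = min (d0\<^sup>2) (min (\<rho>\<^sup>2) (\<delta>\<^sup>2))"
    have "0 < c" using d0(1) \<rho>(1) \<delta> by (simp add: c_def)
    moreover have "c \<le> spread C (X t)" if X: "solves T X0 X" and C: "card C = m" and t: "t \<in> {0..T}" for T X C t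
    proof (rule lower_barrier[where u = "\<lambda>t. spread C (X t)" and T = T])
      fix s assume s: "s \<in> {0..T}"
      show "((\<lambda>t. spread C (X t)) has_real_derivative
          2 * (\<Sum>i\<in>C. \<Sum>j\<in>C. inner (X s $ i - X s $ j) (velocity q \<mu> (X s) $ i - velocity q \<mu> (X s) $ j))) (at s within {0..T})"
        using X s by (intro spread_has_derivative) (auto simp: solves_def)
      assume "spread C (X s) < c"
      then have "spread C (X s) < \<rho>\<^sup>2" "spread C (X s) < \<delta>\<^sup>2" by (auto simp: c_def)
      then show "0 < 2 * (\<Sum>i\<in>C. \<Sum>j\<in>C. inner (X s $ i - X s $ j) (velocity q \<mu> (X s) $ i - velocity q \<mu> (X s) $ j))"
        using \<rho>(2)[of "X s" C] far[OF X C s] X s C m by (auto simp: solves_def)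
    next
      obtain i j where ij: "i \<in> C" "j \<in> C" "i \<noteq> j"
        using C m by (metis card_le_Suc0_iff_eq finite not_less_eq_eq numeral_2_eq_2)
      have "c \<le> d0\<^sup>2" by (simp add: c_def)
      also have "\<dots> \<le> (norm (X0 $ i - X0 $ j))\<^sup>2" using d0 ij by (intro power_mono) auto
      also have "\<dots> \<le> spread C X0" using ij by (intro pair_le_spread)
      finally show "c \<le> spread C (X 0)" using X by (simp add: solves_def)
    qed (use t in auto)
    ultimately show ?thesis by blast
  qed
  show ?thesis using m(2)
  proof (induction rule: inc_induct)
    case base
    show ?case
    proof (rule propagate[OF _ zero_less_one])
      show "2 \<le> CARD('n)" using m by simp
      fix X :: "real \<Rightarrow> 'a ^ 'n" and C :: "'n set" and t i k
      assume "card C = CARD('n)" "k \<notin> C"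
      then show "1 \<le> norm (X t $ i - X t $ k)"
        using card_subset_eq[of UNIV C] by auto
    qed
  next
    case (step n)
    then obtain \<epsilon> where \<epsilon>: "0 < \<epsilon>"
      "\<And>T X C t. solves T X0 X \<Longrightarrow> card C = Suc n \<Longrightarrow> t \<in> {0..T} \<Longrightarrow> \<epsilon> \<le> spread C (X t)" by blast
    let ?N = "real CARD('n)"
    \<comment> \<open>Adding a particle within \<open>2 \<delta>\<close> of every member raises a spread below \<open>\<delta>\<^sup>2\<close> by at most \<open>8 N \<delta>\<^sup>2\<close>.\<close>
    define \<delta> where "\<delta> = sqrt (\<epsilon> / (1 + 8 * ?N))"
    have \<delta>: "0 < \<delta>" "(1 + 8 * ?N) * \<delta>\<^sup>2 = \<epsilon>" using \<epsilon>(1) by (auto simp: \<delta>_def add_pos_nonneg)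
    show ?case
    proof (rule propagate[OF _ \<delta>(1)])
      show "2 \<le> n" using step m by simp
      fix T X t i k and C :: "'n set"
      assume X: "solves T X0 X" and C: "card C = n" and t: "t \<in> {0..T}" and small: "spread C (X t) < \<delta>\<^sup>2"
        and i: "i \<in> C" and k: "k \<notin> C"
      show "\<delta> \<le> norm (X t $ i - X t $ k)"
      proof (rule ccontr)
        assume "\<not> \<delta> \<le> norm (X t $ i - X t $ k)"
        have near: "(norm (X t $ j - X t $ k))\<^sup>2 \<le> 4 * \<delta>\<^sup>2" if "j \<in> C" for j
        proof -
          have "(norm (X t $ j - X t $ i))\<^sup>2 < \<delta>\<^sup>2"
            using pair_le_spread[OF that i, of "X t"] small by linarith
          then have "norm (X t $ j - X t $ i) < \<delta>" using \<delta>(1) by (simp add: power_less_imp_less_base)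
          then have "norm (X t $ j - X t $ k) \<le> 2 * \<delta>"
            using norm_triangle_ineq[of "X t $ j - X t $ i" "X t $ i - X t $ k"] \<open>\<not> \<delta> \<le> _\<close> by simp
          then have "(norm (X t $ j - X t $ k))\<^sup>2 \<le> (2 * \<delta>)\<^sup>2" by (intro power_mono) auto
          then show ?thesis by (simp add: power_mult_distrib)
        qed
        have "(\<Sum>j\<in>C. (norm (X t $ j - X t $ k))\<^sup>2) \<le> real (card C) * (4 * \<delta>\<^sup>2)"
          using near by (intro sum_bounded_above) auto
        also have "\<dots> \<le> ?N * (4 * \<delta>\<^sup>2)"
          by (intro mult_right_mono of_nat_mono card_mono) auto
        finally have "spread (insert k C) (X t) < \<delta>\<^sup>2 + 2 * (?N * (4 * \<delta>\<^sup>2))"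
          using small unfolding spread_insert[OF k] by linarith
        also have "\<dots> = \<epsilon>" using \<delta>(2) by (simp add: algebra_simps)
        finally show False
          using \<epsilon>(2)[OF X _ t, of "insert k C"] C k by simp
      qed
    qed
  qed
qed

lemma uniform_separation:
  fixes X0 :: "'a ^ 'n::finite"
  assumes X0: "X0 \<in> distinct_configs" and N: "2 \<le> CARD('n)"
  shows "\<exists>\<epsilon>>0. \<forall>T X. solves T X0 X \<longrightarrow> (\<forall>t\<in>{0..T}. \<forall>i j. i \<noteq> j \<longrightarrow> \<epsilon> \<le> norm (X t $ i - X t $ j))"
proof -
  obtain \<epsilon> where \<epsilon>: "0 < \<epsilon>"
    "\<And>T X C t. solves T X0 X \<Longrightarrow> card C = 2 \<Longrightarrow> t \<in> {0..T} \<Longrightarrow> \<epsilon> \<le> spread C (X t)"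
    using cluster_spread_lower_bound[OF X0 order_refl N] by blast
  have "sqrt (\<epsilon> / 2) \<le> norm (X t $ i - X t $ j)" if "solves T X0 X" "t \<in> {0..T}" "i \<noteq> j" for T X t i j
  proof -
    have "\<epsilon> \<le> spread {i, j} (X t)" using that by (intro \<epsilon>(2)) auto
    also have "\<dots> = 2 * (norm (X t $ i - X t $ j))\<^sup>2"
      using that(3) by (simp add: spread_def norm_minus_commute)
    finally show ?thesis by (intro real_le_lsqrt) auto
  qed
  then show ?thesis using \<epsilon>(1) by (intro exI[of _ "sqrt (\<epsilon> / 2)"]) auto
qed

lemma energy_has_derivative:
  fixes X :: "real \<Rightarrow> 'a ^ 'n::finite"
  assumes "X t \<in> distinct_configs" "(X has_vector_derivative velocity q \<mu> (X t)) (at t within I)"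
  shows "((\<lambda>t. particle_energy q \<mu> (X t)) has_real_derivative
     - ((1 / real CARD('n)) * (norm (velocity q \<mu> (X t)))\<^sup>2)) (at t within I)"
proof -
  have "(X has_derivative (\<lambda>h. h *\<^sub>R velocity q \<mu> (X t))) (at t within I)"
    using assms(2) by (simp add: has_vector_derivative_def)
  from has_derivative_compose[OF this GDERIV_particle_energy[OF assms(1), unfolded gderiv_def]]
  show ?thesis
    unfolding has_field_derivative_def
    by (rule has_derivative_eq_rhs) (simp add: fun_eq_iff power2_norm_eq_inner)
qed

text \<open>
  The quantitative version, with \<open>c > 0\<close>, drives LaSalle's argument; \<open>c = 0\<close> gives monotonicity.
\<close>
lemma energy_decay:
  fixes X :: "real \<Rightarrow> 'a ^ 'n::finite"
  assumes X: "solves T X0 X" and st: "0 \<le> s" "s \<le> t" "t \<le> T"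
    and c: "\<And>x. x \<in> {s..t} \<Longrightarrow> c \<le> (norm (velocity q \<mu> (X x)))\<^sup>2"
  shows "particle_energy q \<mu> (X t) \<le> particle_energy q \<mu> (X s) - (c / real CARD('n)) * (t - s)"
proof (cases "s = t")
  case False
  have "\<exists>x\<in>{s<..<t}. particle_energy q \<mu> (X t) - particle_energy q \<mu> (X s) =
      (\<lambda>h. - ((1 / real CARD('n)) * (norm (velocity q \<mu> (X x)))\<^sup>2) * h) (t - s)"
  proof (rule mvt_simple)
    fix x assume "s \<le> x" "x \<le> t"
    then have "((\<lambda>t. particle_energy q \<mu> (X t)) has_real_derivative
     - ((1 / real CARD('n)) * (norm (velocity q \<mu> (X x)))\<^sup>2)) (at x within {0..T})"
      using X st by (intro energy_has_derivative) (auto simp: solves_def)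
    then show "((\<lambda>t. particle_energy q \<mu> (X t)) has_derivative
       (\<lambda>h. - ((1 / real CARD('n)) * (norm (velocity q \<mu> (X x)))\<^sup>2) * h)) (at x within {s..t})"
      unfolding has_field_derivative_def by (rule has_derivative_subset) (use st in auto)
  qed (use False st in simp)
  then obtain x where x: "x \<in> {s<..<t}" "particle_energy q \<mu> (X t) - particle_energy q \<mu> (X s) =
      - ((1 / real CARD('n)) * (norm (velocity q \<mu> (X x)))\<^sup>2) * (t - s)"
    by blast
  have x': "x \<in> {s..t}" using x(1) by auto
  have "(c / real CARD('n)) * (t - s) \<le> (1 / real CARD('n)) * (norm (velocity q \<mu> (X x)))\<^sup>2 * (t - s)"
    using c[OF x'] st by (intro mult_right_mono) (auto intro: divide_right_mono)
  then show ?thesis using x(2) unfolding mult_minus_left by linarith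
qed simp

lemma energy_nonincreasing:
  fixes X :: "real \<Rightarrow> 'a ^ 'n::finite"
  assumes X: "solves T X0 X" and st: "0 \<le> s" "s \<le> t" "t \<le> T"
  shows "particle_energy q \<mu> (X t) \<le> particle_energy q \<mu> (X s)"
  using energy_decay[OF X st, of 0] by simp

definition separated :: "real \<Rightarrow> real \<Rightarrow> ('a ^ 'n::finite) set" where
  "separated R \<epsilon> = {X. norm X \<le> R \<and> (\<forall>i j. i \<noteq> j \<longrightarrow> \<epsilon> \<le> norm (X $ i - X $ j))}"

lemma separated_subset_distinct_configs: "0 < \<epsilon> \<Longrightarrow> separated R \<epsilon> \<subseteq> distinct_configs"
  by (force simp: separated_def distinct_configs_def)

lemma compact_separated: "compact (separated R \<epsilon> :: ('a ^ 'n::finite) set)"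
proof -
  have "closed {X :: 'a ^ 'n. \<forall>i j. i \<noteq> j \<longrightarrow> \<epsilon> \<le> norm (X $ i - X $ j)}"
    by (intro closed_Collect_all closed_Collect_imp open_Collect_const closed_Collect_le continuous_intros)
  moreover have "separated R \<epsilon> = cball 0 R \<inter> {X :: 'a ^ 'n. \<forall>i j. i \<noteq> j \<longrightarrow> \<epsilon> \<le> norm (X $ i - X $ j)}"
    by (auto simp: separated_def)
  ultimately show ?thesis by (simp add: compact_Int_closed)
qed

text \<open>
  The constants depend on the initial configuration only. The same compact set can therefore be used before any
  solution is known to exist.
\<close>
lemma solutions_stay_separated:
  fixes X0 :: "'a ^ 'n::finite"
  assumes X0: "X0 \<in> distinct_configs" and N: "2 \<le> CARD('n)"
  obtains R \<epsilon> where "0 < \<epsilon>" "\<And>T X t. solves T X0 X \<Longrightarrow> t \<in> {0..T} \<Longrightarrow> X t \<in> separated R \<epsilon>"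
proof -
  obtain \<epsilon> where "0 < \<epsilon>" and
    \<epsilon>: "\<forall>T X. solves T X0 X \<longrightarrow> (\<forall>t\<in>{0..T}. \<forall>i j. i \<noteq> j \<longrightarrow> \<epsilon> \<le> norm (X t $ i - X t $ j))"
    using uniform_separation[OF X0 N] by (elim exE conjE) (rule that)
  obtain R where R: "\<forall>X :: 'a ^ 'n. particle_energy q \<mu> X \<le> particle_energy q \<mu> X0 \<longrightarrow> norm X \<le> R"
    by (rule exE[OF particle_energy_coercive[of "particle_energy q \<mu> X0"]]) (rule that)
  show ?thesis
  proof (rule that[OF \<open>0 < \<epsilon>\<close>])
    fix T X t assume X: "solves T X0 X" and t: "t \<in> {0..T}"
    have "X 0 = X0" using X by (simp add: solves_def)
    moreover have "particle_energy q \<mu> (X t) \<le> particle_energy q \<mu> (X 0)"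
      by (rule energy_nonincreasing[OF X]) (use t in auto)
    ultimately have "norm (X t) \<le> R" using R by simp
    moreover have "\<forall>i j. i \<noteq> j \<longrightarrow> \<epsilon> \<le> norm (X t $ i - X t $ j)" 
      using \<epsilon>[rule_format, OF X t] by simp
    ultimately show "X t \<in> separated R \<epsilon>" by (simp add: separated_def)
  qed
qed

end

section \<open>Existence, uniqueness and continuation of solutions\<close>

text \<open>
  The integral equation holds before time \<open>T\<close> and both sides are continuous up to \<open>T\<close>; differentiating it gives the
  equation at \<open>T\<close> itself.
\<close>
lemma has_vector_derivative_limit_endpoint:
  fixes X :: "real \<Rightarrow> 'b::euclidean_space"
  assumes T: "0 < T"
    and X: "\<And>t. t \<in> {0..<T} \<Longrightarrow> (X has_vector_derivative V (X t)) (at t within {0..<T})"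
    and cX: "continuous_on {0..T} X" and cV: "continuous_on {0..T} (\<lambda>t. V (X t))"
    and t: "t \<in> {0..T}"
  shows "(X has_vector_derivative V (X t)) (at t within {0..T})"
proof -
  let ?Y = "\<lambda>t. X 0 + integral {0..t} (\<lambda>s. V (X s))"
  have Y: "(?Y has_vector_derivative V (X t)) (at t within {0..T})" if "t \<in> {0..T}" for t
    using has_vector_derivative_add[OF has_vector_derivative_const integral_has_vector_derivative[OF cV that], of "X 0"]
    by simp
  have eq: "X t = ?Y t" if t: "t \<in> {0..<T}" for t
  proof -
    have "((\<lambda>s. V (X s)) has_integral X t - X 0) {0..t}"
      by (rule fundamental_theorem_of_calculus)
         (use t in \<open>auto intro!: has_vector_derivative_within_subset[OF X]\<close>)
    then show ?thesis by (simp add: integral_unique)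
  qed
  have "X T = ?Y T"
  proof -
    have "continuous_on {0..T} ?Y"
      by (rule continuous_on_vector_derivative) (rule Y)
    then have "continuous_on {0..T} (\<lambda>t. X t - ?Y t)" by (intro continuous_on_diff cX)
    then have c: "continuous_on (closure {0..<T}) (\<lambda>t. X t - ?Y t)" using T by simp
    have "X t - ?Y t = 0" if "t \<in> {0..<T}" for t
      unfolding right_minus_eq by (rule eq[OF that])
    moreover have "T \<in> closure {0..<T}" using closure_atLeastLessThan[OF T] T by simp
    ultimately have "X T - ?Y T = 0"
      by (rule continuous_constant_on_closure[OF c])
    then show ?thesis by (simp only: right_minus_eq)
  qed
  have all: "X t = ?Y t" if "t \<in> {0..T}" for t
  proof (cases "t = T")
    case True
    show ?thesis unfolding True by (rule \<open>X T = ?Y T\<close>)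
  next
    case False
    then show ?thesis using that by (intro eq) auto
  qed
  show ?thesis
    by (rule has_vector_derivative_transform[OF t all Y[OF t]])
qed

context target_measure
begin

lemma particle_solution_iff:
  "particle_solution q \<mu> X0 I X \<longleftrightarrow> X 0 = X0 \<and> (\<forall>t\<in>I. X t \<in> distinct_configs \<and>
     (X has_vector_derivative velocity q \<mu> (X t)) (at t within I))"
proof -
  have "C1_on I X" if X: "\<And>t. t \<in> I \<Longrightarrow> X t \<in> distinct_configs"
    "\<And>t. t \<in> I \<Longrightarrow> (X has_vector_derivative velocity q \<mu> (X t)) (at t within I)"
  proof -
    have "continuous_on I X" using X(2) by (rule continuous_on_vector_derivative)
    then have "continuous_on I (\<lambda>t. velocity q \<mu> (X t))"
      by (rule continuous_on_compose2[OF continuous_on_velocity]) (use X(1) in auto)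
    then show ?thesis
      unfolding C1_on_def by (intro exI[of _ "\<lambda>t. velocity q \<mu> (X t)"] conjI ballI X(2))
  qed
  then show ?thesis unfolding particle_solution_def by auto
qed

lemma particle_solution_solves:
  assumes "particle_solution q \<mu> X0 I X" "{0..T} \<subseteq> I"
  shows "solves T X0 X"
  unfolding solves_def
proof (intro conjI ballI)
  show "X 0 = X0" using assms(1) by (simp add: particle_solution_iff)
  fix t assume "t \<in> {0..T}"
  then have "t \<in> I" using assms(2) by auto
  then have X: "X t \<in> distinct_configs" "(X has_vector_derivative velocity q \<mu> (X t)) (at t within I)"
    using assms(1) by (simp_all add: particle_solution_iff)
  show "X t \<in> distinct_configs" by (rule X(1))
  show "(X has_vector_derivative velocity q \<mu> (X t)) (at t within {0..T})"
    by (rule has_vector_derivative_within_subset[OF X(2) assms(2)])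
qed

text \<open>
  The slightly relaxed constants make the smaller set lie in the interior of the larger one.
\<close>
lemma separated_near:
  fixes X Y :: "'a ^ 'n::finite"
  assumes X: "X \<in> separated R \<epsilon>" and Y: "norm (Y - X) \<le> 1" "norm (Y - X) \<le> \<epsilon> / 4"
  shows "Y \<in> separated (R + 1) (\<epsilon> / 2)"
proof -
  have "norm Y \<le> R + 1"
    using norm_triangle_sub[of Y X] X Y by (simp add: separated_def)
  moreover have "\<epsilon> / 2 \<le> norm (Y $ i - Y $ j)" if "i \<noteq> j" for i j
  proof -
    have "norm (Y $ k - X $ k) \<le> \<epsilon> / 4" for k
      using Finite_Cartesian_Product.norm_nth_le[of "Y - X" k] Y by simp
    from this[of i] this[of j] have "norm ((X $ i - Y $ i) - (X $ j - Y $ j)) \<le> \<epsilon> / 2"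
      using norm_triangle_ineq4[of "X $ i - Y $ i" "X $ j - Y $ j"] by (simp add: norm_minus_commute)
    moreover have "norm (X $ i - X $ j) \<le> norm (Y $ i - Y $ j) + norm ((X $ i - Y $ i) - (X $ j - Y $ j))"
      using norm_triangle_ineq[of "Y $ i - Y $ j" "(X $ i - Y $ i) - (X $ j - Y $ j)"] by simp
    moreover have "\<epsilon> \<le> norm (X $ i - X $ j)" using X that by (simp add: separated_def)
    ultimately show ?thesis by linarith
  qed
  ultimately show ?thesis by (simp add: separated_def)
qed

lemma solves_0:
  assumes "X0 \<in> distinct_configs"
  shows "solves 0 X0 (\<lambda>_. X0)"
  using assms by (simp add: solves_def has_vector_derivative_def has_derivative_within_singleton_iff bounded_linear_scaleR_left)

lemma velocity_bounded_on_separated: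
  assumes "0 < \<epsilon>"
  obtains B where "0 \<le> B" "\<And>X :: 'a ^ 'n::finite. X \<in> separated R \<epsilon> \<Longrightarrow> norm (velocity q \<mu> X) \<le> B"
proof -
  have "compact (velocity q \<mu> ` (separated R \<epsilon> :: ('a ^ 'n) set))"
    by (rule compact_continuous_image[OF continuous_on_subset[OF continuous_on_velocity separated_subset_distinct_configs[OF assms]] compact_separated])
  then have "bounded (velocity q \<mu> ` (separated R \<epsilon> :: ('a ^ 'n) set))" by (rule compact_imp_bounded)
  then obtain B where "\<And>X :: 'a ^ 'n. X \<in> separated R \<epsilon> \<Longrightarrow> norm (velocity q \<mu> X) \<le> B"
    by (auto simp: bounded_iff)
  then have "norm (velocity q \<mu> X) \<le> \<bar>B\<bar>" if "X \<in> separated R \<epsilon>" for X :: "'a ^ 'n"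
    using that abs_ge_self order_trans by blast
  then show ?thesis using that[of "\<bar>B\<bar>"] by simp
qed

lemma solution_lipschitz:
  fixes X :: "real \<Rightarrow> 'a ^ 'n::finite"
  assumes X: "solves T X0 X" and B: "\<And>t. t \<in> {0..T} \<Longrightarrow> norm (velocity q \<mu> (X t)) \<le> B"
    and st: "s \<in> {0..T}" "t \<in> {0..T}"
  shows "norm (X s - X t) \<le> B * norm (s - t)"
proof (rule differentiable_bound[where f' = "\<lambda>t h. h *\<^sub>R velocity q \<mu> (X t)"])
  show "convex {0..T}" by simp
  fix r assume r: "r \<in> {0..T}"
  show "(X has_derivative (\<lambda>h. h *\<^sub>R velocity q \<mu> (X r))) (at r within {0..T})"
    using X r by (simp add: solves_def has_vector_derivative_def)
  show "onorm (\<lambda>h. h *\<^sub>R velocity q \<mu> (X r)) \<le> B"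
    using B[OF r] onorm_scaleR_left[of "\<lambda>h. h" "velocity q \<mu> (X r)"] by (simp add: bounded_linear_ident onorm_id)
qed (use st in auto)

text \<open>
  As long as the curve \<open>Z\<close> of the extended field has not left the larger set \<open>S\<close> it solves the particle system, so it
  lies in the smaller set by the a priori bound. At the first exit time \<open>\<tau>\<close> it would thus still be in the interior
  of \<open>S\<close>.
\<close>
lemma global_existence:
  fixes X0 :: "'a ^ 'n::finite"
  assumes X0: "X0 \<in> distinct_configs" and N: "2 \<le> CARD('n)"
  shows "\<exists>X. particle_solution q \<mu> X0 {0..} X"
proof -
  obtain R \<epsilon> where \<epsilon>: "0 < \<epsilon>" and sep: "\<And>T X t. solves T X0 X \<Longrightarrow> t \<in> {0..T} \<Longrightarrow> X t \<in> separated R \<epsilon>"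
    using solutions_stay_separated[OF X0 N] by metis
  define S where "S = (separated (R + 1) (\<epsilon> / 2) :: ('a ^ 'n) set)"
  have SD: "S \<subseteq> distinct_configs" unfolding S_def using \<epsilon> by (intro separated_subset_distinct_configs) simp
  have closedS: "closed S" unfolding S_def by (rule compact_imp_closed[OF compact_separated])
  have "0 < \<epsilon> / 2" using \<epsilon> by simp
  then obtain B where B: "0 \<le> B" "\<And>X. X \<in> S \<Longrightarrow> norm (velocity q \<mu> X) \<le> B"
    unfolding S_def by (rule velocity_bounded_on_separated[where R = "R + 1" and 'n = 'n]) blast
  obtain F :: "'a ^ 'n \<Rightarrow> 'a ^ 'n" where F: "continuous_on UNIV F" "F ` UNIV \<subseteq> cball 0 B" "\<And>X. X \<in> S \<Longrightarrow> F X = velocity q \<mu> X"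
  proof (rule Dugundji[of "cball (0 :: 'a ^ 'n) B" UNIV S "velocity q \<mu>"])
    show "closedin (top_of_set UNIV) S" using closedS by simp
    show "continuous_on S (velocity q \<mu>)" by (rule continuous_on_subset[OF continuous_on_velocity SD])
    show "velocity q \<mu> ` S \<subseteq> cball 0 B" using B(2) by auto
  qed (use B(1) that in auto)
  obtain Z where Z: "Z 0 = X0" "\<And>t. t \<in> {0..} \<Longrightarrow> (Z has_vector_derivative F (Z t)) (at t within {0..})"
    using peano_global[OF F(1), of B X0] F(2) by (auto simp: image_subset_iff)
  have "continuous_on {0..} Z"
    by (rule continuous_on_vector_derivative) (rule Z(2))
  then have contZ: "\<exists>d>0. \<forall>s\<in>{0..}. dist s t < d \<longrightarrow> dist (Z s) (Z t) < e" if "0 \<le> t" "0 < e" for t e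
    using that unfolding continuous_on_iff by simp
  have in_S: "Z t \<in> S" if "0 \<le> t" for t
  proof (rule ccontr)
    assume "Z t \<notin> S"
    define A where "A = {t. 0 \<le> t \<and> Z t \<notin> S}"
    define \<tau> where "\<tau> = Inf A"
    have A: "A \<noteq> {}" "bdd_below A" using \<open>Z t \<notin> S\<close> that by (auto simp: A_def intro!: bdd_belowI[of _ 0])
    have \<tau>0: "0 \<le> \<tau>" unfolding \<tau>_def by (rule cInf_greatest) (use A in \<open>auto simp: A_def\<close>)
    have before: "Z s \<in> S" if "0 \<le> s" "s < \<tau>" for s
      using cInf_lower[OF _ A(2), of s] that by (force simp: A_def \<tau>_def)
    have "Z \<tau> \<in> S"
    proof (rule ccontr)
      assume out: "Z \<tau> \<notin> S"
      have "X0 \<in> separated R \<epsilon>" using sep[OF solves_0[OF X0], of 0] by simp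
      then have "X0 \<in> S" unfolding S_def by (rule separated_near) (use \<epsilon> in auto)
      then have "\<tau> \<noteq> 0" using out Z(1) by auto
      obtain e where e: "0 < e" "ball (Z \<tau>) e \<subseteq> - S"
        using out closedS open_contains_ball[of "- S"] by auto
      obtain d where d: "0 < d" "\<And>s. 0 \<le> s \<Longrightarrow> dist s \<tau> < d \<Longrightarrow> dist (Z s) (Z \<tau>) < e"
        using contZ[OF \<tau>0 e(1)] by auto
      define s where "s = max 0 (\<tau> - d / 2)"
      have s: "0 \<le> s" "s < \<tau>" "dist s \<tau> < d"
        using \<tau>0 \<open>\<tau> \<noteq> 0\<close> d(1) by (auto simp: s_def dist_real_def)
      then have "Z s \<in> ball (Z \<tau>) e" using d(2)[of s] by (simp add: dist_commute)
      then show False using e(2) before[OF s(1,2)] by auto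
    qed
    then have upto: "Z s \<in> S" if "s \<in> {0..\<tau>}" for s
      using before[of s] that by (cases "s = \<tau>") auto
    have "solves \<tau> X0 Z"
      unfolding solves_def
    proof (intro conjI ballI Z(1))
      fix s assume s: "s \<in> {0..\<tau>}"
      show "Z s \<in> distinct_configs" using upto[OF s] SD by auto
      have "(Z has_vector_derivative F (Z s)) (at s within {0..\<tau>})"
        by (rule has_vector_derivative_within_subset[OF Z(2)]) (use s in auto)
      then show "(Z has_vector_derivative velocity q \<mu> (Z s)) (at s within {0..\<tau>})"
        using F(3)[OF upto[OF s]] by simp
    qed
    then have sep\<tau>: "Z \<tau> \<in> separated R \<epsilon>" using sep[of \<tau> Z \<tau>] \<tau>0 by simp
    obtain d where d: "0 < d" "\<And>s. 0 \<le> s \<Longrightarrow> dist s \<tau> < d \<Longrightarrow> dist (Z s) (Z \<tau>) < min 1 (\<epsilon> / 4)"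
      using contZ[OF \<tau>0, of "min 1 (\<epsilon> / 4)"] \<epsilon> by auto
    have after: "Z s \<in> S" if "0 \<le> s" "dist s \<tau> < d" for s
      unfolding S_def by (rule separated_near[OF sep\<tau>]) (use d(2)[OF that] in \<open>auto simp: dist_norm\<close>)
    have "\<tau> + d \<le> Inf A"
    proof (rule cInf_greatest[OF A(1)])
      fix s assume s: "s \<in> A"
      then have "\<tau> \<le> s" unfolding \<tau>_def by (rule cInf_lower[OF _ A(2)])
      then show "\<tau> + d \<le> s" using after[of s] s by (force simp: A_def dist_real_def)
    qed
    then show False using d(1) by (simp add: \<tau>_def)
  qed
  have "particle_solution q \<mu> X0 {0..} Z"
    unfolding particle_solution_iff using Z in_S SD F(3) by (auto simp: subset_iff)
  then show ?thesis by blast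
qed

text \<open>
  On separated configurations the pair interaction is Lipschitz, so only the field of the target requires a hypothesis.
\<close>
lemma velocity_one_sided_lipschitz:
  fixes X Y :: "'a ^ 'n::finite"
  assumes K: "\<And>x y. inner (drift x - drift y) (x - y) \<le> K * (norm (x - y))\<^sup>2"
    and \<epsilon>: "0 < \<epsilon>" and XY: "X \<in> separated R \<epsilon>" "Y \<in> separated R \<epsilon>"
  shows "inner (X - Y) (velocity q \<mu> X - velocity q \<mu> Y) \<le>
    (K + 2 * real CARD('n) * (3 * q * \<epsilon> powr (q - 2))) * (norm (X - Y))\<^sup>2"
proof -
  let ?N = "real CARD('n)" and ?L = "3 * q * \<epsilon> powr (q - 2)" and ?D = "norm (X - Y)"
  have L0: "0 \<le> ?L" using q by simp
  have D: "norm (X $ i - Y $ i) \<le> ?D" for i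
    using Finite_Cartesian_Product.norm_nth_le[of "X - Y" i] by simp
  define w where "w i = (\<Sum>j\<in>UNIV. grad_kernel q (Y $ i - Y $ j) - grad_kernel q (X $ i - X $ j))" for i
  have v: "velocity q \<mu> X $ i - velocity q \<mu> Y $ i = (1 / ?N) *\<^sub>R w i + (drift (X $ i) - drift (Y $ i))" for i
    by (simp add: velocity_nth w_def sum_subtractf scaleR_diff_right)
  have w: "norm (w i) \<le> ?N * (2 * ?L * ?D)" for i
  proof -
    have "norm (w i) \<le> (\<Sum>j\<in>(UNIV::'n set). 2 * ?L * ?D)"
      unfolding w_def
    proof (rule order_trans[OF norm_sum sum_mono])
      fix j
      show "norm (grad_kernel q (Y $ i - Y $ j) - grad_kernel q (X $ i - X $ j)) \<le> 2 * ?L * ?D"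
      proof (cases "i = j")
        case False
        then have a: "norm (grad_kernel q (Y $ i - Y $ j) - grad_kernel q (X $ i - X $ j)) \<le> ?L * norm ((Y $ i - Y $ j) - (X $ i - X $ j))"
          using XY by (intro grad_kernel_lipschitz_away q \<epsilon>) (auto simp: separated_def)
        have b: "norm ((Y $ i - Y $ j) - (X $ i - X $ j)) \<le> 2 * ?D"
          using norm_triangle_ineq4[of "X $ j - Y $ j" "X $ i - Y $ i"] D[of i] D[of j]
          by (simp add: algebra_simps)
        have "?L * (2 * ?D) = 2 * ?L * ?D" by simp
        then show ?thesis using a mult_left_mono[OF b L0] by linarith
      qed (use L0 in simp)
    qed
    then show ?thesis by simp
  qed
  have "inner (X - Y) (velocity q \<mu> X - velocity q \<mu> Y) =
     (\<Sum>i\<in>UNIV. inner (X $ i - Y $ i) ((1 / ?N) *\<^sub>R w i) + inner (drift (X $ i) - drift (Y $ i)) (X $ i - Y $ i))"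
    unfolding inner_vec_def vector_minus_component v inner_add_right by (simp add: inner_commute)
  also have "\<dots> \<le> (\<Sum>i\<in>UNIV. 2 * ?L * ?D\<^sup>2 + K * (norm (X $ i - Y $ i))\<^sup>2)"
  proof (intro sum_mono add_mono K)
    fix i
    have "inner (X $ i - Y $ i) ((1 / ?N) *\<^sub>R w i) \<le> norm (X $ i - Y $ i) * norm ((1 / ?N) *\<^sub>R w i)"
      by (rule norm_cauchy_schwarz)
    also have "\<dots> \<le> ?D * (2 * ?L * ?D)"
      using w[of i] D[of i] by (intro mult_mono) (auto simp: divide_le_eq mult_ac)
    finally show "inner (X $ i - Y $ i) ((1 / ?N) *\<^sub>R w i) \<le> 2 * ?L * ?D\<^sup>2"
      by (simp add: power2_eq_square mult_ac)
  qed
  also have "\<dots> = ?N * (2 * ?L * ?D\<^sup>2) + K * (\<Sum>i\<in>UNIV. (norm (X $ i - Y $ i))\<^sup>2)"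
    by (simp add: sum.distrib sum_distrib_left)
  also have "(\<Sum>i\<in>UNIV. (norm (X $ i - Y $ i))\<^sup>2) = ?D\<^sup>2"
    unfolding power2_norm_eq_inner inner_vec_def by simp
  finally show ?thesis by (simp add: algebra_simps)
qed

text \<open>
  For \<open>1 \<le> q\<close> the field is monotone decreasing as an average of monotone decreasing fields.
\<close>
lemma drift_one_sided_lipschitz:
  assumes "\<beta> = 1 \<or> 1 \<le> q"
  shows "\<exists>K. \<forall>x y. inner (drift x - drift y) (x - y) \<le> K * (norm (x - y))\<^sup>2"
  using assms
proof
  assume "\<beta> = 1"
  have "inner (drift x - drift y) (x - y) \<le> (6 * q * M) * (norm (x - y))\<^sup>2" for x y
  proof -
    have "inner (drift x - drift y) (x - y) \<le> norm (drift x - drift y) * norm (x - y)"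
      by (rule norm_cauchy_schwarz)
    also have "\<dots> \<le> (6 * q * M * norm (x - y)) * norm (x - y)"
      using drift_holder[of x y] \<open>\<beta> = 1\<close> by (intro mult_right_mono) auto
    finally show ?thesis by (simp add: power2_eq_square mult_ac)
  qed
  then show ?thesis by blast
next
  assume "1 \<le> q"
  have "inner (drift x - drift y) (x - y) \<le> 0 * (norm (x - y))\<^sup>2" for x y
  proof -
    have "inner (drift x - drift y) (x - y) = (LINT z|\<mu>. inner (grad_kernel q (x - z) - grad_kernel q (y - z)) (x - y))"
      unfolding drift_def using integrable_grad_kernel by simp
    also have "\<dots> \<le> (LINT z|\<mu>. 0)"
    proof (rule integral_mono)
      fix z
      show "inner (grad_kernel q (x - z) - grad_kernel q (y - z)) (x - y) \<le> 0"
        using grad_kernel_antimono[OF \<open>1 \<le> q\<close>, of "x - z" "y - z"] by simp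
    qed (use integrable_grad_kernel in auto)
    finally show ?thesis by simp
  qed
  then show ?thesis by blast
qed

lemma solution_unique:
  fixes X0 :: "'a ^ 'n::finite"
  assumes X0: "X0 \<in> distinct_configs" and N: "2 \<le> CARD('n)" and reg: "\<beta> = 1 \<or> 1 \<le> q"
    and X: "particle_solution q \<mu> X0 {0..} X" and Y: "particle_solution q \<mu> X0 {0..} Y" and t: "0 \<le> t"
  shows "Y t = X t"
proof -
  obtain R \<epsilon> where \<epsilon>: "0 < \<epsilon>" and sep: "\<And>T X t. solves T X0 X \<Longrightarrow> t \<in> {0..T} \<Longrightarrow> X t \<in> separated R \<epsilon>"
    using solutions_stay_separated[OF X0 N] by metis
  obtain K where K: "\<And>x y. inner (drift x - drift y) (x - y) \<le> K * (norm (x - y))\<^sup>2"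
    using drift_one_sided_lipschitz[OF reg] by blast
  have sX: "solves t X0 X" and sY: "solves t X0 Y"
    using X Y by (auto intro!: particle_solution_solves)
  let ?L = "K + 2 * real CARD('n) * (3 * q * \<epsilon> powr (q - 2))"
  let ?u = "\<lambda>s. (norm (X s - Y s))\<^sup>2"
  let ?u' = "\<lambda>s. 2 * inner (X s - Y s) (velocity q \<mu> (X s) - velocity q \<mu> (Y s))"
  have "?u t = 0"
  proof (rule gronwall_zero[where u = ?u and u' = ?u' and L = "2 * ?L" and T = t])
    fix s assume s: "s \<in> {0..t}"
    have "((\<lambda>s. X s - Y s) has_vector_derivative velocity q \<mu> (X s) - velocity q \<mu> (Y s)) (at s within {0..t})"
      using sX sY s by (intro has_vector_derivative_diff) (auto simp: solves_def)
    then have d: "((\<lambda>s. X s - Y s) has_derivative (\<lambda>h. h *\<^sub>R (velocity q \<mu> (X s) - velocity q \<mu> (Y s)))) (at s within {0..t})"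
      by (simp only: has_vector_derivative_def)
    show "(?u has_real_derivative ?u' s) (at s within {0..t})"
      unfolding has_field_derivative_def power2_norm_eq_inner
      by (rule has_derivative_eq_rhs[OF has_derivative_inner[OF d d]]) (simp add: fun_eq_iff inner_commute)
    show "?u' s \<le> 2 * ?L * ?u s"
      using mult_left_mono[OF velocity_one_sided_lipschitz[OF K \<epsilon> sep[OF sX s] sep[OF sY s]], of 2]
      by (simp only: mult.assoc)
  qed (use sX sY t in \<open>auto simp: solves_def\<close>)
  then show ?thesis by simp
qed

text \<open>
  On a bounded lifespan the velocity is bounded, so the solution extends continuously to the endpoint; the limit is
  separated, and a global solution started there continues it.
\<close>
lemma maximal_solution_global:
  fixes X0 :: "'a ^ 'n::finite"
  assumes X0: "X0 \<in> distinct_configs" and N: "2 \<le> CARD('n)"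
    and max: "maximal_particle_solution q \<mu> X0 T X"
  shows "T = \<infinity>"
proof (rule ccontr)
  assume "T \<noteq> \<infinity>"
  then obtain r where T: "T = ereal r" "0 < r"
    using max by (cases T) (auto simp: maximal_particle_solution_def)
  have life: "lifespan T = {0..<r}" by (auto simp: lifespan_def T)
  have X: "particle_solution q \<mu> X0 {0..<r} X"
    using max by (simp add: maximal_particle_solution_def life)
  obtain R \<epsilon> where \<epsilon>: "0 < \<epsilon>" and sep: "\<And>T X t. solves T X0 X \<Longrightarrow> t \<in> {0..T} \<Longrightarrow> X t \<in> separated R \<epsilon>"
    using solutions_stay_separated[OF X0 N] by metis
  have sX: "solves s X0 X" if "s < r" for s
    by (rule particle_solution_solves[OF X]) (use that in auto)
  have Xsep: "X t \<in> separated R \<epsilon>" if "t \<in> {0..<r}" for t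
    using sep[OF sX[of t], of t] that by simp
  obtain B where B: "0 \<le> B" "\<And>X :: 'a ^ 'n. X \<in> separated R \<epsilon> \<Longrightarrow> norm (velocity q \<mu> X) \<le> B"
    using velocity_bounded_on_separated[OF \<epsilon>] by metis
  have "B-lipschitz_on {0..<r} X"
  proof (rule lipschitz_onI[OF _ B(1)])
    fix s t assume st: "s \<in> {0..<r}" "t \<in> {0..<r}"
    have "norm (X s - X t) \<le> B * norm (s - t)"
      by (rule solution_lipschitz[OF sX[of "max s t"]]) (use st B(2) Xsep in auto)
    then show "dist (X s) (X t) \<le> B * dist s t" by (simp add: dist_norm)
  qed
  then have "uniformly_continuous_on {0..<r} X" by (rule lipschitz_on_uniformly_continuous)
  then obtain g where g: "uniformly_continuous_on (closure {0..<r}) g" "\<And>t. t \<in> {0..<r} \<Longrightarrow> X t = g t"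
    by (rule uniformly_continuous_on_extension_on_closure) (rule that)
  have gc: "continuous_on {0..r} g" using uniformly_continuous_imp_continuous[OF g(1)] T by simp
  have gsep: "g t \<in> separated R \<epsilon>" if "t \<in> {0..r}" for t
  proof -
    have "continuous_on (closure {0..<r}) g" using gc T by simp
    moreover have "closed (separated R \<epsilon> :: ('a ^ 'n) set)" by (rule compact_imp_closed[OF compact_separated])
    moreover have "g ` {0..<r} \<subseteq> separated R \<epsilon>" using Xsep g(2) by auto
    ultimately have "g ` closure {0..<r} \<subseteq> separated R \<epsilon>" by (rule image_closure_subset)
    then show ?thesis using that T by auto
  qed
  have gD: "g t \<in> distinct_configs" if "t \<in> {0..r}" for t
    using gsep[OF that] separated_subset_distinct_configs[OF \<epsilon>] by auto
  have gder: "(g has_vector_derivative velocity q \<mu> (g t)) (at t within {0..r})" if t: "t \<in> {0..r}" for t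
  proof (rule has_vector_derivative_limit_endpoint[OF T(2) _ gc _ t])
    fix s assume s: "s \<in> {0..<r}"
    have "(X has_vector_derivative velocity q \<mu> (X s)) (at s within {0..<r})"
      using X s by (simp add: particle_solution_iff)
    then have "(g has_vector_derivative velocity q \<mu> (X s)) (at s within {0..<r})"
      by (rule has_vector_derivative_transform[OF s, rotated]) (use g(2) in auto)
    then show "(g has_vector_derivative velocity q \<mu> (g s)) (at s within {0..<r})"
      using g(2)[OF s] by simp
  next
    show "continuous_on {0..r} (\<lambda>t. velocity q \<mu> (g t))"
      by (rule continuous_on_compose2[OF continuous_on_velocity gc]) (use gD in auto)
  qed
  have g0: "g 0 = X0" using g(2)[of 0] X T by (simp add: particle_solution_iff)
  obtain Y where Y: "particle_solution q \<mu> (g r) {0..} Y"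
    using global_existence[OF gD[of r] N] T by auto
  define Z where "Z t = (if t \<le> r then g t else Y (t - r))" for t
  have UN: "{0..r} \<union> {r..} = {0..}" using T by auto
  have sh: "(\<lambda>t. t - r) ` {r..} = {0..}"
  proof
    show "{0..} \<subseteq> (\<lambda>t. t - r) ` {r..}"
    proof
      fix x :: real assume "x \<in> {0..}"
      then show "x \<in> (\<lambda>t. t - r) ` {r..}" by (intro image_eqI[of _ _ "x + r"]) auto
    qed
  qed auto
  have "(Z has_vector_derivative velocity q \<mu> (Z t)) (at t within {0..r} \<union> {r..})" if "t \<in> {0..r} \<union> {r..}" for t
  proof (rule has_vector_derivative_concat[where I = "{r..}" and X = g and Y = Y])
    fix s assume "s + r \<in> {r..}"
    then show "(Y has_vector_derivative velocity q \<mu> (Y s)) (at s within (\<lambda>t. t - r) ` {r..})"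
      unfolding sh using Y by (simp add: particle_solution_iff)
  next
    show "Y 0 = g r" using Y by (simp add: particle_solution_iff)
  qed (use T gder that Z_def in auto)
  then have "particle_solution q \<mu> X0 {0..} Z"
    unfolding particle_solution_iff UN using g0 T gD Y by (auto simp: Z_def particle_solution_iff)
  then have "particle_solution q \<mu> X0 (lifespan \<infinity>) Z" by (simp add: lifespan_infinity)
  moreover have "\<forall>t\<in>lifespan T. Z t = X t" using g(2) by (auto simp: life Z_def)
  moreover have "T < \<infinity>" by (simp add: T)
  ultimately show False using max unfolding maximal_particle_solution_def by blast
qed

end

section \<open>Long-time behaviour\<close>

lemma omega_limit_subsequence:
  fixes X :: "real \<Rightarrow> 'b::metric_space"
  assumes S: "compact S" "\<And>t. 0 \<le> t \<Longrightarrow> X t \<in> S" and \<sigma>: "\<And>n::nat. real n \<le> \<sigma> n"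
  obtains r Y where "strict_mono (r :: nat \<Rightarrow> nat)" "(\<lambda>n. X (\<sigma> (r n))) \<longlonglongrightarrow> Y" "Y \<in> omega_limit X"
proof -
  have "X (\<sigma> n) \<in> S" for n using \<sigma>[of n] by (intro S(2)) (meson of_nat_0_le_iff order_trans)
  then obtain Y r where r: "strict_mono (r :: nat \<Rightarrow> nat)" "((\<lambda>n. X (\<sigma> n)) \<circ> r) \<longlonglongrightarrow> Y"
    using S(1) unfolding compact_def by (metis (no_types, lifting))
  have "Y \<in> closure (X ` {T..})" if "0 \<le> T" for T
  proof -
    obtain m :: nat where m: "T \<le> real m" using real_arch_simple by blast
    have "\<forall>\<^sub>F n in sequentially. ((\<lambda>n. X (\<sigma> n)) \<circ> r) n \<in> closure (X ` {T..})"
      unfolding eventually_sequentially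
    proof (intro exI allI impI)
      fix n assume "m \<le> n"
      then have "real m \<le> real (r n)" using seq_suble[OF r(1), of n] by simp
      then have "T \<le> \<sigma> (r n)" using m \<sigma>[of "r n"] by linarith
      then show "((\<lambda>n. X (\<sigma> n)) \<circ> r) n \<in> closure (X ` {T..})"
        using closure_subset[of "X ` {T..}"] by auto
    qed
    then show ?thesis by (rule Lim_in_closed_set[OF closed_closure _ _ r(2)]) simp
  qed
  then have "Y \<in> omega_limit X" by (simp add: omega_limit_def)
  then show ?thesis using that[OF r(1)] r(2) by (simp add: o_def)
qed

lemma omega_limit_sequence:
  fixes X :: "real \<Rightarrow> 'b::metric_space"
  assumes "Y \<in> omega_limit X"
  obtains \<sigma> where "\<And>n::nat. real n \<le> \<sigma> n" "(\<lambda>n. X (\<sigma> n)) \<longlonglongrightarrow> Y"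
proof -
  have "\<exists>s. real n \<le> s \<and> dist (X s) Y < 1 / real (Suc n)" for n
  proof -
    have "Y \<in> closure (X ` {real n..})" using assms by (simp add: omega_limit_def)
    then have "\<exists>y\<in>X ` {real n..}. dist y Y < 1 / real (Suc n)"
      unfolding closure_approachable by (rule allE[where x = "1 / real (Suc n)"]) simp
    then show ?thesis by auto
  qed
  then obtain \<sigma> where \<sigma>: "\<And>n. real n \<le> \<sigma> n" "\<And>n. dist (X (\<sigma> n)) Y < 1 / real (Suc n)" by metis
  have "(\<lambda>n. dist (X (\<sigma> n)) Y) \<longlonglongrightarrow> 0"
  proof (rule Lim_null_comparison)
    show "\<forall>\<^sub>F n in sequentially. norm (dist (X (\<sigma> n)) Y) \<le> 1 / real (Suc n)"
      using \<sigma>(2) by (intro always_eventually) (auto intro: less_imp_le)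
    show "(\<lambda>n. 1 / real (Suc n)) \<longlonglongrightarrow> 0" by (rule LIMSEQ_Suc[OF lim_1_over_n])
  qed
  then have "(\<lambda>n. X (\<sigma> n)) \<longlonglongrightarrow> Y" by (rule iffD2[OF tendsto_dist_iff])
  with \<sigma>(1) show ?thesis by (rule that)
qed

lemma omega_limit_subset:
  assumes "compact S" "\<And>t. 0 \<le> t \<Longrightarrow> X t \<in> (S :: 'b::metric_space set)"
  shows "omega_limit X \<subseteq> S"
proof -
  have "omega_limit X \<subseteq> closure (X ` {0..})" unfolding omega_limit_def by blast
  also have "\<dots> \<subseteq> S"
    using assms by (intro closure_minimal compact_imp_closed) auto
  finally show ?thesis .
qed

lemma compact_omega_limit:
  assumes "compact S" "\<And>t. 0 \<le> t \<Longrightarrow> X t \<in> (S :: 'b::metric_space set)"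
  shows "compact (omega_limit X)"
proof -
  have "closed (omega_limit X)" unfolding omega_limit_def by (intro closed_INT) simp
  then have "compact (S \<inter> omega_limit X)" by (rule compact_Int_closed[OF assms(1)])
  moreover have "omega_limit X \<subseteq> S" by (rule omega_limit_subset[OF assms])
  ultimately show ?thesis by (simp add: Int_absorb1)
qed

text \<open>
  A decreasing intersection of compact connected sets. Replacing \<open>T\<close> by \<open>max 0 T\<close> indexes them by all reals.
\<close>
lemma connected_omega_limit:
  fixes X :: "real \<Rightarrow> 'b::euclidean_space"
  assumes S: "compact S" "\<And>t. 0 \<le> t \<Longrightarrow> X t \<in> S" and cont: "continuous_on {0..} X"
  shows "connected (omega_limit X)"
proof -
  let ?A = "\<lambda>T. closure (X ` {max 0 T..})"
  have sub: "?A T \<subseteq> S" for T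
    using S by (intro closure_minimal compact_imp_closed) auto
  have "connected (\<Inter> (range ?A))"
  proof (rule connected_nest)
    show "compact (?A T)" for T
      using compact_Int_closed[OF S(1) closed_closure[of "X ` {max 0 T..}"]] sub[of T] by (simp add: Int_absorb1)
    show "connected (?A T)" for T
      by (intro connected_imp_connected_closure connected_continuous_image continuous_on_subset[OF cont]) auto
    show "?A T \<subseteq> ?A S" if "S \<le> T" for S T
      using that by (intro closure_mono image_mono) auto
  qed
  moreover have "\<Inter> (range ?A) = omega_limit X"
  proof
    show "\<Inter> (range ?A) \<subseteq> omega_limit X"
      unfolding omega_limit_def
    proof (rule INT_greatest)
      fix T :: real assume "T \<in> {0..}"
      then have "?A T = closure (X ` {T..})" by (simp add: max_absorb2)
      then show "\<Inter> (range ?A) \<subseteq> closure (X ` {T..})" by blast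
    qed
    show "omega_limit X \<subseteq> \<Inter> (range ?A)"
      unfolding omega_limit_def by (rule INT_greatest) (rule INT_lower, simp)
  qed
  ultimately show ?thesis by simp
qed

lemma antimono_bounded_below_tendsto:
  fixes e :: "real \<Rightarrow> real"
  assumes anti: "\<And>s t. 0 \<le> s \<Longrightarrow> s \<le> t \<Longrightarrow> e t \<le> e s" and low: "\<And>t. 0 \<le> t \<Longrightarrow> m \<le> e t"
  obtains L where "(e \<longlongrightarrow> L) at_top" "\<And>t. 0 \<le> t \<Longrightarrow> L \<le> e t"
proof -
  define L where "L = Inf (e ` {0..})"
  have bdd: "bdd_below (e ` {0..})" using low by (intro bdd_belowI2[of _ m]) auto
  have le: "L \<le> e t" if "0 \<le> t" for t
    unfolding L_def by (rule cInf_lower[OF _ bdd]) (use that in auto)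
  have "(e \<longlongrightarrow> L) at_top"
  proof (rule order_tendstoI)
    fix a assume "a < L"
    then show "\<forall>\<^sub>F t in at_top. a < e t"
      unfolding eventually_at_top_linorder using le less_le_trans by (intro exI[of _ 0]) blast
  next
    fix a assume "L < a"
    then obtain s where s: "0 \<le> s" "e s < a"
      using cInf_less_iff[OF _ bdd, of a] unfolding L_def by auto
    then show "\<forall>\<^sub>F t in at_top. e t < a"
      unfolding eventually_at_top_linorder using anti le_less_trans by (intro exI[of _ s]) blast
  qed
  then show ?thesis using le that by blast
qed

lemma infdist_omega_limit_tendsto_0:
  fixes X :: "real \<Rightarrow> 'b::metric_space"
  assumes S: "compact S" "\<And>t. 0 \<le> t \<Longrightarrow> X t \<in> S" and C: "omega_limit X \<subseteq> C"
  shows "((\<lambda>t. infdist (X t) C) \<longlongrightarrow> 0) at_top"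
proof (rule ccontr)
  assume "\<not> ((\<lambda>t. infdist (X t) C) \<longlongrightarrow> 0) at_top"
  then obtain e where e: "0 < e" "\<not> (\<forall>\<^sub>F t in at_top. dist (infdist (X t) C) 0 < e)"
    unfolding tendsto_iff by blast
  have "\<exists>s\<ge>real n. e \<le> infdist (X s) C" for n
    using e(2) unfolding eventually_at_top_linorder not_ex not_all
    by (metis abs_of_nonneg dist_0_norm dist_commute infdist_nonneg not_le real_norm_def)
  then obtain \<sigma> where \<sigma>: "\<And>n::nat. real n \<le> \<sigma> n" "\<And>n. e \<le> infdist (X (\<sigma> n)) C" by metis
  obtain r Y where r: "(\<lambda>n. X (\<sigma> (r n))) \<longlonglongrightarrow> Y" "Y \<in> omega_limit X"
    using omega_limit_subsequence[where X = X and S = S and \<sigma> = \<sigma>] S \<sigma>(1) by metis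
  have "(\<lambda>n. dist (X (\<sigma> (r n))) Y) \<longlonglongrightarrow> 0" using r(1) by (rule iffD1[OF tendsto_dist_iff])
  moreover have "e \<le> dist (X (\<sigma> (r n))) Y" for n
    using \<sigma>(2)[of "r n"] infdist_le[of Y C "X (\<sigma> (r n))"] r(2) C by force
  ultimately have "e \<le> 0" by (intro LIMSEQ_le_const) auto
  then show False using e(1) by simp
qed

context target_measure
begin

text \<open>
  If the velocity at \<open>Y\<close> did not vanish, then at each of infinitely many times the trajectory would be within \<open>\<rho> / 2\<close> of
  \<open>Y\<close> and, having bounded speed, remain within \<open>\<rho>\<close> for a time \<open>h\<close>. The energy would drop by the fixed amount \<open>v\<^sup>2 h / N\<close>
  each time, below its limit. Only the compactness of the trajectory enters, not uniqueness of solutions.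
\<close>
lemma omega_limit_velocity_zero:
  fixes X :: "real \<Rightarrow> 'a ^ 'n::finite"
  assumes X: "\<And>T. solves T X0 X" and \<epsilon>: "0 < \<epsilon>" and sep: "\<And>t. 0 \<le> t \<Longrightarrow> X t \<in> separated R \<epsilon>"
    and E: "((\<lambda>t. particle_energy q \<mu> (X t)) \<longlongrightarrow> L) at_top" "\<And>t. 0 \<le> t \<Longrightarrow> L \<le> particle_energy q \<mu> (X t)"
    and Y: "Y \<in> omega_limit X"
  shows "velocity q \<mu> Y = 0"
proof (rule ccontr)
  let ?S = "separated R \<epsilon> :: ('a ^ 'n) set" and ?N = "real CARD('n)"
  assume "velocity q \<mu> Y \<noteq> 0"
  define v where "v = norm (velocity q \<mu> Y) / 2"
  have v: "0 < v" using \<open>velocity q \<mu> Y \<noteq> 0\<close> by (simp add: v_def)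
  have YS: "Y \<in> ?S" by (rule subsetD[OF omega_limit_subset[OF compact_separated sep] Y])
  have "continuous_on ?S (\<lambda>Z. norm (velocity q \<mu> Z))"
    by (intro continuous_on_norm continuous_on_subset[OF continuous_on_velocity] separated_subset_distinct_configs \<epsilon>)
  then obtain \<rho> where \<rho>: "0 < \<rho>" "\<And>Z. Z \<in> ?S \<Longrightarrow> dist Z Y < \<rho> \<Longrightarrow> dist (norm (velocity q \<mu> Z)) (norm (velocity q \<mu> Y)) < v"
    using YS v unfolding continuous_on_iff by metis
  have fast: "v\<^sup>2 \<le> (norm (velocity q \<mu> Z))\<^sup>2" if "Z \<in> ?S" "dist Z Y < \<rho>" for Z
  proof (rule power_mono)
    show "v \<le> norm (velocity q \<mu> Z)"
      using \<rho>(2)[OF that] unfolding v_def dist_real_def by linarith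
  qed (use v in simp)
  obtain B where B: "0 \<le> B" "\<And>Z. Z \<in> ?S \<Longrightarrow> norm (velocity q \<mu> Z) \<le> B"
    using velocity_bounded_on_separated[OF \<epsilon>, where 'n = 'n and R = R] by blast
  \<comment> \<open>With speed at most \<open>B\<close>, a time \<open>h\<close> moves the trajectory by less than \<open>\<rho> / 2\<close>.\<close>
  define h where "h = \<rho> / (2 * (B + 1))"
  have h: "0 < h" "B * h < \<rho> / 2" using \<rho>(1) B(1) by (auto simp: h_def field_simps)
  obtain \<sigma> where \<sigma>: "\<And>n::nat. real n \<le> \<sigma> n" "(\<lambda>n. X (\<sigma> n)) \<longlonglongrightarrow> Y"
    using omega_limit_sequence[OF Y] by blast
  have \<sigma>0: "0 \<le> \<sigma> n" for n using \<sigma>(1)[of n] by (meson of_nat_0_le_iff order_trans)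
  have "\<forall>\<^sub>F n in sequentially. dist (X (\<sigma> n)) Y < \<rho> / 2"
    using \<sigma>(2) \<rho>(1) by (auto dest!: tendstoD[of _ _ _ "\<rho> / 2"])
  then have drop: "\<forall>\<^sub>F n in sequentially. L + (v\<^sup>2 / ?N) * h \<le> particle_energy q \<mu> (X (\<sigma> n))"
  proof eventually_elim
    case (elim n)
    have "particle_energy q \<mu> (X (\<sigma> n + h)) \<le> particle_energy q \<mu> (X (\<sigma> n)) - (v\<^sup>2 / ?N) * (\<sigma> n + h - \<sigma> n)"
    proof (rule energy_decay[OF X[of "\<sigma> n + h"]])
      fix x assume x: "x \<in> {\<sigma> n..\<sigma> n + h}"
      have "norm (X x - X (\<sigma> n)) \<le> B * norm (x - \<sigma> n)"
        by (rule solution_lipschitz[OF X[of "\<sigma> n + h"]]) (use x \<sigma>0[of n] h(1) B(2) sep in auto)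
      also have "\<dots> \<le> B * h" using x B(1) by (intro mult_left_mono) auto
      finally have "dist (X x) Y < \<rho>"
        using h(2) elim dist_triangle[of "X x" Y "X (\<sigma> n)"] by (simp add: dist_norm)
      moreover have "X x \<in> ?S" using x \<sigma>0[of n] by (intro sep) auto
      ultimately show "v\<^sup>2 \<le> (norm (velocity q \<mu> (X x)))\<^sup>2" by (intro fast)
    qed (use \<sigma>0[of n] h(1) in auto)
    moreover have "L \<le> particle_energy q \<mu> (X (\<sigma> n + h))" using \<sigma>0[of n] h(1) by (intro E(2)) simp
    ultimately show ?case by simp
  qed
  have "filterlim \<sigma> at_top sequentially"
    by (rule filterlim_at_top_mono[OF filterlim_real_sequentially]) (simp add: \<sigma>(1))
  then have "(\<lambda>n. particle_energy q \<mu> (X (\<sigma> n))) \<longlonglongrightarrow> L"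
    by (rule filterlim_compose[OF E(1)])
  then have "L + (v\<^sup>2 / ?N) * h \<le> L" using drop by (rule tendsto_lowerbound) simp
  moreover have "0 < (v\<^sup>2 / ?N) * h" using v h(1) by simp
  ultimately show False by linarith
qed

lemma solution_asymptotics:
  fixes X0 :: "'a ^ 'n::finite"
  assumes X0: "X0 \<in> distinct_configs" and N: "2 \<le> CARD('n)" and sol: "particle_solution q \<mu> X0 {0..} X"
  shows "(SUP t\<in>{0..}. ereal (Max (range (\<lambda>i. norm (X t $ i))))) < \<infinity> \<and>
        0 < (INF t\<in>{0..}. ereal (Min ((\<lambda>(i, j). norm (X t $ i - X t $ j)) ` {(i, j). i \<noteq> j}))) \<and>
        omega_limit X \<noteq> {} \<and> compact (omega_limit X) \<and> connected (omega_limit X) \<and>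
        (\<exists>E_inf. ((\<lambda>t. particle_energy q \<mu> (X t)) \<longlongrightarrow> E_inf) at_top \<and>
                 omega_limit X \<subseteq> critical_configs q \<mu> \<inter> {Y. particle_energy q \<mu> Y = E_inf}) \<and>
        ((\<lambda>t. infdist (X t) (critical_configs q \<mu>)) \<longlongrightarrow> 0) at_top"
proof -
  obtain R \<epsilon> where \<epsilon>: "0 < \<epsilon>" and sepT: "\<And>T X t. solves T X0 X \<Longrightarrow> t \<in> {0..T} \<Longrightarrow> X t \<in> separated R \<epsilon>"
    using solutions_stay_separated[OF X0 N] by metis
  have solT: "solves T X0 X" for T by (rule particle_solution_solves[OF sol]) auto
  have sep: "X t \<in> separated R \<epsilon>" if "0 \<le> t" for t using sepT[OF solT[of t], of t] that by simp
  note S = compact_separated[of R \<epsilon>, where 'n = 'n] sep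
  have "(SUP t\<in>{0..}. ereal (Max (range (\<lambda>i. norm (X t $ i))))) \<le> ereal R"
  proof (rule SUP_least)
    fix t :: real assume "t \<in> {0..}"
    then have "norm (X t) \<le> R" using sep[of t] by (simp add: separated_def)
    then have "norm (X t $ i) \<le> R" for i
      using Finite_Cartesian_Product.norm_nth_le[of "X t" i] by linarith
    then show "ereal (Max (range (\<lambda>i. norm (X t $ i)))) \<le> ereal R" by simp
  qed
  then have 1: "(SUP t\<in>{0..}. ereal (Max (range (\<lambda>i. norm (X t $ i))))) < \<infinity>"
    by (rule le_less_trans) simp
  have "ereal \<epsilon> \<le> (INF t\<in>{0..}. ereal (Min ((\<lambda>(i, j). norm (X t $ i - X t $ j)) ` {(i, j). i \<noteq> j})))"
  proof (rule INF_greatest)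
    fix t :: real assume t: "t \<in> {0..}"
    obtain i0 j0 :: 'n where "i0 \<noteq> j0"
      using N by (metis UNIV_I card_le_Suc0_iff_eq finite not_less_eq_eq numeral_2_eq_2)
    then have "{(i, j). i \<noteq> (j::'n)} \<noteq> {}" by auto
    then have "\<epsilon> \<le> Min ((\<lambda>(i, j). norm (X t $ i - X t $ j)) ` {(i, j). i \<noteq> j})"
      using sep[of t] t by (subst Min_ge_iff) (auto simp: separated_def)
    then show "ereal \<epsilon> \<le> ereal (Min ((\<lambda>(i, j). norm (X t $ i - X t $ j)) ` {(i, j). i \<noteq> j}))" by simp
  qed
  then have 2: "0 < (INF t\<in>{0..}. ereal (Min ((\<lambda>(i, j). norm (X t $ i - X t $ j)) ` {(i, j). i \<noteq> j})))"
    by (rule less_le_trans[rotated]) (use \<epsilon> in simp)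
  have 3: "omega_limit X \<noteq> {}"
    by (rule omega_limit_subsequence[OF S, where \<sigma> = real]) auto
  have 4: "compact (omega_limit X)" by (rule compact_omega_limit[OF S])
  have cont: "continuous_on {0..} X"
    by (rule continuous_on_vector_derivative) (use sol in \<open>auto simp: particle_solution_iff\<close>)
  have 5: "connected (omega_limit X)" by (rule connected_omega_limit[where X = X, OF S cont])
  have "compact (particle_energy q \<mu> ` (separated R \<epsilon> :: ('a ^ 'n) set))"
    by (rule compact_continuous_image[OF continuous_on_particle_energy compact_separated])
  then have "bdd_below (particle_energy q \<mu> ` (separated R \<epsilon> :: ('a ^ 'n) set))"
    by (rule bounded_imp_bdd_below[OF compact_imp_bounded])
  then obtain m where m: "\<And>Z :: 'a ^ 'n. Z \<in> separated R \<epsilon> \<Longrightarrow> m \<le> particle_energy q \<mu> Z"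
    by (auto simp: bdd_below_def)
  obtain L where L: "((\<lambda>t. particle_energy q \<mu> (X t)) \<longlongrightarrow> L) at_top" "\<And>t. 0 \<le> t \<Longrightarrow> L \<le> particle_energy q \<mu> (X t)"
  proof (rule antimono_bounded_below_tendsto[of "\<lambda>t. particle_energy q \<mu> (X t)" m])
    show "particle_energy q \<mu> (X t) \<le> particle_energy q \<mu> (X s)" if "0 \<le> s" "s \<le> t" for s t
      by (rule energy_nonincreasing[OF solT[of t]]) (use that in auto)
  qed (use m sep that in auto)
  have 6: "omega_limit X \<subseteq> critical_configs q \<mu> \<inter> {Y. particle_energy q \<mu> Y = L}"
  proof
    fix Y assume Y: "Y \<in> omega_limit X"
    have "Y \<in> separated R \<epsilon>" by (rule subsetD[OF omega_limit_subset[OF S] Y])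
    then have YD: "Y \<in> distinct_configs" by (rule subsetD[OF separated_subset_distinct_configs[OF \<epsilon>]])
    have "velocity q \<mu> Y = 0" by (rule omega_limit_velocity_zero[OF solT \<epsilon> sep L Y])
    then have "GDERIV (particle_energy q \<mu>) Y :> 0" using GDERIV_particle_energy[OF YD] by simp
    moreover have "particle_energy q \<mu> Y = L"
    proof -
      obtain \<sigma> where \<sigma>: "\<And>n::nat. real n \<le> \<sigma> n" "(\<lambda>n. X (\<sigma> n)) \<longlonglongrightarrow> Y"
        using omega_limit_sequence[OF Y] by blast
      have "filterlim \<sigma> at_top sequentially"
        by (rule filterlim_at_top_mono[OF filterlim_real_sequentially]) (simp add: \<sigma>(1))
      then have "(\<lambda>n. particle_energy q \<mu> (X (\<sigma> n))) \<longlonglongrightarrow> L"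
        by (rule filterlim_compose[OF L(1)])
      moreover have "(\<lambda>n. particle_energy q \<mu> (X (\<sigma> n))) \<longlonglongrightarrow> particle_energy q \<mu> Y"
        by (rule continuous_on_tendsto_compose[OF continuous_on_particle_energy[of UNIV] \<sigma>(2)]) auto
      ultimately show ?thesis by (rule LIMSEQ_unique[rotated])
    qed
    ultimately show "Y \<in> critical_configs q \<mu> \<inter> {Y. particle_energy q \<mu> Y = L}"
      using YD by (simp add: critical_configs_def)
  qed
  then have crit: "omega_limit X \<subseteq> critical_configs q \<mu>" by blast
  have 7: "((\<lambda>t. infdist (X t) (critical_configs q \<mu>)) \<longlongrightarrow> 0) at_top"
    by (rule infdist_omega_limit_tendsto_0[OF S(1) _ crit]) (rule sep)
  show ?thesis using 1 2 3 4 5 6 7 L(1) by blast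
qed

end

theorem theorem1p5:
  fixes q :: real and p :: ereal
    and \<mu> :: "'a::euclidean_space measure"
    and X0 :: "'a ^ 'n::finite"
  assumes q: "0 < q" "q < 2"
    and cases: "case_i DIM('a) q p \<or> case_ii DIM('a) q p \<or> case_iii DIM('a) q p"
    and \<mu>: "\<mu> \<in> prob_moment (max 1 q) \<inter> Lp_measures p"
    and N: "2 \<le> CARD('n)"
    and X0: "X0 \<in> distinct_configs"
  shows
    "(case_i DIM('a) q p \<or> case_ii DIM('a) q p \<longrightarrow>
        (\<exists>X. particle_solution q \<mu> X0 {0..} X \<and>
             (\<forall>Y. particle_solution q \<mu> X0 {0..} Y \<longrightarrow> (\<forall>t\<ge>0. Y t = X t)))) \<and>
     (case_iii DIM('a) q p \<longrightarrow>
        (\<exists>X. particle_solution q \<mu> X0 {0..} X) \<and>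
        (\<forall>T X. maximal_particle_solution q \<mu> X0 T X \<longrightarrow> T = \<infinity>)) \<and>
     (\<forall>X. particle_solution q \<mu> X0 {0..} X \<longrightarrow>
        (SUP t\<in>{0..}. ereal (Max (range (\<lambda>i. norm (X t $ i))))) < \<infinity> \<and>
        0 < (INF t\<in>{0..}. ereal (Min ((\<lambda>(i, j). norm (X t $ i - X t $ j)) ` {(i, j). i \<noteq> j}))) \<and>
        omega_limit X \<noteq> {} \<and> compact (omega_limit X) \<and> connected (omega_limit X) \<and>
        (\<exists>E_inf. ((\<lambda>t. particle_energy q \<mu> (X t)) \<longlongrightarrow> E_inf) at_top \<and>
                 omega_limit X \<subseteq> critical_configs q \<mu> \<inter> {Y. particle_energy q \<mu> Y = E_inf}) \<and>
        ((\<lambda>t. infdist (X t) (critical_configs q \<mu>)) \<longlongrightarrow> 0) at_top)"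
proof -
  have prob: "prob_space \<mu>" and sets: "sets \<mu> = sets borel"
    and moment: "integrable \<mu> (\<lambda>x. norm x powr max 1 q)" and Lp: "\<mu> \<in> Lp_measures p"
    using \<mu> by (auto simp: prob_moment_def)
  obtain \<beta> M where exponent: "0 < \<beta>" "\<beta> \<le> 1" "q - 1 < \<beta>" "case_i DIM('a) q p \<Longrightarrow> \<beta> = 1"
    "\<And>x. integrable \<mu> (\<lambda>y. norm (x - y) powr (q - 1 - \<beta>))"
    "\<And>x. (LINT y|\<mu>. norm (x - y) powr (q - 1 - \<beta>)) \<le> M"
    by (rule subcritical_holder_exponent[OF q cases Lp prob]) (rule that)
  interpret target_measure q \<beta> M \<mu>
    by (rule target_measure.intro)
       (use q exponent prob sets moment Lp_measures_no_atoms[OF Lp] in auto)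
  obtain X where X: "particle_solution q \<mu> X0 {0..} X"
    using global_existence[OF X0 N] by blast
  have unique: "Y t = X t"
    if "case_i DIM('a) q p \<or> case_ii DIM('a) q p" "particle_solution q \<mu> X0 {0..} Y" "0 \<le> t" for Y t
  proof (rule solution_unique[OF X0 N _ X that(2,3)])
    show "\<beta> = 1 \<or> 1 \<le> q" using that(1) exponent(4) by (auto simp: case_ii_def)
  qed
  show ?thesis
  proof (intro conjI impI)
    assume "case_i DIM('a) q p \<or> case_ii DIM('a) q p"
    then show "\<exists>X. particle_solution q \<mu> X0 {0..} X \<and>
        (\<forall>Y. particle_solution q \<mu> X0 {0..} Y \<longrightarrow> (\<forall>t\<ge>0. Y t = X t))"
      using X unique by (intro exI[of _ X]) simp
  next
    show "\<exists>X. particle_solution q \<mu> X0 {0..} X" by (intro exI[of _ X] X)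
  next
    show "\<forall>T X. maximal_particle_solution q \<mu> X0 T X \<longrightarrow> T = \<infinity>"
      using maximal_solution_global[OF X0 N] by simp
  next
    show "\<forall>X. particle_solution q \<mu> X0 {0..} X \<longrightarrow>
        (SUP t\<in>{0..}. ereal (Max (range (\<lambda>i. norm (X t $ i))))) < \<infinity> \<and>
        0 < (INF t\<in>{0..}. ereal (Min ((\<lambda>(i, j). norm (X t $ i - X t $ j)) ` {(i, j). i \<noteq> j}))) \<and>
        omega_limit X \<noteq> {} \<and> compact (omega_limit X) \<and> connected (omega_limit X) \<and>
        (\<exists>E_inf. ((\<lambda>t. particle_energy q \<mu> (X t)) \<longlongrightarrow> E_inf) at_top \<and>
                 omega_limit X \<subseteq> critical_configs q \<mu> \<inter> {Y. particle_energy q \<mu> Y = E_inf}) \<and>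
        ((\<lambda>t. infdist (X t) (critical_configs q \<mu>)) \<longlongrightarrow> 0) at_top"
      by (intro allI impI solution_asymptotics[OF X0 N])
  qed
qed

end
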